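(* Let $X$ be a proper, geodesic, line-convex, Gromov-hyperbolic metric space. Let $\Gamma < \mathrm{Isom}(X)$ be discrete, virtually torsion-free and non-elementary. Assume that $h_{\mathrm{erg}}(X;\Gamma) < +\infty$. Then the topological entropy of the quotient geodesic flow of $\Gamma\backslash X$ equals the critical exponent of $\Gamma$, i.e. $$h_{\mathrm{top}}(\Gamma\backslash \mathrm{Geod}(X),\bar\Phi_1) = h_{\mathrm{crit}}(X;\Gamma).$$
   Context: Let $(X,d)$ be a metric space. $X$ is proper if closed balls are compact. A geodesic line is an isometric embedding $\gamma\colon\mathbb{R}\to X$; a geodesic ray is an isometric embedding $\xi\colon[0,+\infty)\to X$. $X$ is line-convex if for every two geodesic lines $\gamma,\gamma'$ the function $t\mapsto d(\gamma(t),\gamma'(t))$ is convex on $\mathbb{R}$. $X$ is Gromov-hyperbolic if there is $\delta\ge 0$ such that $(x,z)_w\ge\min\{(x,y)_w,(y,z)_w\}-\delta$ for all $x,y,z,w\in X$, where $(y,z)_x=\frac12(d(x,y)+d(x,z)-d(y,z))$. $\partial X$ is its Gromov boundary; $\gamma^{\pm}\in\partial X$ are the endpoints of a geodesic line $\gamma$; $\xi_{x,z}$ denotes a geodesic ray from $x\in X$ to $z\in\partial X$. Groups. $\Gamma<\mathrm{Isom}(X)$ is discrete if for all $x\in X$, $R\ge0$ the set $\{g\in\Gamma: d(x,gx)\le R\}$ is finite. The limit set $\Lambda(\Gamma)\subseteq\partial X$ is the set of accumulation points of an orbit $\Gamma x$; $\Gamma$ is non-elementary if $\#\Lambda(\Gamma)>2$.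 The critical exponent is $h_{\mathrm{crit}}(X;\Gamma)=\limsup_{T\to+\infty}\frac1T\log\#(\Gamma x\cap B(x,T))$, for any $x\in X$ (independent of $x$). Ergodic limit set. Fix $x\in X$. For $\tau>0$ and an increasing sequence of real numbers $\Theta=\{\vartheta_i\}_{i\in\mathbb N}$ with $\vartheta_i\to+\infty$, let $\Lambda_{\tau,\Theta}(\Gamma)$ be the set of $z\in\partial X$ for which there is a geodesic ray $\xi_{x,z}$ such that for every $i\in\mathbb{N}$ there is $t_i\in[\vartheta_i,\vartheta_{i+1}]$ with $d(\xi_{x,z}(t_i),\Gamma x)\le\tau$. Let $\Theta_{\mathrm{erg}}$ be the set of increasing sequences of positive reals $\{\vartheta_i\}$ such that $\lim_{i\to+\infty}\vartheta_i/i$ exists and lies in $(0,+\infty)$. Then $\Lambda_{\mathrm{erg}}(\Gamma)=\bigcup_{\tau>0}\bigcup_{\Theta\in\Theta_{\mathrm{erg}}}\Lambda_{\tau,\Theta}(\Gamma)$. Ergodic entropy. For $C\subseteq\partial X$ let $\mathrm{QC\text{-}Hull}(C)\subseteq X$ be the union of all geodesic lines with both endpoints in $C$. For $B\subseteq X$, $r>0$, $\mathrm{Cov}(B,r)$ is the minimal cardinality of a subset $S\subseteq B$ such that every point of $B$ is at distance $\le r$ from $S$. Then $$h_{\mathrm{erg}}(X;\Gamma)=\lim_{r\to0}\limsup_{T\to+\infty}\frac1T\log\mathrm{Cov}\big(\overline B(x,T)\cap\mathrm{QC\text{-}Hull}(\Lambda_{\mathrm{erg}}(\Gamma)),r\big).$$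 Quotient geodesic flow. $\mathrm{Geod}(X)$ is the space of geodesic lines of $X$ with the topology of uniform convergence on compact subsets of $\mathbb{R}$, and $(\Phi_t\gamma)(\cdot)=\gamma(\cdot+t)$. $\Gamma$ acts by $(g\gamma)(\cdot)=g\gamma(\cdot)$, commuting with $\Phi_t$; $\bar\Phi_t$ is the induced action on $\Gamma\backslash\mathrm{Geod}(X)$. The quotient geodesic flow of $\Gamma\backslash X$ is the dynamical system $(\Gamma\backslash\mathrm{Geod}(X),\bar\Phi_1)$. Topological entropy. For a metrizable space $Y$ and continuous $T\colon Y\to Y$, $$h_{\mathrm{top}}(Y,T)=\inf_{\rho}\sup_K\lim_{r\to0}\limsup_{n\to+\infty}\frac1n\log\mathrm{Cov}_{\rho^n}(K,r),$$ where $\rho$ ranges over metrics inducing the topology of $Y$, $K$ over compact subsets of $Y$, $\rho^n(y,y')=\max_{0\le i\le n-1}\rho(T^iy,T^iy')$, and $\mathrm{Cov}_{\rho^n}(K,r)$ is the minimal number of $\rho^n$-balls of radius $r$ needed to cover $K$. *)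

theory Defs
  imports "HOL-Analysis.Analysis" "HOL-Algebra.Coset"
begin

section \<open>Metric notions\<close>

text \<open>The metric space X is a type of class \<^class>\<open>metric_space\<close>. The properties of X are
  predicates on that type, passed as a type argument.\<close>

definition proper_space :: "'a::metric_space itself \<Rightarrow> bool" where
  "proper_space _ \<longleftrightarrow> (\<forall>(x::'a) r. compact (cball x r))"

definition geodesic_space :: "'a::metric_space itself \<Rightarrow> bool" where
  "geodesic_space _ \<longleftrightarrow>
     (\<forall>x y::'a. \<exists>c::real \<Rightarrow> 'a. c 0 = x \<and> c (dist x y) = y \<and>
        (\<forall>s\<in>{0..dist x y}. \<forall>t\<in>{0..dist x y}. dist (c s) (c t) = \<bar>s - t\<bar>))"

definition geodesic_line :: "(real \<Rightarrow> 'a::metric_space) \<Rightarrow> bool" where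
  "geodesic_line \<gamma> \<longleftrightarrow> (\<forall>s t. dist (\<gamma> s) (\<gamma> t) = \<bar>s - t\<bar>)"

text \<open>Only the values of a ray on the nonnegative reals are meaningful.\<close>

definition geodesic_ray :: "(real \<Rightarrow> 'a::metric_space) \<Rightarrow> bool" where
  "geodesic_ray \<xi> \<longleftrightarrow> (\<forall>s\<ge>0. \<forall>t\<ge>0. dist (\<xi> s) (\<xi> t) = \<bar>s - t\<bar>)"

definition line_convex :: "'a::metric_space itself \<Rightarrow> bool" where
  "line_convex _ \<longleftrightarrow>
     (\<forall>\<gamma> \<gamma>'::real \<Rightarrow> 'a. geodesic_line \<gamma> \<longrightarrow> geodesic_line \<gamma>' \<longrightarrow>
        convex_on UNIV (\<lambda>t. dist (\<gamma> t) (\<gamma>' t)))"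

definition gromov_product :: "'a::metric_space \<Rightarrow> 'a \<Rightarrow> 'a \<Rightarrow> real" where
  "gromov_product x y z = (dist x y + dist x z - dist y z) / 2"

definition gromov_hyperbolic :: "'a::metric_space itself \<Rightarrow> bool" where
  "gromov_hyperbolic _ \<longleftrightarrow>
     (\<exists>\<delta>\<ge>0. \<forall>x y z w::'a.
        gromov_product w x z \<ge> min (gromov_product w x y) (gromov_product w y z) - \<delta>)"

section \<open>Gromov boundary\<close>

text \<open>Boundary points are equivalence classes of sequences converging to infinity. Changing the
  base point \<open>w\<close> changes Gromov products by at most the distance between the two base points.\<close>

definition gromov_seq_rel :: "(nat \<Rightarrow> 'a::metric_space) \<Rightarrow> (nat \<Rightarrow> 'a) \<Rightarrow> bool" where
  "gromov_seq_rel u v \<longleftrightarrow>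
     (\<forall>w. filterlim (\<lambda>(n, m). gromov_product w (u n) (v m)) at_top (sequentially \<times>\<^sub>F sequentially))"

definition gromov_sequences :: "(nat \<Rightarrow> 'a::metric_space) set" where
  "gromov_sequences = {u. gromov_seq_rel u u}"

definition gromov_rel :: "((nat \<Rightarrow> 'a::metric_space) \<times> (nat \<Rightarrow> 'a)) set" where
  "gromov_rel = {(u, v). u \<in> gromov_sequences \<and> v \<in> gromov_sequences \<and> gromov_seq_rel u v}"

definition gromov_boundary :: "(nat \<Rightarrow> 'a::metric_space) set set" where
  "gromov_boundary = gromov_sequences // gromov_rel"

definition pos_endpoint :: "(real \<Rightarrow> 'a::metric_space) \<Rightarrow> (nat \<Rightarrow> 'a) set" where
  "pos_endpoint \<gamma> = gromov_rel `` {\<lambda>n. \<gamma> (real n)}"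

definition neg_endpoint :: "(real \<Rightarrow> 'a::metric_space) \<Rightarrow> (nat \<Rightarrow> 'a) set" where
  "neg_endpoint \<gamma> = gromov_rel `` {\<lambda>n. \<gamma> (- real n)}"

definition ray_from_to :: "(real \<Rightarrow> 'a::metric_space) \<Rightarrow> 'a \<Rightarrow> (nat \<Rightarrow> 'a) set \<Rightarrow> bool" where
  "ray_from_to \<xi> x z \<longleftrightarrow> geodesic_ray \<xi> \<and> \<xi> 0 = x \<and> pos_endpoint \<xi> = z"

definition QC_Hull :: "(nat \<Rightarrow> 'a::metric_space) set set \<Rightarrow> 'a set" where
  "QC_Hull C = (\<Union>\<gamma>\<in>{\<gamma>. geodesic_line \<gamma> \<and> pos_endpoint \<gamma> \<in> C \<and> neg_endpoint \<gamma> \<in> C}. range \<gamma>)"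

section \<open>Groups of isometries\<close>

definition isom_group :: "('a::metric_space \<Rightarrow> 'a) monoid" where
  "isom_group = \<lparr>carrier = {g. bij g \<and> (\<forall>x y. dist (g x) (g y) = dist x y)},
                 monoid.mult = (\<circ>), one = id\<rparr>"

lemma group_isom_group: "group (isom_group :: ('a::metric_space \<Rightarrow> 'a) monoid)"
proof (rule groupI)
  fix g :: "'a \<Rightarrow> 'a"
  assume "g \<in> carrier isom_group"
  then have g: "bij g" "\<And>x y. dist (g x) (g y) = dist x y"
    by (auto simp: isom_group_def)
  have "dist (inv_into UNIV g x) (inv_into UNIV g y) = dist x y" for x y
    using g(2)[of "inv_into UNIV g x" "inv_into UNIV g y"] g(1) by (simp add: bij_is_surj surj_f_inv_f)
  then show "\<exists>h\<in>carrier isom_group. h \<otimes>\<^bsub>isom_group\<^esub> g = \<one>\<^bsub>isom_group\<^esub>"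
    using g(1) by (intro bexI[of _ "inv_into UNIV g"])
      (auto simp: isom_group_def bij_imp_bij_inv bij_is_inj)
qed (auto simp: isom_group_def bij_comp comp_assoc)

definition virtually_torsion_free :: "('g, 'm) monoid_scheme \<Rightarrow> bool" where
  "virtually_torsion_free G \<longleftrightarrow>
     (\<exists>H. subgroup H G \<and> finite (rcosets\<^bsub>G\<^esub> H) \<and>
        (\<forall>h\<in>H. h \<noteq> \<one>\<^bsub>G\<^esub> \<longrightarrow> (\<forall>n::nat. n > 0 \<longrightarrow> h [^]\<^bsub>G\<^esub> n \<noteq> \<one>\<^bsub>G\<^esub>)))"

definition discrete_isometries :: "('a::metric_space \<Rightarrow> 'a) set \<Rightarrow> bool" where
  "discrete_isometries \<Gamma> \<longleftrightarrow> (\<forall>x. \<forall>R\<ge>0. finite {g \<in> \<Gamma>. dist x (g x) \<le> R})"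

definition orbit_of :: "('a \<Rightarrow> 'a) set \<Rightarrow> 'a \<Rightarrow> 'a set" where
  "orbit_of \<Gamma> x = (\<lambda>g. g x) ` \<Gamma>"

text \<open>A sequence in X converges to a boundary point \<open>z\<close> iff it belongs to the class \<open>z\<close>.\<close>

definition limit_set :: "'a::metric_space \<Rightarrow> ('a \<Rightarrow> 'a) set \<Rightarrow> (nat \<Rightarrow> 'a) set set" where
  "limit_set x \<Gamma> = {z \<in> gromov_boundary. \<exists>u\<in>z. range u \<subseteq> orbit_of \<Gamma> x}"

definition non_elementary :: "'a::metric_space \<Rightarrow> ('a \<Rightarrow> 'a) set \<Rightarrow> bool" where
  "non_elementary x \<Gamma> \<longleftrightarrow> infinite (limit_set x \<Gamma>) \<or> card (limit_set x \<Gamma>) > 2"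

text \<open>For discrete \<open>\<Gamma>\<close> the set being counted is finite, and it is nonempty for \<open>T > 0\<close>.\<close>

definition critical_exponent :: "'a::metric_space \<Rightarrow> ('a \<Rightarrow> 'a) set \<Rightarrow> ereal" where
  "critical_exponent x \<Gamma> =
     Limsup at_top (\<lambda>T::real. ereal (1 / T * ln (real (card (orbit_of \<Gamma> x \<inter> ball x T)))))"

section \<open>Ergodic limit set and ergodic entropy\<close>

definition uniform_radial_limit_set ::
    "'a::metric_space \<Rightarrow> ('a \<Rightarrow> 'a) set \<Rightarrow> real \<Rightarrow> (nat \<Rightarrow> real) \<Rightarrow> (nat \<Rightarrow> 'a) set set" where
  "uniform_radial_limit_set x \<Gamma> \<tau> \<theta> =
     {z \<in> gromov_boundary. \<exists>\<xi>. ray_from_to \<xi> x z \<and>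
        (\<forall>i. \<exists>t\<in>{\<theta> i..\<theta> (Suc i)}. 0 \<le> t \<and> infdist (\<xi> t) (orbit_of \<Gamma> x) \<le> \<tau>)}"

definition Theta_erg :: "(nat \<Rightarrow> real) set" where
  "Theta_erg = {\<theta>. strict_mono \<theta> \<and> (\<forall>i. 0 < \<theta> i) \<and> (\<exists>c>0. (\<lambda>i. \<theta> i / real i) \<longlonglongrightarrow> c)}"

definition ergodic_limit_set :: "'a::metric_space \<Rightarrow> ('a \<Rightarrow> 'a) set \<Rightarrow> (nat \<Rightarrow> 'a) set set" where
  "ergodic_limit_set x \<Gamma> = (\<Union>\<tau>\<in>{0<..}. \<Union>\<theta>\<in>Theta_erg. uniform_radial_limit_set x \<Gamma> \<tau> \<theta>)"

text \<open>Covering numbers are \<open>\<infinity>\<close> when there is no finite cover. Conventions: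
  \<open>log 0 = -\<infinity>\<close> and \<open>log \<infinity> = \<infinity>\<close>.\<close>

definition log_enat :: "enat \<Rightarrow> ereal" where
  "log_enat N = (case N of enat k \<Rightarrow> (if k = 0 then -\<infinity> else ereal (ln (real k))) | \<infinity> \<Rightarrow> \<infinity>)"

definition Cov :: "'a::metric_space set \<Rightarrow> real \<Rightarrow> enat" where
  "Cov B r = (INF S\<in>{S. finite S \<and> S \<subseteq> B \<and> (\<forall>b\<in>B. \<exists>s\<in>S. dist b s \<le> r)}. enat (card S))"

text \<open>Covering numbers are antitone in \<open>r\<close>, so the limits for \<open>r\<close> tending to 0 exist in
  \<^typ>\<open>ereal\<close>, here and in the topological entropy.\<close>

definition ergodic_entropy :: "'a::metric_space \<Rightarrow> ('a \<Rightarrow> 'a) set \<Rightarrow> ereal" where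
  "ergodic_entropy x \<Gamma> =
     Lim (at_right 0) (\<lambda>r::real. Limsup at_top (\<lambda>T::real.
       ereal (1 / T) * log_enat (Cov (cball x T \<inter> QC_Hull (ergodic_limit_set x \<Gamma>)) r)))"

section \<open>Topological entropy\<close>

text \<open>The value of \<open>dynamical_metric\<close> at \<open>n = 0\<close> is unspecified and never matters.\<close>

definition dynamical_metric :: "('y \<Rightarrow> 'y) \<Rightarrow> ('y \<Rightarrow> 'y \<Rightarrow> real) \<Rightarrow> nat \<Rightarrow> 'y \<Rightarrow> 'y \<Rightarrow> real" where
  "dynamical_metric T \<rho> n y y' = Max ((\<lambda>i. \<rho> ((T ^^ i) y) ((T ^^ i) y')) ` {..<n})"

definition ball_cover_number :: "'y set \<Rightarrow> ('y \<Rightarrow> 'y \<Rightarrow> real) \<Rightarrow> 'y set \<Rightarrow> real \<Rightarrow> enat" where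
  "ball_cover_number M d K r =
     (INF S\<in>{S. finite S \<and> S \<subseteq> M \<and> K \<subseteq> (\<Union>s\<in>S. Metric_space.mball M d s r)}. enat (card S))"

definition topological_entropy :: "'y topology \<Rightarrow> ('y \<Rightarrow> 'y) \<Rightarrow> ereal" where
  "topological_entropy Y T =
     (INF \<rho>\<in>{\<rho>. Metric_space (topspace Y) \<rho> \<and> Metric_space.mtopology (topspace Y) \<rho> = Y}.
      SUP K\<in>{K. compactin Y K}.
        Lim (at_right 0) (\<lambda>r::real. limsup (\<lambda>n.
          ereal (1 / real n) *
            log_enat (ball_cover_number (topspace Y) (dynamical_metric T \<rho> n) K r))))"

section \<open>The quotient geodesic flow\<close>

definition Geod :: "(real \<Rightarrow> 'a::metric_space) set" where
  "Geod = {\<gamma>. geodesic_line \<gamma>}"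

text \<open>The topology of uniform convergence on compact subsets of the real line.\<close>

definition geod_topology :: "(real \<Rightarrow> 'a::metric_space) topology" where
  "geod_topology = topology (\<lambda>U. U \<subseteq> Geod \<and>
     (\<forall>\<gamma>\<in>U. \<exists>K e. compact K \<and> 0 < e \<and> {\<gamma>'\<in>Geod. \<forall>t\<in>K. dist (\<gamma> t) (\<gamma>' t) < e} \<subseteq> U))"

lemma openin_geod_topology:
  "openin geod_topology U \<longleftrightarrow> U \<subseteq> Geod \<and>
     (\<forall>\<gamma>\<in>U. \<exists>K e. compact K \<and> 0 < e \<and> {\<gamma>'\<in>Geod. \<forall>t\<in>K. dist (\<gamma> t) (\<gamma>' t) < e} \<subseteq> U)"
proof -
  let ?N = "\<lambda>(\<gamma>::real \<Rightarrow> 'a) K e. {\<gamma>'\<in>Geod. \<forall>t\<in>K. dist (\<gamma> t) (\<gamma>' t) < e}"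
  let ?P = "\<lambda>U. U \<subseteq> Geod \<and> (\<forall>\<gamma>\<in>U. \<exists>K e. compact K \<and> 0 < e \<and> ?N \<gamma> K e \<subseteq> U)"
  have inter: "?P (S \<inter> T)" if S: "?P S" and T: "?P T" for S T
  proof (intro conjI ballI)
    show "S \<inter> T \<subseteq> Geod" using S by blast
    fix \<gamma> assume \<gamma>: "\<gamma> \<in> S \<inter> T"
    obtain K e where 1: "compact K" "0 < e" "?N \<gamma> K e \<subseteq> S"
      using bspec[OF conjunct2[OF S] IntD1[OF \<gamma>]] by blast
    obtain L d where 2: "compact L" "0 < d" "?N \<gamma> L d \<subseteq> T"
      using bspec[OF conjunct2[OF T] IntD2[OF \<gamma>]] by blast
    have "?N \<gamma> (K \<union> L) (min e d) \<subseteq> ?N \<gamma> K e \<inter> ?N \<gamma> L d" by auto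
    then have "?N \<gamma> (K \<union> L) (min e d) \<subseteq> S \<inter> T" using 1(3) 2(3) by blast
    then show "\<exists>K e. compact K \<and> 0 < e \<and> ?N \<gamma> K e \<subseteq> S \<inter> T"
      using 1 2 by (intro exI[of _ "K \<union> L"] exI[of _ "min e d"]) (auto simp: compact_Un)
  qed
  have union: "?P (\<Union>\<K>)" if \<K>: "\<forall>S\<in>\<K>. ?P S" for \<K>
  proof (intro conjI ballI)
    show "\<Union>\<K> \<subseteq> Geod" using \<K> by blast
    fix \<gamma> assume "\<gamma> \<in> \<Union>\<K>"
    then obtain S where S: "S \<in> \<K>" "\<gamma> \<in> S" by blast
    obtain K e where "compact K" "0 < e" "?N \<gamma> K e \<subseteq> S"
      using bspec[OF conjunct2[OF bspec[OF \<K> S(1)]] S(2)] by blast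
    moreover have "S \<subseteq> \<Union>\<K>" using S(1) by blast
    ultimately show "\<exists>K e. compact K \<and> 0 < e \<and> ?N \<gamma> K e \<subseteq> \<Union>\<K>"
      by (intro exI[of _ K] exI[of _ e] conjI) (assumption+, rule order_trans)
  qed
  have "istopology ?P"
    unfolding istopology_def
  proof (rule conjI)
    show "\<forall>S T. ?P S \<longrightarrow> ?P T \<longrightarrow> ?P (S \<inter> T)"
      by ((rule allI impI)+, rule inter)
    show "\<forall>\<K>. (\<forall>S\<in>\<K>. ?P S) \<longrightarrow> ?P (\<Union>\<K>)"
      by ((rule allI impI)+, rule union)
  qed
  then show ?thesis unfolding geod_topology_def by (simp only: topology_inverse')
qed

lemma topspace_geod_topology: "topspace geod_topology = Geod"
proof
  show "topspace geod_topology \<subseteq> (Geod :: (real \<Rightarrow> 'a) set)"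
    unfolding topspace_def using openin_geod_topology by blast
  have "openin geod_topology (Geod :: (real \<Rightarrow> 'a) set)"
    unfolding openin_geod_topology by (auto intro!: exI[of _ "{}"] exI[of _ "1::real"])
  then show "(Geod :: (real \<Rightarrow> 'a) set) \<subseteq> topspace geod_topology"
    by (rule openin_subset)
qed

definition geodesic_flow :: "real \<Rightarrow> (real \<Rightarrow> 'a) \<Rightarrow> real \<Rightarrow> 'a" where
  "geodesic_flow s \<gamma> = (\<lambda>t. \<gamma> (t + s))"

definition geod_orbit :: "('a \<Rightarrow> 'a) set \<Rightarrow> (real \<Rightarrow> 'a) \<Rightarrow> (real \<Rightarrow> 'a) set" where
  "geod_orbit \<Gamma> \<gamma> = (\<lambda>g. g \<circ> \<gamma>) ` \<Gamma>"

text \<open>The set of \<open>\<Gamma>\<close>-orbits of geodesic lines with the quotient topology.\<close>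

definition quotient_geod :: "('a::metric_space \<Rightarrow> 'a) set \<Rightarrow> (real \<Rightarrow> 'a) set topology" where
  "quotient_geod \<Gamma> = topology (\<lambda>V. V \<subseteq> geod_orbit \<Gamma> ` Geod \<and>
     openin geod_topology {\<gamma>\<in>Geod. geod_orbit \<Gamma> \<gamma> \<in> V})"

lemma openin_quotient_geod:
  "openin (quotient_geod \<Gamma>) V \<longleftrightarrow> V \<subseteq> geod_orbit \<Gamma> ` Geod \<and>
     openin geod_topology {\<gamma>\<in>Geod. geod_orbit \<Gamma> \<gamma> \<in> V}"
proof -
  let ?pre = "\<lambda>V. {\<gamma>\<in>Geod. geod_orbit \<Gamma> \<gamma> \<in> V}"
  let ?P = "\<lambda>V. V \<subseteq> geod_orbit \<Gamma> ` Geod \<and> openin geod_topology (?pre V)"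
  have "?pre (S \<inter> T) = ?pre S \<inter> ?pre T" for S T by blast
  moreover have "?pre (\<Union>\<K>) = \<Union>(?pre ` \<K>)" for \<K> by blast
  ultimately have "istopology ?P"
    unfolding istopology_def
    by (simp only:) (fastforce simp del: Union_iff)
  then show ?thesis unfolding quotient_geod_def by (simp only: topology_inverse')
qed

lemma quotient_map_geod_orbit: "quotient_map geod_topology (quotient_geod \<Gamma>) (geod_orbit \<Gamma>)"
proof -
  have "{\<gamma>\<in>Geod. geod_orbit \<Gamma> \<gamma> \<in> geod_orbit \<Gamma> ` Geod} = Geod"
    by blast
  then have "openin (quotient_geod \<Gamma>) (geod_orbit \<Gamma> ` Geod)"
    unfolding openin_quotient_geod
    using openin_topspace[of "geod_topology :: (real \<Rightarrow> 'a) topology"]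
    by (simp only: topspace_geod_topology) simp
  then have ts: "topspace (quotient_geod \<Gamma>) = geod_orbit \<Gamma> ` Geod"
    unfolding topspace_def openin_quotient_geod by blast
  show ?thesis
    unfolding quotient_map_def ts topspace_geod_topology by (simp add: openin_quotient_geod)
qed

text \<open>The orbit of the translate by \<open>s\<close> of \<open>\<gamma>\<close> is the image of the orbit of \<open>\<gamma>\<close> under the flow.\<close>

definition quotient_flow :: "real \<Rightarrow> (real \<Rightarrow> 'a) set \<Rightarrow> (real \<Rightarrow> 'a) set" where
  "quotient_flow s \<omega> = geodesic_flow s ` \<omega>"

lemma quotient_flow_geod_orbit:
  "quotient_flow s (geod_orbit \<Gamma> \<gamma>) = geod_orbit \<Gamma> (geodesic_flow s \<gamma>)"
  by (simp add: quotient_flow_def geod_orbit_def geodesic_flow_def image_image comp_def)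

end

(* The deformed quotient metric compact_dist extends to the one-point compactification, so portions
   of an orbit far from the base orbit cost no entropy; convexity shows that a line between its first
   and last visit to a neighbourhood of the orbit of x is determined, up to boundedly many choices, by
   two orbit points. This bounds the entropy by the critical exponent. For the lower bound,
   non-elementarity yields a finite set F of isometries with which arbitrary long elements can be
   concatenated into quasigeodesics. All words in the elements of length at most T then give lines
   staying near the orbit, and the number of words whose lines shadow a given one, modulo the group,
   is at most linear in T per letter, which is negligible against the growth of the alphabet. *)

theory Submission
  imports Defs
begin

section \<open>Gromov products\<close>

text \<open>The entropy is an infimum over all metrics inducing the quotient topology, so the two
  bounds are asymmetric. For the upper bound one well-chosen metric is enough, and it may degenerate
  at infinity. The lower bound must hold for every metric; it helps that the lines built from words
  project into one compact flow-invariant set, on which all these metrics are uniformly comparable.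
  The obstacle in the counting is that orbits close in the quotient at every time are aligned by an
  isometry that depends on the time, because elements of \<Gamma> may move points only slightly.
  Each letter therefore carries a correction term, and discreteness bounds the number of
  corrections. The set F comes from a counting contradiction. Without it some far point y would be
  almost fixed, as seen from x, by all elements up to a large displacement, and two directions away
  from y would generate exponentially many words in a region where discreteness leaves room for
  linearly many.\<close>

lemma gromov_product_commute: "gromov_product w y z = gromov_product w z y"
  by (simp add: gromov_product_def dist_commute)

lemma gromov_product_nonneg: "0 \<le> gromov_product w y z"
  using dist_triangle[of y z w] by (simp add: gromov_product_def dist_commute)

lemma gromov_product_le_dist: "gromov_product w y z \<le> dist w y"
  using dist_triangle[of w z y] by (simp add: gromov_product_def dist_commute)

lemma gromov_product_le_dist2: "gromov_product w y z \<le> dist w z"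
  using gromov_product_le_dist[of w z y] by (simp add: gromov_product_commute)

lemma gromov_product_add: "gromov_product w y z + gromov_product y w z = dist w y"
  by (simp add: gromov_product_def dist_commute field_simps)

lemma gromov_product_change_base: "gromov_product w y z \<le> gromov_product v y z + dist w v"
  using dist_triangle[of w y v] dist_triangle[of w z v]
  by (simp add: gromov_product_def dist_commute field_simps)

lemma gromov_product_change_point: "gromov_product w y z \<le> gromov_product w y' z + dist y y'"
  using dist_triangle[of w y y'] dist_triangle[of y' z y]
  by (simp add: gromov_product_def dist_commute field_simps)

lemma gromov_product_change_point2: "gromov_product w y z \<le> gromov_product w y z' + dist z z'"
  using gromov_product_change_point[of w z y z'] by (simp add: gromov_product_commute)

lemma gromov_product_self [simp]: "gromov_product w y y = dist w y" "gromov_product w w y = 0"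
    "gromov_product w y w = 0"
  by (simp_all add: gromov_product_def dist_commute)

abbreviation ginv :: "('a \<Rightarrow> 'a) \<Rightarrow> 'a \<Rightarrow> 'a" where "ginv \<equiv> inv_into UNIV"

text \<open>The hypotheses for fixed x, \<Gamma> and \<delta>, with functional inverses in place of
  group inverses. \<open>discrete\<close> carries no sign condition on R because a negative R gives
  the empty set.\<close>

locale hyperbolic_group =
  fixes x :: "'a::metric_space" and \<Gamma> :: "('a \<Rightarrow> 'a) set" and \<delta> :: real
  assumes proper: "compact (cball (p::'a) r)"
    and geodesic: "\<exists>c::real \<Rightarrow> 'a. c 0 = p \<and> c (dist p q) = q \<and>
        (\<forall>s\<in>{0..dist p q}. \<forall>t\<in>{0..dist p q}. dist (c s) (c t) = \<bar>s - t\<bar>)"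
    and lines_convex: "geodesic_line \<gamma> \<Longrightarrow> geodesic_line (\<gamma>' :: real \<Rightarrow> 'a) \<Longrightarrow>
        convex_on UNIV (\<lambda>t. dist (\<gamma> t) (\<gamma>' t))"
    and \<delta>_nonneg: "0 \<le> \<delta>"
    and hyperbolic: "min (gromov_product (w::'a) p q) (gromov_product w q r') - \<delta> \<le> gromov_product w p r'"
    and id_\<Gamma>: "id \<in> \<Gamma>"
    and comp_\<Gamma>: "g \<in> \<Gamma> \<Longrightarrow> h \<in> \<Gamma> \<Longrightarrow> g \<circ> h \<in> \<Gamma>"
    and inv_\<Gamma>: "g \<in> \<Gamma> \<Longrightarrow> ginv g \<in> \<Gamma>"
    and bij_\<Gamma>: "g \<in> \<Gamma> \<Longrightarrow> bij g"
    and isom_\<Gamma>: "g \<in> \<Gamma> \<Longrightarrow> dist (g p) (g q) = dist p q"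
    and discrete: "finite {g \<in> \<Gamma>. dist p (g p) \<le> R}"
begin

abbreviation nrm :: "('a \<Rightarrow> 'a) \<Rightarrow> real" where "nrm g \<equiv> dist x (g x)"

abbreviation displ :: "real \<Rightarrow> ('a \<Rightarrow> 'a) set" where "displ R \<equiv> {g \<in> \<Gamma>. nrm g \<le> R}"

lemma inv_app [simp]: "g \<in> \<Gamma> \<Longrightarrow> ginv g (g p) = p" "g \<in> \<Gamma> \<Longrightarrow> g (ginv g p) = p"
  using bij_\<Gamma> by (auto simp: bij_is_inj bij_is_surj surj_f_inv_f)

lemma inv_comp [simp]: "g \<in> \<Gamma> \<Longrightarrow> ginv g \<circ> g = id" "g \<in> \<Gamma> \<Longrightarrow> g \<circ> ginv g = id"
  by (auto simp: fun_eq_iff)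

lemma dist_shift: "g \<in> \<Gamma> \<Longrightarrow> dist (g p) q = dist p (ginv g q)"
  using isom_\<Gamma>[of g p "ginv g q"] by simp

lemma nrm_inv: "g \<in> \<Gamma> \<Longrightarrow> nrm (ginv g) = nrm g"
  using dist_shift[of g x x] by (simp add: dist_commute)

lemma gromov_product_isom: "g \<in> \<Gamma> \<Longrightarrow> gromov_product (g w) (g y) (g z) = gromov_product w y z"
  by (simp add: gromov_product_def isom_\<Gamma>)

text \<open>The parameter is the one at which (a|q)_p and (q|b)_p coincide: both are the mean of
  (a|b)_p and the distance from p to q, so the four-point condition bounds that distance
  directly.\<close>

lemma near_geodesic:
  fixes c :: "real \<Rightarrow> 'a"
  assumes c: "c 0 = a" "c (dist a b) = b"
    and iso: "\<And>s t. s \<in> {0..dist a b} \<Longrightarrow> t \<in> {0..dist a b} \<Longrightarrow> dist (c s) (c t) = \<bar>s - t\<bar>"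
  shows "dist (c (gromov_product a p b)) p \<le> gromov_product p a b + 2 * \<delta>"
proof -
  define u where "u = gromov_product a p b"
  define q where "q = c u"
  have u: "0 \<le> u" "u \<le> dist a b"
    using gromov_product_nonneg gromov_product_le_dist2 by (auto simp: u_def)
  have qa: "dist q a = u" and qb: "dist q b = dist a b - u"
    using iso[of u 0] iso[of u "dist a b"] u c by (auto simp: q_def)
  have "min (gromov_product p a q) (gromov_product p q b) - \<delta> \<le> gromov_product p a b"
    by (rule hyperbolic)
  moreover have "gromov_product p a q = (gromov_product p a b + dist p q) / 2"
    and "gromov_product p q b = (gromov_product p a b + dist p q) / 2"
    using qa qb by (simp_all add: gromov_product_def dist_commute u_def field_simps)
  ultimately show ?thesis by (simp add: q_def u_def dist_commute)
qed

section \<open>Chains with little backtracking\<close>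

text \<open>Local condition for a discrete quasigeodesic: long steps with bounded backtracking at
  every vertex. Indexing by all integers makes it invariant under reversal and leads to complete
  lines instead of rays.\<close>

definition chain :: "real \<Rightarrow> real \<Rightarrow> (int \<Rightarrow> 'a) \<Rightarrow> bool" where
  "chain c l p \<longleftrightarrow> (\<forall>k. gromov_product (p k) (p (k - 1)) (p (k + 1)) \<le> c \<and> l \<le> dist (p k) (p (k + 1)))"

lemma chain_reverse: "chain c l p \<Longrightarrow> chain c l (\<lambda>k. p (- k))"
  unfolding chain_def
proof
  fix k assume *: "\<forall>k. gromov_product (p k) (p (k - 1)) (p (k + 1)) \<le> c \<and> l \<le> dist (p k) (p (k + 1))"
  have "gromov_product (p (- k)) (p (- k - 1)) (p (- k + 1)) \<le> c" "l \<le> dist (p (- k - 1)) (p (- k - 1 + 1))"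
    using * by blast+
  then show "gromov_product (p (- k)) (p (- (k - 1))) (p (- (k + 1))) \<le> c \<and> l \<le> dist (p (- k)) (p (- (k + 1)))"
    by (simp only: minus_diff_eq minus_add_distrib diff_conv_add_uminus minus_minus)
      (simp add: gromov_product_commute dist_commute add.commute)
qed

text \<open>By induction the path from \<open>p (i + 1)\<close> to the far endpoint starts along
  \<open>p (i + 2)\<close> for at least l - c - \<delta>. This exceeds c + \<delta>, so in the
  four-point inequality the minimum must be the other product.\<close>

lemma chain_first:
  assumes ch: "chain c l p" and l: "2 * c + 2 * \<delta> < l" and c: "0 \<le> c"
  shows "gromov_product (p (i + 1)) (p i) (p (i + 1 + int n)) \<le> c + \<delta>"
proof (induction n arbitrary: i)
  case 0
  then show ?case using c \<delta>_nonneg by simp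
next
  case (Suc n)
  let ?m = "p (i + 1 + int (Suc n))"
  have "gromov_product (p (i + 2)) (p (i + 1)) ?m \<le> c + \<delta>"
    using Suc[of "i + 1"] by (simp add: algebra_simps)
  moreover have "l \<le> dist (p (i + 1)) (p (i + 2))"
    using ch[unfolded chain_def, rule_format, of "i + 1"] by (simp add: algebra_simps)
  ultimately have "l - c - \<delta> \<le> gromov_product (p (i + 1)) ?m (p (i + 2))"
    using gromov_product_add[of "p (i + 1)" "p (i + 2)" ?m] by (simp add: gromov_product_commute)
  moreover have "gromov_product (p (i + 1)) (p i) (p (i + 2)) \<le> c"
    using ch[unfolded chain_def, rule_format, of "i + 1"] by (simp add: algebra_simps)
  moreover have "min (gromov_product (p (i + 1)) (p i) ?m) (gromov_product (p (i + 1)) ?m (p (i + 2))) - \<delta>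
      \<le> gromov_product (p (i + 1)) (p i) (p (i + 2))"
    by (rule hyperbolic)
  ultimately show ?case using l by linarith
qed

lemma chain_first':
  assumes "chain c l p" "2 * c + 2 * \<delta> < l" "0 \<le> c" "i < j"
  shows "gromov_product (p (i + 1)) (p i) (p j) \<le> c + \<delta>"
  using chain_first[OF assms(1-3), of i "nat (j - i - 1)"] assms(4) by (simp add: algebra_simps)

lemma chain_last:
  assumes "chain c l p" "2 * c + 2 * \<delta> < l" "0 \<le> c" "i < j"
  shows "gromov_product (p (j - 1)) (p j) (p i) \<le> c + \<delta>"
  using chain_first'[OF chain_reverse[OF assms(1)] assms(2,3), of "- j" "- i"] assms(4)
  by (simp add: algebra_simps)

text \<open>\<open>p i\<close> lies in the direction of \<open>p (k - 1)\<close> as seen from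
  \<open>p k\<close>, whereas \<open>p j\<close> does not. One more use of hyperbolicity costs
  another \<delta>, and the stronger lower bound on l pays for it.\<close>

lemma chain_middle:
  assumes ch: "chain c l p" and l: "2 * c + 3 * \<delta> < l" and c: "0 \<le> c" and "i \<le> k" "k \<le> j"
  shows "gromov_product (p k) (p i) (p j) \<le> c + 2 * \<delta>"
proof (cases "i = k \<or> j = k")
  case True
  then show ?thesis using c \<delta>_nonneg by auto
next
  case False
  with assms have ij: "i < k" "k < j" by auto
  have l': "2 * c + 2 * \<delta> < l" using l \<delta>_nonneg by linarith
  have 1: "gromov_product (p k) (p (k - 1)) (p j) \<le> c + \<delta>"
    using chain_first'[OF ch l' c, of "k - 1" j] ij by simp
  have "gromov_product (p (k - 1)) (p k) (p i) \<le> c + \<delta>"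
    using chain_last[OF ch l' c ij(1)] .
  moreover have "l \<le> dist (p (k - 1)) (p k)"
    using ch[unfolded chain_def, rule_format, of "k - 1"] by simp
  ultimately have 2: "l - c - \<delta> \<le> gromov_product (p k) (p (k - 1)) (p i)"
    using gromov_product_add[of "p (k - 1)" "p k" "p i"] by (simp add: gromov_product_commute)
  have "min (gromov_product (p k) (p (k - 1)) (p i)) (gromov_product (p k) (p i) (p j)) - \<delta>
     \<le> gromov_product (p k) (p (k - 1)) (p j)"
    by (rule hyperbolic)
  with 1 2 l show ?thesis by linarith
qed

text \<open>Every step gains its length l and loses at most twice the backtracking c + \<delta> at
  its end.\<close>

lemma chain_dist:
  assumes ch: "chain c l p" and l: "2 * c + 2 * \<delta> < l" and c: "0 \<le> c"
  shows "(l - 2 * c - 2 * \<delta>) * real n \<le> dist (p i) (p (i + int n))"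
proof (induction n arbitrary: i)
  case (Suc n)
  have "(l - 2 * c - 2 * \<delta>) * real n \<le> dist (p (i + 1)) (p (i + 1 + int n))"
    using Suc .
  moreover have "gromov_product (p (i + 1)) (p i) (p (i + 1 + int n)) \<le> c + \<delta>"
    by (rule chain_first[OF assms])
  moreover have "l \<le> dist (p i) (p (i + 1))"
    using ch by (auto simp: chain_def)
  ultimately show ?case
    by (simp add: gromov_product_def dist_commute algebra_simps)
qed simp

text \<open>The partial products \<open>e\<^sub>0 \<circ> \<dots> \<circ> e\<^sub>k\<^sub>-\<^sub>1\<close> of a bi-infinite sequence, continued to negative
  \<open>k\<close> so that \<open>walk e (k + 1) = walk e k \<circ> e k\<close> throughout.\<close>

definition walk :: "(int \<Rightarrow> 'a \<Rightarrow> 'a) \<Rightarrow> int \<Rightarrow> 'a \<Rightarrow> 'a" where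
  "walk e k = (if 0 \<le> k then rec_nat id (\<lambda>n q. q \<circ> e (int n)) (nat k)
     else rec_nat id (\<lambda>n q. q \<circ> ginv (e (- int n - 1))) (nat (- k)))"

lemma walk_0 [simp]: "walk e 0 = id" by (simp add: walk_def)

lemma walk_Suc:
  assumes "\<And>k. e k \<in> \<Gamma>"
  shows "walk e (k + 1) = walk e k \<circ> e k"
proof (cases "0 \<le> k")
  case True
  then show ?thesis by (simp add: walk_def nat_add_distrib)
next
  case False
  define n where "n = nat (- k - 1)"
  have k: "k = - int (Suc n)" using False by (simp add: n_def)
  have "walk e k = walk e (k + 1) \<circ> ginv (e k)"
  proof -
    have "nat (- k) = Suc n" "- int n - 1 = k" by (simp_all add: k)
    moreover have "walk e (k + 1) = rec_nat id (\<lambda>n q. q \<circ> ginv (e (- int n - 1))) n"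
      by (cases n) (simp_all add: walk_def k nat_add_distrib)
    ultimately show ?thesis using False by (simp add: walk_def)
  qed
  then show ?thesis using assms[of k] by (simp add: comp_assoc)
qed

lemma walk_in:
  assumes "\<And>k. e k \<in> \<Gamma>"
  shows "walk e k \<in> \<Gamma>"
proof -
  have "rec_nat id (\<lambda>n q. q \<circ> e (int n)) n \<in> \<Gamma>"
    "rec_nat id (\<lambda>n q. q \<circ> ginv (e (- int n - 1))) n \<in> \<Gamma>" for n
    by (induction n) (auto simp: id_\<Gamma> assms comp_\<Gamma> inv_\<Gamma>)
  then show ?thesis by (simp add: walk_def)
qed

lemma walk_cong:
  assumes "\<And>i. 0 \<le> i \<Longrightarrow> i < k \<Longrightarrow> e i = e' i" "0 \<le> k"
  shows "walk e k = walk e' k"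
proof -
  have "n \<le> nat k \<Longrightarrow> rec_nat id (\<lambda>n q. q \<circ> e (int n)) n = rec_nat id (\<lambda>n q. q \<circ> e' (int n)) n" for n
    by (induction n) (auto simp: assms(1))
  then show ?thesis using assms(2) by (simp add: walk_def)
qed

lemma walk_dist:
  assumes "\<And>k. e k \<in> \<Gamma>"
  shows "dist (walk e k x) (walk e (k + 1) x) = nrm (e k)"
  by (simp add: walk_Suc[OF assms] isom_\<Gamma>[OF walk_in[OF assms]])

lemma walk_nrm_le:
  assumes "\<And>k. e k \<in> \<Gamma>" "\<And>k. nrm (e k) \<le> L"
  shows "nrm (walk e (int n)) \<le> L * real n"
proof (induction n)
  case (Suc n)
  have "nrm (walk e (int (Suc n))) \<le> nrm (walk e (int n)) + dist (walk e (int n) x) (walk e (int n + 1) x)"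
    using dist_triangle by (simp add: add.commute)
  also have "\<dots> \<le> L * real n + L"
    using Suc assms(2) walk_dist[OF assms(1)] by (intro add_mono) auto
  finally show ?case by (simp add: algebra_simps)
qed simp

text \<open>Translating the vertex \<open>walk e k x\<close> back to x turns its neighbours into
  \<open>ginv (e (k - 1)) x\<close> and \<open>e k x\<close>, so the chain conditions only concern
  consecutive letters.\<close>

lemma walk_chain:
  assumes e: "\<And>k. e k \<in> \<Gamma>"
    and c: "\<And>k. gromov_product x (ginv (e k) x) (e (k + 1) x) \<le> c" and l: "\<And>k. l \<le> nrm (e k)"
  shows "chain c l (\<lambda>k. walk e k x)"
  unfolding chain_def
proof
  fix k
  let ?q = "walk e k"
  have q: "?q \<in> \<Gamma>" by (rule walk_in[OF e])
  have "walk e (k - 1) = ?q \<circ> ginv (e (k - 1))"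
    using walk_Suc[of e, OF e, of "k - 1"] e[of "k - 1"] by (simp add: comp_assoc)
  then have "gromov_product (?q x) (walk e (k - 1) x) (walk e (k + 1) x)
     = gromov_product x (ginv (e (k - 1)) x) (e k x)"
    using gromov_product_isom[OF q] walk_Suc[of e, OF e, of k] by simp
  then show "gromov_product (?q x) (walk e (k - 1) x) (walk e (k + 1) x) \<le> c \<and> l \<le> dist (?q x) (walk e (k + 1) x)"
    using c[of "k - 1"] l walk_dist[OF e] by simp
qed

end

section \<open>Non-elementary groups\<close>

context hyperbolic_group begin

text \<open>The points \<open>ginv w x\<close> lie near a geodesic from x to y and at nearly the
  same distance from x, hence within 2 + 2 * D + 2 * \<delta> of each other. Multiplying by one
  fixed inverse embeds W into a ball of \<Gamma>, which is finite by discreteness.\<close>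

lemma annulus_count:
  assumes W: "W \<subseteq> \<Gamma>" and D: "\<And>w. w \<in> W \<Longrightarrow> gromov_product (ginv w x) x y \<le> D"
    and nrm: "\<And>w. w \<in> W \<Longrightarrow> j \<le> nrm w \<and> nrm w \<le> j + 1"
  shows "finite W \<and> card W \<le> card (displ (2 + 2 * D + 2 * \<delta>))"
proof (cases "W = {}")
  case False
  then obtain w0 where w0: "w0 \<in> W" by blast
  have "inj_on (\<lambda>w. w \<circ> ginv w0) W"
  proof (rule inj_onI)
    fix u v assume "u \<circ> ginv w0 = v \<circ> ginv w0"
    then have "(u \<circ> ginv w0) \<circ> w0 = (v \<circ> ginv w0) \<circ> w0" by simp
    then show "u = v" using w0 W by (simp add: comp_assoc subset_iff)
  qed
  moreover have "(\<lambda>w. w \<circ> ginv w0) ` W \<subseteq> displ (2 + 2 * D + 2 * \<delta>)"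
  proof (rule image_subsetI)
    fix w assume w: "w \<in> W"
    have G: "w \<in> \<Gamma>" "w0 \<in> \<Gamma>" using w w0 W by auto
    let ?p = "ginv w x" and ?q = "ginv w0 x"
    have "j - D \<le> gromov_product x ?p y" "j - D \<le> gromov_product x ?q y"
      using gromov_product_add[of x ?p y] gromov_product_add[of x ?q y]
        D[OF w] D[OF w0] nrm[OF w] nrm[OF w0] nrm_inv[OF G(1)] nrm_inv[OF G(2)] by linarith+
    moreover have "min (gromov_product x ?p y) (gromov_product x y ?q) - \<delta> \<le> gromov_product x ?p ?q"
      by (rule hyperbolic)
    ultimately have "j - D - \<delta> \<le> gromov_product x ?p ?q"
      by (simp add: gromov_product_commute[of x y ?q] min_def split: if_splits)
    then have "dist ?p ?q \<le> 2 + 2 * D + 2 * \<delta>"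
      using nrm[OF w] nrm[OF w0] nrm_inv[OF G(1)] nrm_inv[OF G(2)]
      by (simp add: gromov_product_def)
    moreover have "dist x (w (ginv w0 x)) = dist ?p ?q"
      using dist_shift[OF inv_\<Gamma>[OF G(1)], of x ?q] isom_\<Gamma>[OF G(1), of ?p ?q] G by simp
    ultimately show "w \<circ> ginv w0 \<in> displ (2 + 2 * D + 2 * \<delta>)"
      using G by (simp add: comp_\<Gamma> inv_\<Gamma>)
  qed
  ultimately show ?thesis
    using discrete by (meson card_inj_on_le finite_imageD finite_subset)
qed simp

text \<open>Words in \<open>g1\<close>, \<open>g2\<close> are quasigeodesic and pairwise distinct, while their inverses all move
  \<open>x\<close> to points close to a geodesic from \<open>x\<close> to \<open>y\<close>, of which there are only linearly many.\<close>

lemma free_words_count: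
  assumes g: "g1 \<in> \<Gamma>" "g2 \<in> \<Gamma>" and C: "0 \<le> C" "gromov_product x (g1 x) (g2 x) \<le> C"
    and y: "gromov_product x (g1 x) y \<le> C" "gromov_product x (g2 x) y \<le> C"
    and L: "4 * C + 10 * \<delta> + 1 < l" "l \<le> nrm g1" "l \<le> nrm g2" "nrm g1 \<le> L" "nrm g2 \<le> L"
    and m: "1 \<le> m"
    and K: "\<And>f. f \<in> \<Gamma> \<Longrightarrow> nrm f \<le> L * real m \<Longrightarrow> C + 2 * \<delta> < gromov_product x y (f y)"
  shows "2 ^ m \<le> (nat \<lceil>L * real m\<rceil> + 1) * card (displ (2 + 2 * (C + 2 * \<delta>) + 2 * \<delta>))"
proof -
  define c where "c = C + \<delta>"
  have c: "0 \<le> c" "2 * c + 2 * \<delta> < l" using C L(1) \<delta>_nonneg by (auto simp: c_def)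
  \<comment> \<open>As \<open>a x\<close> diverges from y, \<open>ginv a x\<close> points towards
    \<open>ginv a y\<close>, hence towards y because \<open>ginv a\<close> almost fixes that
    direction; but \<open>b x\<close> diverges from y.\<close>
  have junction: "gromov_product x (ginv a x) (b x) \<le> c" if ab: "a \<in> {g1, g2}" "b \<in> {g1, g2}" for a b
  proof -
    have a: "a \<in> \<Gamma>" "l \<le> nrm a" "nrm a \<le> L" "gromov_product x (a x) y \<le> C" using ab g y L by auto
    have "gromov_product (ginv a x) (ginv a (a x)) (ginv a y) \<le> C"
      using a(4) gromov_product_isom[OF inv_\<Gamma>[OF a(1)]] by simp
    then have 1: "l - C \<le> gromov_product x (ginv a x) (ginv a y)"
      using gromov_product_add[of x "ginv a x" "ginv a y"] nrm_inv[OF a(1)] a by simp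
    have "nrm (ginv a) \<le> L * real m"
      using nrm_inv[OF a(1)] a(3) m mult_left_mono[of 1 "real m" L] zero_le_dist[of x "a x"] by simp
    then have 2: "C + 2 * \<delta> < gromov_product x (ginv a y) y"
      using K[OF inv_\<Gamma>[OF a(1)]] by (simp add: gromov_product_commute)
    have "min (gromov_product x (ginv a x) (ginv a y)) (gromov_product x (ginv a y) y) - \<delta>
        \<le> gromov_product x (ginv a x) y"
      by (rule hyperbolic)
    then have 3: "C + \<delta> < gromov_product x (ginv a x) y" using 1 2 C L(1) \<delta>_nonneg by linarith
    have "gromov_product x (b x) y \<le> C" using ab y by auto
    moreover have "min (gromov_product x (b x) (ginv a x)) (gromov_product x (ginv a x) y) - \<delta>
        \<le> gromov_product x (b x) y"
      by (rule hyperbolic)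
    ultimately show ?thesis using 3 by (simp add: c_def gromov_product_commute)
  qed
  \<comment> \<open>A word of length m is encoded by the set B of positions carrying g1; all other
    positions, also those outside the word, carry g2.\<close>
  define e where "e B k = (if 0 \<le> k \<and> nat k \<in> B then g1 else g2)" for B and k :: int
  have e2: "e B k \<in> {g1, g2}" for B k by (simp add: e_def)
  have e: "e B k \<in> \<Gamma>" for B k using e2[of B k] g by auto
  have el: "l \<le> nrm (e B k)" "nrm (e B k) \<le> L" for B k using e2[of B k] L by auto
  define w where "w B = walk (e B)" for B
  have w: "w B k \<in> \<Gamma>" for B k unfolding w_def by (rule walk_in[OF e])
  have ch: "chain c l (\<lambda>k. w B k x)" for B
    unfolding w_def using e junction e2 el by (intro walk_chain) auto
  have long: "l - c - \<delta> \<le> gromov_product (w B k x) (w B (k + 1) x) (w B (int m) x)" if "k < int m" for B k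
  proof -
    have "gromov_product (w B (k + 1) x) (w B k x) (w B (int m) x) \<le> c + \<delta>"
      by (rule chain_first'[OF ch c(2,1) that])
    moreover have "l \<le> dist (w B k x) (w B (k + 1) x)"
      using walk_dist[of "e B" k, OF e] el(1)[of B k] unfolding w_def by linarith
    ultimately show ?thesis
      using gromov_product_add[of "w B k x" "w B (k + 1) x" "w B (int m) x"] by linarith
  qed
  \<comment> \<open>At the first differing position the two paths leave a common point along
    translates of \<open>g1 x\<close> and \<open>g2 x\<close>, which diverge; a common endpoint
    would force both steps to agree with the direction to it, and so with each other.\<close>
  have "inj_on (\<lambda>B. w B (int m)) (Pow {..<m})"
  proof (rule inj_onI, rule ccontr)
    fix A B assume AB: "A \<in> Pow {..<m}" "B \<in> Pow {..<m}" "w A (int m) = w B (int m)" "A \<noteq> B"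
    define j where "j = (LEAST j. (j \<in> A) \<noteq> (j \<in> B))"
    have j: "(j \<in> A) \<noteq> (j \<in> B)" 
      unfolding j_def by (rule LeastI_ex[of "\<lambda>j. (j \<in> A) \<noteq> (j \<in> B)"]) (use AB(4) in blast)
    then have jm: "int j < int m" using AB by auto
    have "(i \<in> A) = (i \<in> B)" if "i < j" for i
      using not_less_Least[of i "\<lambda>j. (j \<in> A) \<noteq> (j \<in> B)"] that unfolding j_def by blast
    then have eq: "w A (int j) = w B (int j)"
      unfolding w_def by (intro walk_cong) (auto simp: e_def)
    let ?P = "w A (int j) x" and ?z = "w A (int m) x"
    have "l - c - \<delta> \<le> gromov_product ?P (w A (int j + 1) x) ?z"
      "l - c - \<delta> \<le> gromov_product ?P ?z (w B (int j + 1) x)"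
      using long[OF jm, of A] long[OF jm, of B] by (simp_all add: eq AB(3) gromov_product_commute)
    moreover have "min (gromov_product ?P (w A (int j + 1) x) ?z) (gromov_product ?P ?z (w B (int j + 1) x)) - \<delta>
       \<le> gromov_product ?P (w A (int j + 1) x) (w B (int j + 1) x)"
      by (rule hyperbolic)
    moreover have "w A (int j + 1) x = w A (int j) (e A (int j) x)" "w B (int j + 1) x = w A (int j) (e B (int j) x)"
      using walk_Suc[of "e A", OF e] walk_Suc[of "e B", OF e] eq by (simp_all add: w_def)
    then have "gromov_product ?P (w A (int j + 1) x) (w B (int j + 1) x) = gromov_product x (e A (int j) x) (e B (int j) x)"
      using gromov_product_isom[OF w] by simp
    moreover have "gromov_product x (e A (int j) x) (e B (int j) x) \<le> C"
      using j C by (auto simp: e_def gromov_product_commute)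
    ultimately show False using L(1) C(1) \<delta>_nonneg by (simp add: c_def min_def split: if_splits)
  qed
  then have card: "card ((\<lambda>B. w B (int m)) ` Pow {..<m}) = 2 ^ m"
    by (simp add: card_image card_Pow)
  let ?W = "(\<lambda>B. w B (int m)) ` Pow {..<m}" and ?N = "card (displ (2 + 2 * (C + 2 * \<delta>) + 2 * \<delta>))"
  let ?A = "\<lambda>j::nat. {v \<in> ?W. real j \<le> nrm v \<and> nrm v \<le> real j + 1}"
  have wL: "nrm (w B (int m)) \<le> L * real m" for B
    unfolding w_def by (rule walk_nrm_le) (use e el in auto)
  \<comment> \<open>The path of a word starts along \<open>g1 x\<close> or \<open>g2 x\<close>, so
    its endpoint diverges from y and, since the word almost fixes y, also from the image of y.
    Translating back by the word gives the claim.\<close>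
  have gp: "gromov_product (ginv (w B (int m)) x) x y \<le> C + 2 * \<delta>" for B
  proof -
    let ?w = "w B (int m)" and ?p = "w B 1 x"
    have "w B 1 = e B 0" using walk_Suc[of "e B" 0, OF e] by (simp add: w_def)
    then have p: "gromov_product x ?p y \<le> C" using e2[of B 0] y by auto
    have 1: "l - c - \<delta> \<le> gromov_product x ?p (?w x)" using long[of 0 B] m by (simp add: w_def)
    have "min (gromov_product x ?p (?w x)) (gromov_product x (?w x) y) - \<delta> \<le> gromov_product x ?p y"
      by (rule hyperbolic)
    then have 2: "gromov_product x (?w x) y \<le> C + \<delta>"
      using p 1 L(1) C(1) \<delta>_nonneg by (simp add: c_def min_def split: if_splits)
    have "min (gromov_product x (?w x) (?w y)) (gromov_product x (?w y) y) - \<delta> \<le> gromov_product x (?w x) y"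
      by (rule hyperbolic)
    moreover have "C + 2 * \<delta> < gromov_product x (?w y) y"
      using K[OF w wL] by (simp add: gromov_product_commute)
    ultimately have "gromov_product x (?w x) (?w y) \<le> C + 2 * \<delta>" using 2 by linarith
    moreover have "gromov_product (?w (ginv ?w x)) (?w x) (?w y) = gromov_product (ginv ?w x) x y"
      by (rule gromov_product_isom[OF w])
    ultimately show ?thesis using w by simp
  qed
  have "?W \<subseteq> (\<Union>j\<in>{..nat \<lceil>L * real m\<rceil>}. ?A j)"
  proof clarify
    fix B assume B: "B \<subseteq> {..<m}"
    let ?v = "w B (int m)"
    have "nat \<lfloor>nrm ?v\<rfloor> \<le> nat \<lceil>L * real m\<rceil>"
      using wL[of B] by (intro nat_mono) linarith
    moreover have "real (nat \<lfloor>nrm ?v\<rfloor>) \<le> nrm ?v" "nrm ?v \<le> real (nat \<lfloor>nrm ?v\<rfloor>) + 1"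
      using zero_le_dist[of x "?v x"] by linarith+
    ultimately show "?v \<in> (\<Union>j\<in>{..nat \<lceil>L * real m\<rceil>}. ?A j)" using B by blast
  qed
  moreover have A: "finite (?A j) \<and> card (?A j) \<le> ?N" for j
    by (rule annulus_count) (use w gp in auto)
  ultimately have "card ?W \<le> (\<Sum>j\<in>{..nat \<lceil>L * real m\<rceil>}. card (?A j))"
    by (intro order_trans[OF card_mono card_UN_le]) auto
  also have "\<dots> \<le> (\<Sum>j\<in>{..nat \<lceil>L * real m\<rceil>}. ?N)"
    using A by (intro sum_mono) auto
  finally show ?thesis using card by simp
qed

section \<open>Boundary points and separated directions\<close>

lemma gromov_seq_relE:
  assumes "gromov_seq_rel u v"
  obtains N where "\<And>n m. N \<le> n \<Longrightarrow> N \<le> m \<Longrightarrow> Z \<le> gromov_product (w::'a) (u n) (v m)"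
proof -
  have "\<forall>\<^sub>F z in sequentially \<times>\<^sub>F sequentially. Z \<le> (case z of (n, m) \<Rightarrow> gromov_product w (u n) (v m))"
    using assms unfolding gromov_seq_rel_def filterlim_at_top by blast
  then show thesis unfolding eventually_prod_sequentially using that by auto
qed

lemma gromov_seq_relI:
  assumes "\<And>w Z. \<exists>N. \<forall>n\<ge>N. \<forall>m\<ge>N. Z \<le> gromov_product (w::'a) (u n) (v m)"
  shows "gromov_seq_rel u v"
  unfolding gromov_seq_rel_def filterlim_at_top eventually_prod_sequentially
proof (intro allI)
  fix w Z show "\<exists>N. \<forall>m\<ge>N. \<forall>n\<ge>N. Z \<le> (case (n, m) of (n, m) \<Rightarrow> gromov_product w (u n) (v m))"
    using assms[of Z w] by auto
qed

lemma gromov_seq_rel_sym: "gromov_seq_rel u v \<Longrightarrow> gromov_seq_rel v (u :: nat \<Rightarrow> 'a)"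
  by (rule gromov_seq_relI) (metis gromov_product_commute gromov_seq_relE)

lemma gromov_seq_rel_trans:
  assumes "gromov_seq_rel u v" "gromov_seq_rel v s"
  shows "gromov_seq_rel u (s :: nat \<Rightarrow> 'a)"
proof (rule gromov_seq_relI)
  fix w Z
  obtain N where N: "\<And>n m. N \<le> n \<Longrightarrow> N \<le> m \<Longrightarrow> Z + \<delta> \<le> gromov_product (w::'a) (u n) (v m)"
    using gromov_seq_relE[OF assms(1)] by blast
  obtain M where M: "\<And>n m. M \<le> n \<Longrightarrow> M \<le> m \<Longrightarrow> Z + \<delta> \<le> gromov_product (w::'a) (v n) (s m)"
    using gromov_seq_relE[OF assms(2)] by blast
  have "Z \<le> gromov_product w (u n) (s m)" if "max N M \<le> n" "max N M \<le> m" for n m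
    using N[of n "max N M"] M[of "max N M" m] that hyperbolic[of w "u n" "v (max N M)" "s m"] by simp
  then show "\<exists>N. \<forall>n\<ge>N. \<forall>m\<ge>N. Z \<le> gromov_product (w::'a) (u n) (s m)" by blast
qed

text \<open>Inequivalence only provides arbitrarily late pairs with a small product. Late members of
  one sequence have large mutual products, so hyperbolicity transfers the bound from one such pair
  to all late pairs, at the cost of 2 * \<delta> and of the change of base point.\<close>

lemma separated_sequences:
  assumes "gromov_seq_rel u u" "gromov_seq_rel v v" "\<not> gromov_seq_rel u (v :: nat \<Rightarrow> 'a)"
  obtains C N where "\<And>n m. N \<le> n \<Longrightarrow> N \<le> m \<Longrightarrow> gromov_product x (u n) (v m) \<le> C"
proof -
  obtain w Z where wZ: "\<And>N. \<exists>n\<ge>N. \<exists>m\<ge>N. gromov_product w (u n) (v m) < Z"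
    using gromov_seq_relI[of u v] assms(3) by (meson not_le)
  define C where "C = Z + dist x w + 2 * \<delta>"
  obtain N where N: "\<And>n m. N \<le> n \<Longrightarrow> N \<le> m \<Longrightarrow> C + 1 \<le> gromov_product x (u n) (u m)"
    using gromov_seq_relE[OF assms(1)] by blast
  obtain M where M: "\<And>n m. M \<le> n \<Longrightarrow> M \<le> m \<Longrightarrow> C + 1 \<le> gromov_product x (v n) (v m)"
    using gromov_seq_relE[OF assms(2)] by blast
  have "gromov_product x (u i) (v j) \<le> C" if ij: "max N M \<le> i" "max N M \<le> j" for i j
  proof -
    obtain n m where nm: "max N M \<le> n" "max N M \<le> m" "gromov_product w (u n) (v m) < Z" using wZ by blast
    have "gromov_product x (u n) (v m) < Z + dist x w"
      using gromov_product_change_base[of x "u n" "v m" w] nm(3) by linarith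
    moreover have "C + 1 \<le> gromov_product x (u n) (u i)" "C + 1 \<le> gromov_product x (v j) (v m)"
      using N[of n i] M[of j m] ij nm by auto
    ultimately show ?thesis
      using hyperbolic[of x "u n" "u i" "v m"] hyperbolic[of x "u i" "v j" "v m"] \<delta>_nonneg
      by (simp add: C_def min_def split: if_splits)
  qed
  then show thesis using that by blast
qed

text \<open>The class of a boundary point is generated by any of its members, in particular by a
  sequence in the orbit.\<close>

lemma limit_set_gromov_rel:
  assumes "z \<in> limit_set x \<Gamma>"
  obtains u where "range u \<subseteq> orbit_of \<Gamma> x" "gromov_seq_rel u u" "z = {v \<in> gromov_sequences. gromov_seq_rel u v}"
proof -
  obtain u where u: "u \<in> z" "range u \<subseteq> orbit_of \<Gamma> x" and z: "z \<in> gromov_sequences // gromov_rel"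
    using assms by (auto simp: limit_set_def gromov_boundary_def)
  obtain a where a: "a \<in> gromov_sequences" "z = gromov_rel `` {a}" using z by (auto simp: quotient_def)
  have au: "gromov_seq_rel a u" "u \<in> gromov_sequences" using a u by (auto simp: gromov_rel_def)
  have "z = {v \<in> gromov_sequences. gromov_seq_rel a v}" using a by (auto simp: gromov_rel_def)
  also have "\<dots> = {v \<in> gromov_sequences. gromov_seq_rel u v}"
    using au(1) gromov_seq_rel_sym gromov_seq_rel_trans by blast
  finally show thesis using that u au by (simp add: gromov_sequences_def)
qed

text \<open>Orbit sequences tending to three distinct limit points have pairwise bounded products
  while their norms diverge; hence C does not depend on l. Three directions are taken so that,
  whatever y is, two of them diverge from y.\<close>

lemma three_directions:
  assumes "non_elementary x \<Gamma>"
  obtains C where "0 \<le> C" "\<And>l. \<exists>g1\<in>\<Gamma>. \<exists>g2\<in>\<Gamma>. \<exists>g3\<in>\<Gamma>. l \<le> nrm g1 \<and> l \<le> nrm g2 \<and> l \<le> nrm g3 \<and>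
     gromov_product x (g1 x) (g2 x) \<le> C \<and> gromov_product x (g1 x) (g3 x) \<le> C \<and> gromov_product x (g2 x) (g3 x) \<le> C"
proof -
  have "\<exists>T\<subseteq>limit_set x \<Gamma>. card T = 3 \<and> finite T"
  proof (cases "finite (limit_set x \<Gamma>)")
    case True
    then show ?thesis
      using assms obtain_subset_with_card_n[of 3 "limit_set x \<Gamma>"] finite_subset
      unfolding non_elementary_def by (metis Suc_leI eval_nat_numeral(3))
  qed (use infinite_arbitrarily_large in blast)
  then obtain z1 z2 z3 where z: "z1 \<in> limit_set x \<Gamma>" "z2 \<in> limit_set x \<Gamma>" "z3 \<in> limit_set x \<Gamma>"
    "z1 \<noteq> z2" "z1 \<noteq> z3" "z2 \<noteq> z3" by (auto simp: card_3_iff)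
  obtain u1 where u1: "range u1 \<subseteq> orbit_of \<Gamma> x" "gromov_seq_rel u1 u1" "z1 = {v \<in> gromov_sequences. gromov_seq_rel u1 v}"
    using limit_set_gromov_rel[OF z(1)] by blast
  obtain u2 where u2: "range u2 \<subseteq> orbit_of \<Gamma> x" "gromov_seq_rel u2 u2" "z2 = {v \<in> gromov_sequences. gromov_seq_rel u2 v}"
    using limit_set_gromov_rel[OF z(2)] by blast
  obtain u3 where u3: "range u3 \<subseteq> orbit_of \<Gamma> x" "gromov_seq_rel u3 u3" "z3 = {v \<in> gromov_sequences. gromov_seq_rel u3 v}"
    using limit_set_gromov_rel[OF z(3)] by blast
  have ne: "\<not> gromov_seq_rel u v" if "{a \<in> gromov_sequences. gromov_seq_rel u a} \<noteq> {a \<in> gromov_sequences. gromov_seq_rel v a}"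
    for u v :: "nat \<Rightarrow> 'a"
    using that gromov_seq_rel_sym gromov_seq_rel_trans by blast
  obtain C12 N12 where 12: "\<And>n m. N12 \<le> n \<Longrightarrow> N12 \<le> m \<Longrightarrow> gromov_product x (u1 n) (u2 m) \<le> C12"
    using separated_sequences[OF u1(2) u2(2) ne] z u1 u2 by metis
  obtain C13 N13 where 13: "\<And>n m. N13 \<le> n \<Longrightarrow> N13 \<le> m \<Longrightarrow> gromov_product x (u1 n) (u3 m) \<le> C13"
    using separated_sequences[OF u1(2) u3(2) ne] z u1 u3 by metis
  obtain C23 N23 where 23: "\<And>n m. N23 \<le> n \<Longrightarrow> N23 \<le> m \<Longrightarrow> gromov_product x (u2 n) (u3 m) \<le> C23"
    using separated_sequences[OF u2(2) u3(2) ne] z u2 u3 by metis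
  define C where "C = Max {0, C12, C13, C23}"
  show thesis
  proof (rule that[of C])
    fix l
    obtain M1 where M1: "\<And>n m. M1 \<le> n \<Longrightarrow> M1 \<le> m \<Longrightarrow> l \<le> gromov_product x (u1 n) (u1 m)"
      using gromov_seq_relE[OF u1(2)] by blast
    obtain M2 where M2: "\<And>n m. M2 \<le> n \<Longrightarrow> M2 \<le> m \<Longrightarrow> l \<le> gromov_product x (u2 n) (u2 m)"
      using gromov_seq_relE[OF u2(2)] by blast
    obtain M3 where M3: "\<And>n m. M3 \<le> n \<Longrightarrow> M3 \<le> m \<Longrightarrow> l \<le> gromov_product x (u3 n) (u3 m)"
      using gromov_seq_relE[OF u3(2)] by blast
    define n where "n = Max {M1, M2, M3, N12, N13, N23}"
    have "u1 n \<in> orbit_of \<Gamma> x" "u2 n \<in> orbit_of \<Gamma> x" "u3 n \<in> orbit_of \<Gamma> x"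
      using u1 u2 u3 by auto
    then obtain g1 g2 g3 where g: "g1 \<in> \<Gamma>" "g2 \<in> \<Gamma>" "g3 \<in> \<Gamma>" "u1 n = g1 x" "u2 n = g2 x" "u3 n = g3 x"
      unfolding orbit_of_def by blast
    have n: "M1 \<le> n" "M2 \<le> n" "M3 \<le> n" "N12 \<le> n" "N13 \<le> n" "N23 \<le> n" by (auto simp: n_def)
    have C: "C12 \<le> C" "C13 \<le> C" "C23 \<le> C" by (auto simp: C_def)
    have "l \<le> nrm g1" "l \<le> nrm g2" "l \<le> nrm g3"
      using M1[OF n(1) n(1)] M2[OF n(2) n(2)] M3[OF n(3) n(3)] g(4-6) by simp_all
    moreover have "gromov_product x (g1 x) (g2 x) \<le> C" "gromov_product x (g1 x) (g3 x) \<le> C" "gromov_product x (g2 x) (g3 x) \<le> C"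
      using 12[OF n(4) n(4)] 13[OF n(5) n(5)] 23[OF n(6) n(6)] g(4-6) C by simp_all
    ultimately show "\<exists>g1\<in>\<Gamma>. \<exists>g2\<in>\<Gamma>. \<exists>g3\<in>\<Gamma>. l \<le> nrm g1 \<and> l \<le> nrm g2 \<and> l \<le> nrm g3 \<and>
     gromov_product x (g1 x) (g2 x) \<le> C \<and> gromov_product x (g1 x) (g3 x) \<le> C \<and> gromov_product x (g2 x) (g3 x) \<le> C"
      using g by blast
  qed (simp add: C_def)
qed

lemma exponential_beats_linear: "\<exists>m\<ge>1. (nat \<lceil>L * real m\<rceil> + 1) * N < 2 ^ m"
proof -
  define K where "K = (nat \<lceil>\<bar>L\<bar>\<rceil> + 1) * (N + 1)"
  have K: "0 < K" by (simp add: K_def)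
  have "(\<lambda>n. real n * (1/2) ^ n) \<longlonglongrightarrow> 0"
    by (rule powser_times_n_limit_0) simp
  then have "\<forall>\<^sub>F n in sequentially. real n * (1/2) ^ n < 1 / real (2 * K)"
    by (rule order_tendstoD) (use K in simp)
  then obtain n where n: "1 \<le> n" "real n * (1/2) ^ n < 1 / real (2 * K)"
    unfolding eventually_sequentially by (metis nle_le order.refl)
  have "real (2 * K * n) < 2 ^ n"
    using n(2) K by (simp add: field_simps power_divide)
  then have *: "2 * K * n < 2 ^ n" by (metis of_nat_less_iff of_nat_numeral of_nat_power)
  have "L * real n \<le> real (nat \<lceil>\<bar>L\<bar>\<rceil> * n)"
    by (simp add: mult_right_mono) (metis abs_ge_self le_of_int_ceiling mult_right_mono of_nat_0_le_iff order_trans)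
  then have "nat \<lceil>L * real n\<rceil> \<le> nat \<lceil>\<bar>L\<bar>\<rceil> * n" by linarith
  then have "nat \<lceil>L * real n\<rceil> + 1 \<le> (nat \<lceil>\<bar>L\<bar>\<rceil> + 1) * n"
    unfolding add_mult_distrib using n(1) by linarith
  then have "(nat \<lceil>L * real n\<rceil> + 1) * N \<le> ((nat \<lceil>\<bar>L\<bar>\<rceil> + 1) * n) * (N + 1)"
    by (rule mult_mono) simp_all
  also have "\<dots> \<le> 2 * K * n" by (simp add: K_def algebra_simps)
  finally have "(nat \<lceil>L * real n\<rceil> + 1) * N < 2 ^ n" using * by (rule le_less_trans)
  with n(1) show ?thesis by blast
qed

text \<open>If the conclusion failed, there would be points \<open>y\<close> arbitrarily far away which every
  \<open>f \<in> \<Gamma>\<close> of bounded displacement moves only relatively little: \<open>\<Gamma>\<close> almost fixes a direction.\<close>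

lemma extension_set:
  assumes "non_elementary x \<Gamma>"
  obtains c F where "0 \<le> c" "finite F" "F \<subseteq> \<Gamma>" "\<And>y z. \<exists>f\<in>F. gromov_product x y (f z) \<le> c"
proof -
  have "\<exists>k. \<forall>y z. \<exists>f\<in>displ (real k). gromov_product x y (f z) \<le> real k"
  proof (rule ccontr)
    assume "\<not> ?thesis"
    then have neg: "\<exists>y z. \<forall>f\<in>displ (real k). real k < gromov_product x y (f z)" for k
      unfolding not_le[symmetric] by blast
    obtain C where C: "0 \<le> C" and dir: "\<And>l. \<exists>g1\<in>\<Gamma>. \<exists>g2\<in>\<Gamma>. \<exists>g3\<in>\<Gamma>. l \<le> nrm g1 \<and> l \<le> nrm g2 \<and> l \<le> nrm g3 \<and>
     gromov_product x (g1 x) (g2 x) \<le> C \<and> gromov_product x (g1 x) (g3 x) \<le> C \<and> gromov_product x (g2 x) (g3 x) \<le> C"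
      using three_directions[OF assms] by blast
    define C' where "C' = C + \<delta>"
    define l where "l = 4 * C' + 10 * \<delta> + 2"
    obtain g1 g2 g3 where g: "g1 \<in> \<Gamma>" "g2 \<in> \<Gamma>" "g3 \<in> \<Gamma>" "l \<le> nrm g1" "l \<le> nrm g2" "l \<le> nrm g3"
       "gromov_product x (g1 x) (g2 x) \<le> C" "gromov_product x (g1 x) (g3 x) \<le> C" "gromov_product x (g2 x) (g3 x) \<le> C"
      using dir[of l] by blast
    define L where "L = Max {nrm g1, nrm g2, nrm g3}"
    have L: "nrm g1 \<le> L" "nrm g2 \<le> L" "nrm g3 \<le> L" by (auto simp: L_def)
    obtain m where m: "1 \<le> m" "(nat \<lceil>L * real m\<rceil> + 1) * card (displ (2 + 2 * (C' + 2 * \<delta>) + 2 * \<delta>)) < 2 ^ m"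
      using exponential_beats_linear by blast
    \<comment> \<open>Large enough that words of length m lie in \<open>displ (real k)\<close> and
      that the bound in \<open>K\<close> survives the loss of L * m from moving the base point and
      of \<delta> from hyperbolicity.\<close>
    define k where "k = nat \<lceil>L * real m + C' + 4 * \<delta> + 1\<rceil>"
    have k: "L * real m + C' + 4 * \<delta> + 1 \<le> real k" unfolding k_def by (rule real_nat_ceiling_ge)
    obtain y z where yz: "\<And>f. f \<in> displ (real k) \<Longrightarrow> real k < gromov_product x y (f z)"
      using neg by blast
    have Lm: "0 \<le> L * real m" using L(1) by (intro mult_nonneg_nonneg) (auto intro: order_trans[OF zero_le_dist])
    \<comment> \<open>The point \<open>f z\<close> agrees for long with y by the choice of y and z,
      and with \<open>f y\<close> because z agrees with y and f moves the base point by a bounded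
      amount.\<close>
    have K: "C' + 2 * \<delta> < gromov_product x y (f y)" if f: "f \<in> \<Gamma>" "nrm f \<le> L * real m" for f
    proof -
      have 1: "real k < gromov_product x y (f z)" "real k < gromov_product x y z"
        using yz[of f] yz[of id] f k C \<delta>_nonneg Lm by (auto simp: id_\<Gamma> C'_def)
      have "gromov_product x y z = gromov_product (f x) (f y) (f z)"
        using gromov_product_isom[OF f(1)] by simp
      also have "\<dots> \<le> gromov_product x (f y) (f z) + nrm f"
        using gromov_product_change_base[of "f x" "f y" "f z" x] by (simp add: dist_commute)
      finally have "real k - L * real m < gromov_product x (f z) (f y)"
        using 1 f by (simp add: gromov_product_commute)
      then show ?thesis
        using hyperbolic[of x y "f z" "f y"] 1 k \<delta>_nonneg Lm by linarith
    qed
    have two: False if ab: "a \<in> {g1, g2, g3}" "b \<in> {g1, g2, g3}" "gromov_product x (a x) (b x) \<le> C"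
      "gromov_product x (a x) y \<le> C'" "gromov_product x (b x) y \<le> C'" for a b
    proof -
      have "2 ^ m \<le> (nat \<lceil>L * real m\<rceil> + 1) * card (displ (2 + 2 * (C' + 2 * \<delta>) + 2 * \<delta>))"
        by (rule free_words_count[where l = l and y = y and ?g1.0 = a and ?g2.0 = b])
          (use ab g L m K C \<delta>_nonneg in \<open>auto simp: l_def C'_def\<close>)
      then show False using m by linarith
    qed
    \<comment> \<open>Two directions that both follow y would follow each other. So at most one of
      the three fails, and the other two generate the words.\<close>
    have "gromov_product x (a x) y \<le> C' \<or> gromov_product x (b x) y \<le> C'" if "gromov_product x (a x) (b x) \<le> C" for a b
      using hyperbolic[of x "a x" y "b x"] that gromov_product_commute[of x y "b x"] by (auto simp: C'_def min_def split: if_splits)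
    then show False using two[of g1 g2] two[of g1 g3] two[of g2 g3] g by blast
  qed
  then obtain k where "\<And>y z. \<exists>f\<in>displ (real k). gromov_product x y (f z) \<le> real k" by blast
  then show thesis using that[of "real k" "displ (real k)"] discrete by fastforce
qed

end

section \<open>Compactness for geodesic lines\<close>

text \<open>Tychonoff's theorem: the function type carries the topology of pointwise convergence,
  and the set is a product of compact balls.\<close>

lemma compact_growing_functions:
  fixes p :: "'a::metric_space"
  assumes "\<And>r. compact (cball p r)"
  shows "compact {\<gamma> :: real \<Rightarrow> 'a. \<forall>t. dist p (\<gamma> t) \<le> \<bar>t\<bar> + D}"
proof -
  have "compactin (product_topology (\<lambda>t. euclidean) UNIV) (PiE UNIV (\<lambda>t::real. cball p (\<bar>t\<bar> + D)))"
    using assms by (simp add: compactin_PiE)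
  then show ?thesis
    by (simp add: euclidean_product_topology PiE_def Pi_def)
qed

lemma continuous_on_eval: "continuous_on S (\<lambda>\<gamma> :: real \<Rightarrow> 'a::metric_space. \<gamma> t)"
  by (rule continuous_on_product_then_coordinatewise) (rule continuous_on_id)

lemma closed_geodesic_condition: "closed {\<gamma> :: real \<Rightarrow> 'a::metric_space. dist (\<gamma> s) (\<gamma> t) = c}"
  by (intro closed_Collect_eq continuous_on_dist continuous_on_eval continuous_on_const)

lemma closed_dist_le: "closed {\<gamma> :: real \<Rightarrow> 'a::metric_space. dist (\<gamma> t) p \<le> r}"
  by (intro closed_Collect_le continuous_on_dist continuous_on_eval continuous_on_const)

lemma closed_infdist_le: "closed {\<gamma> :: real \<Rightarrow> 'a::metric_space. infdist (\<gamma> t) A \<le> r}"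
  by (intro closed_Collect_le continuous_on_infdist continuous_on_eval continuous_on_const)

text \<open>Geodesic lines are 1-Lipschitz, so pointwise convergence is already uniform on compact
  sets: closeness e / 4 on a finite e / 4-net of K leaves an error below e between the net
  points.\<close>

lemma compactin_geod_topology:
  assumes S: "compact S" "S \<subseteq> (Geod :: (real \<Rightarrow> 'a::metric_space) set)"
  shows "compactin geod_topology S"
proof -
  have "continuous_map (subtopology euclidean Geod) geod_topology (id :: (real \<Rightarrow> 'a) \<Rightarrow> _)"
    unfolding continuous_map_def
  proof (intro conjI allI impI)
    show "id \<in> topspace (top_of_set Geod) \<rightarrow> topspace (geod_topology :: (real \<Rightarrow> 'a) topology)"
      by (simp add: topspace_geod_topology)
    fix U :: "(real \<Rightarrow> 'a) set" assume U: "openin geod_topology U"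
    show "openin (top_of_set Geod) {\<gamma> \<in> topspace (top_of_set Geod). id \<gamma> \<in> U}"
    proof (subst openin_subopen, clarsimp)
      fix \<gamma> :: "real \<Rightarrow> 'a" assume \<gamma>: "\<gamma> \<in> Geod" "\<gamma> \<in> U"
      obtain K e where K: "compact K" "0 < e" "{\<gamma>' \<in> Geod. \<forall>t\<in>K. dist (\<gamma> t) (\<gamma>' t) < e} \<subseteq> U"
        using U \<gamma>(2) unfolding openin_geod_topology by blast
      have "0 < e / 4" using K(2) by simp
      then obtain F where F: "finite F" "K \<subseteq> (\<Union>s\<in>F. ball s (e / 4))"
        using K(1) unfolding compact_eq_totally_bounded by blast
      define V where "V = (\<Inter>s\<in>F. {\<gamma>' :: real \<Rightarrow> 'a. dist (\<gamma>' s) (\<gamma> s) < e / 4})"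
      have "open V" unfolding V_def
        by (intro open_INT F(1) ballI open_Collect_less continuous_on_dist continuous_on_eval continuous_on_const)
      moreover have "\<gamma> \<in> V" using K(2) by (simp add: V_def)
      moreover have "Geod \<inter> V \<subseteq> U"
      proof
        fix \<gamma>' assume \<gamma>': "\<gamma>' \<in> Geod \<inter> V"
        have "dist (\<gamma> t) (\<gamma>' t) < e" if t: "t \<in> K" for t
        proof -
          obtain s where s: "s \<in> F" "dist s t < e / 4" using F(2) t by auto
          have "dist (\<gamma> t) (\<gamma> s) = \<bar>t - s\<bar>" "dist (\<gamma>' s) (\<gamma>' t) = \<bar>s - t\<bar>" "dist (\<gamma>' s) (\<gamma> s) < e / 4"
            using \<gamma>(1) \<gamma>' s(1) by (auto simp: Geod_def geodesic_line_def V_def)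
          then show ?thesis
            using s(2) dist_triangle[of "\<gamma> t" "\<gamma>' t" "\<gamma> s"] dist_triangle[of "\<gamma> s" "\<gamma>' t" "\<gamma>' s"] K(2)
            by (simp add: dist_real_def dist_commute abs_minus_commute[of t s])
        qed
        then show "\<gamma>' \<in> U" using K(3) \<gamma>' by blast
      qed
      ultimately show "\<exists>T. openin (top_of_set Geod) T \<and> \<gamma> \<in> T \<and> T \<subseteq> {\<gamma> \<in> Geod. \<gamma> \<in> U}"
        using \<gamma> by (intro exI[of _ "Geod \<inter> V"]) auto
    qed
  qed
  moreover have "compactin (top_of_set Geod) S"
    using S by (simp add: compactin_subtopology)
  ultimately show ?thesis using image_compactin by fastforce
qed

context hyperbolic_group begin

text \<open>Pointwise limits preserve all the conditions, and the bound at time 0 confines the line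
  at time t to the compact ball of radius \<bar>t\<bar> + r.\<close>

lemma compact_cocompact_lines:
  "compact {\<gamma> \<in> Geod. dist x (\<gamma> 0) \<le> r \<and> (\<forall>t. infdist (\<gamma> t) A \<le> R)}"
proof -
  let ?B = "(\<Inter>s. \<Inter>t. {\<gamma>. dist (\<gamma> s) (\<gamma> t) = \<bar>s - t\<bar>}) \<inter> (\<Inter>t. {\<gamma> :: real \<Rightarrow> 'a. infdist (\<gamma> t) A \<le> R})
    \<inter> {\<gamma>. dist (\<gamma> 0) x \<le> r}"
  have "compact ({\<gamma> :: real \<Rightarrow> 'a. \<forall>t. dist x (\<gamma> t) \<le> \<bar>t\<bar> + r} \<inter> ?B)"
    by (intro compact_Int_closed compact_growing_functions proper closed_Int closed_INT ballI
        closed_geodesic_condition closed_infdist_le closed_dist_le)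
  also have "{\<gamma> :: real \<Rightarrow> 'a. \<forall>t. dist x (\<gamma> t) \<le> \<bar>t\<bar> + r} \<inter> ?B =
    {\<gamma> \<in> Geod. dist x (\<gamma> 0) \<le> r \<and> (\<forall>t. infdist (\<gamma> t) A \<le> R)}"
  proof -
    have "dist x (\<gamma> t) \<le> \<bar>t\<bar> + r" if "\<forall>s t. dist (\<gamma> s) (\<gamma> t) = \<bar>s - t\<bar>" "dist x (\<gamma> 0) \<le> r" for \<gamma> t
      using that(1)[rule_format, of 0 t] that(2) dist_triangle[of x "\<gamma> t" "\<gamma> 0"] by simp
    then show ?thesis by (auto simp: Geod_def geodesic_line_def dist_commute)
  qed
  finally show ?thesis .
qed

text \<open>Geodesic segments from \<open>p (- m)\<close> to \<open>p m\<close> pass within D of all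
  intermediate vertices; parametrised with time 0 next to \<open>p 0\<close>, they subconverge to a
  line. The visits to the vertices are required at natural times, and rounding costs the extra 1 in
  D + 1.\<close>

lemma line_along_chain:
  assumes ch: "chain c l p" and c: "0 \<le> c" and l: "4 * c + 6 * \<delta> + 1 \<le> l"
    and L: "\<And>k. dist (p k) (p (k + 1)) \<le> L"
  defines "D \<equiv> c + 4 * \<delta>"
  obtains \<gamma> where "geodesic_line \<gamma>" "dist (\<gamma> 0) (p 0) \<le> D"
    "\<And>k::nat. \<exists>j::nat. dist (\<gamma> (real j)) (p (int k)) \<le> D + 1"
    "\<And>t. infdist (\<gamma> t) (range p) \<le> L + D"
proof -
  have l1: "2 * c + 2 * \<delta> < l" and l2: "2 * c + 3 * \<delta> < l"
    using c l \<delta>_nonneg by linarith+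
  have D: "0 \<le> D" using c \<delta>_nonneg by (simp add: D_def)
  have lL: "l \<le> L" using ch L[of 0] unfolding chain_def by (meson order_trans)
  then have L1: "1 \<le> L" using l c \<delta>_nonneg by linarith
  \<comment> \<open>A bound for the time of the visit to \<open>p k\<close> that does not depend on
    the segment. It turns the existence of j into a finite union of closed conditions, which
    survives the limit.\<close>
  define J where "J k = nat \<lceil>L * real k\<rceil>" for k
  have J: "L * real k \<le> real (J k)" for k unfolding J_def by (rule real_nat_ceiling_ge)
  have kJ: "k \<le> J k" for k
    using J[of k] mult_right_mono[OF L1, of "real k"] by linarith
  define A where "A m = (\<Inter>s\<in>{-real m..real m}. \<Inter>t\<in>{-real m..real m}. {\<gamma> :: real \<Rightarrow> 'a. dist (\<gamma> s) (\<gamma> t) = \<bar>s - t\<bar>})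
     \<inter> {\<gamma>. dist (\<gamma> 0) (p 0) \<le> D} \<inter> (\<Inter>t\<in>{-real m..real m}. {\<gamma>. infdist (\<gamma> t) (range p) \<le> L + D})
     \<inter> (\<Inter>k\<in>{k. J k \<le> m}. \<Union>j\<in>{..J k}. {\<gamma>. dist (\<gamma> (real j)) (p (int k)) \<le> D + 1})" for m
  let ?K = "{\<gamma> :: real \<Rightarrow> 'a. \<forall>t. dist (p 0) (\<gamma> t) \<le> \<bar>t\<bar> + D}"
  have closed: "closed (A m)" for m
    unfolding A_def
    by (intro closed_Int closed_INT closed_UN ballI closed_geodesic_condition closed_infdist_le closed_dist_le) auto
  have mono: "A m \<subseteq> A n" if "n \<le> m" for n m
  proof -
    have "{-real n..real n} \<subseteq> {-real m..real m}" "{k. J k \<le> n} \<subseteq> {k. J k \<le> m}" using that by auto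
    then show ?thesis unfolding A_def by blast
  qed
  have ne: "?K \<inter> A m \<noteq> {}" for m
  proof -
    define a where "a = p (- int m)"
    define b where "b = p (int m)"
    \<comment> \<open>The parameter at which the segment passes next to \<open>p k\<close>, supplied
      by \<open>near_geodesic\<close>.\<close>
    define u where "u k = gromov_product a (p k) b" for k
    obtain \<sigma> where \<sigma>0: "\<sigma> 0 = a" "\<sigma> (dist a b) = b"
      and \<sigma>: "\<And>s t. s \<in> {0..dist a b} \<Longrightarrow> t \<in> {0..dist a b} \<Longrightarrow> dist (\<sigma> s) (\<sigma> t) = \<bar>s - t\<bar>"
      using geodesic[of a b] by blast
    have near: "dist (\<sigma> (u k)) (p k) \<le> D" if "- int m \<le> k" "k \<le> int m" for k
      using near_geodesic[OF \<sigma>0 \<sigma>, of "p k"] chain_middle[OF ch l2 c that] 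
      by (simp add: u_def a_def b_def D_def)
    have u0: "u (- int m) = 0" "u (int m) = dist a b"
      by (simp_all add: u_def a_def b_def)
    \<comment> \<open>The projections advance by at least 1 per step: the lower bound on l is what
      remains necessary after subtracting 2 * (c + 2 * \<delta>) of backtracking. Hence the segment
      reaches at least m to both sides of \<open>u 0\<close>.\<close>
    have u_mono: "real_of_int (k - j) \<le> u k - u j" if "- int m \<le> j" "j \<le> k" "k \<le> int m" for j k
    proof (cases "j = k")
      case False
      have 1: "gromov_product (p j) a (p k) \<le> c + 2 * \<delta>" "gromov_product (p k) (p j) b \<le> c + 2 * \<delta>"
        unfolding a_def b_def using that by (auto intro!: chain_middle[OF ch l2 c])
      have "(l - 2 * c - 2 * \<delta>) * real (nat (k - j)) \<le> dist (p j) (p (j + int (nat (k - j))))"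
        by (rule chain_dist[OF ch l1 c])
      then have 2: "(l - 2 * c - 2 * \<delta>) * real_of_int (k - j) \<le> dist (p j) (p k)"
        using that by simp
      have "1 \<le> real_of_int (k - j)" using False that by linarith
      then have "(2 * c + 4 * \<delta>) * 1 + 1 * real_of_int (k - j) \<le> (2 * c + 4 * \<delta>) * real_of_int (k - j) + 1 * real_of_int (k - j)"
        using c \<delta>_nonneg by (intro add_mono mult_left_mono) auto
      also have "\<dots> = (2 * c + 4 * \<delta> + 1) * real_of_int (k - j)" by (simp add: algebra_simps)
      also have "\<dots> \<le> (l - 2 * c - 2 * \<delta>) * real_of_int (k - j)"
        using l that by (intro mult_right_mono) auto
      finally have "2 * c + 4 * \<delta> + real_of_int (k - j) \<le> dist (p j) (p k)" using 2 by simp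
      then show ?thesis using 1 by (simp add: u_def gromov_product_def dist_commute field_simps)
    qed simp
    have u_step: "u (k + 1) - u k \<le> L" for k
      using gromov_product_change_point[of a "p (k + 1)" b "p k"] L[of k]
      by (simp add: u_def dist_commute)
    have u_L: "u (int k) - u 0 \<le> L * real k" for k
    proof (induction k)
      case (Suc k)
      then show ?case using u_step[of "int k"] by (simp add: algebra_simps)
    qed simp
    have u_range: "u k \<in> {0..dist a b}" for k
      using gromov_product_nonneg gromov_product_le_dist2 by (auto simp: u_def)
    have um: "real m \<le> u 0" "u 0 + real m \<le> dist a b"
      using u_mono[of "- int m" 0] u_mono[of 0 "int m"] u0 by auto
    \<comment> \<open>Clamping extends the segment to all times without leaving \<open>?K\<close>;
      the isometry condition is only required on the window from - m to m.\<close>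
    define cl where "cl t = max (- real m) (min (real m) t)" for t
    have cl: "cl t = t" if "t \<in> {-real m..real m}" for t using that by (auto simp: cl_def)
    have cl_abs: "\<bar>cl t\<bar> \<le> \<bar>t\<bar>" for t by (auto simp: cl_def)
    have cl_in: "u 0 + cl t \<in> {0..dist a b}" for t using um by (auto simp: cl_def)
    define \<gamma> where "\<gamma> t = \<sigma> (u 0 + cl t)" for t
    have "\<gamma> \<in> ?K"
    proof clarify
      fix t
      have "dist (\<gamma> t) (\<sigma> (u 0)) \<le> \<bar>t\<bar>"
        using \<sigma>[OF cl_in u_range[of 0], of t] cl_abs[of t] by (simp add: \<gamma>_def)
      then show "dist (p 0) (\<gamma> t) \<le> \<bar>t\<bar> + D"
        using near[of 0] dist_triangle[of "p 0" "\<gamma> t" "\<sigma> (u 0)"] by (simp add: dist_commute)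
    qed
    moreover have "dist (\<gamma> s) (\<gamma> t) = \<bar>s - t\<bar>" if "s \<in> {-real m..real m}" "t \<in> {-real m..real m}" for s t
      using \<sigma>[OF cl_in cl_in, of s t] cl that by (simp add: \<gamma>_def)
    moreover have "dist (\<gamma> 0) (p 0) \<le> D" using near[of 0] by (simp add: \<gamma>_def cl_def)
    moreover have "infdist (\<gamma> t) (range p) \<le> L + D" if "t \<in> {-real m..real m}" for t
    proof -
      define v where "v = u 0 + t"
      have v: "v \<in> {0..dist a b}" "\<gamma> t = \<sigma> v" using cl_in[of t] cl[OF that] by (auto simp: v_def \<gamma>_def)
      have "\<exists>k. - int m \<le> k \<and> k \<le> int m \<and> \<bar>v - u k\<bar> \<le> L"
      proof (cases "v = dist a b")
        case True
        then show ?thesis using u0 L1 by (intro exI[of _ "int m"]) auto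
      next
        case False
        let ?P = "\<lambda>n. v < u (- int m + int n)"
        \<comment> \<open>The first projection beyond v. The preceding one is at most L behind v
          because consecutive projections advance by at most L.\<close>
        define n where "n = (LEAST n. ?P n)"
        have P: "?P (2 * m)" using v False u0 by auto
        then have n: "?P n" "n \<le> 2 * m" unfolding n_def by (rule LeastI, rule Least_le)
        then have "n \<noteq> 0" using v u0 by (intro notI) simp
        then obtain n' where n': "n = Suc n'" using not0_implies_Suc by blast
        then have "\<not> ?P n'" using not_less_Least[of n' ?P] unfolding n_def by simp
        moreover have "u (- int m + int n) - u (- int m + int n') \<le> L"
          using u_step[of "- int m + int n'"] n' by (simp add: algebra_simps)
        ultimately show ?thesis using n n' by (intro exI[of _ "- int m + int n'"]) auto
      qed
      then obtain k where k: "- int m \<le> k" "k \<le> int m" "\<bar>v - u k\<bar> \<le> L" by blast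
      have "dist (\<gamma> t) (p k) \<le> L + D"
        using \<sigma>[OF v(1) u_range, of k] k near[OF k(1,2)] dist_triangle[of "\<gamma> t" "p k" "\<sigma> (u k)"] v(2) by simp
      then show ?thesis using infdist_le2[of "p k" "range p"] by blast
    qed
    moreover have "\<exists>j\<in>{..J k}. dist (\<gamma> (real j)) (p (int k)) \<le> D + 1" if "J k \<le> m" for k
    proof -
      define v where "v = u (int k) - u 0"
      have km: "k \<le> m" using kJ[of k] that by linarith
      have v0: "0 \<le> v" using u_mono[of 0 "int k"] km by (simp add: v_def)
      have vJ: "v \<le> real (J k)" using u_L[of k] J[of k] by (simp add: v_def)
      define j where "j = nat \<lfloor>v\<rfloor>"
      have j: "real j \<le> v" "v < real j + 1" using v0 by (auto simp: j_def)
      then have jJ: "j \<le> J k" using vJ by linarith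
      then have "cl (real j) = real j" using that by (intro cl) auto
      then have "dist (\<gamma> (real j)) (\<sigma> (u (int k))) \<le> 1"
        using \<sigma>[OF cl_in u_range, of "real j" "int k"] j by (simp add: \<gamma>_def v_def)
      then have "dist (\<gamma> (real j)) (p (int k)) \<le> D + 1"
        using near[of "int k"] km dist_triangle[of "\<gamma> (real j)" "p (int k)" "\<sigma> (u (int k))"] by simp
      then show ?thesis using jJ by blast
    qed
    ultimately have "\<gamma> \<in> ?K \<inter> A m" unfolding A_def by blast
    then show ?thesis by blast
  qed
  have "?K \<inter> (\<Inter>m\<in>UNIV. A m) \<noteq> {}"
  proof (rule compact_imp_fip_image)
    show "compact ?K" by (rule compact_growing_functions) (rule proper)
    fix I :: "nat set" assume I: "finite I"
    have "A (Max (insert 0 I)) \<subseteq> (\<Inter>m\<in>I. A m)"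
      using I by (intro INT_greatest mono) simp
    then show "?K \<inter> (\<Inter>m\<in>I. A m) \<noteq> {}" using ne by blast
  qed (rule closed)
  then obtain \<gamma> where \<gamma>: "\<And>m. \<gamma> \<in> A m" by blast
  show thesis
  proof (rule that)
    show "geodesic_line \<gamma>"
      unfolding geodesic_line_def
    proof (intro allI)
      fix s t :: real
      let ?m = "nat \<lceil>max \<bar>s\<bar> \<bar>t\<bar>\<rceil>"
      have "s \<in> {-real ?m..real ?m}" "t \<in> {-real ?m..real ?m}"
        using real_nat_ceiling_ge[of "max \<bar>s\<bar> \<bar>t\<bar>"] unfolding atLeastAtMost_iff by linarith+
      then show "dist (\<gamma> s) (\<gamma> t) = \<bar>s - t\<bar>" using \<gamma>[of ?m] unfolding A_def by blast
    qed
    show "dist (\<gamma> 0) (p 0) \<le> D" using \<gamma>[of 0] unfolding A_def by blast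
    show "\<exists>j::nat. dist (\<gamma> (real j)) (p (int k)) \<le> D + 1" for k using \<gamma>[of "J k"] unfolding A_def by blast
    show "infdist (\<gamma> t) (range p) \<le> L + D" for t
    proof -
      have "t \<in> {-real (nat \<lceil>\<bar>t\<bar>\<rceil>)..real (nat \<lceil>\<bar>t\<bar>\<rceil>)}"
        using real_nat_ceiling_ge[of "\<bar>t\<bar>"] unfolding atLeastAtMost_iff by linarith
      then show ?thesis using \<gamma>[of "nat \<lceil>\<bar>t\<bar>\<rceil>"] unfolding A_def by blast
    qed
  qed
qed

end

section \<open>A metric on the quotient of the space of lines\<close>

text \<open>The distance of two lines grows at most linearly, so the quadratic weight makes the
  supremum finite and its tail small. The result metrises uniform convergence on compact sets of
  times.\<close>

definition line_dist :: "(real \<Rightarrow> 'a::metric_space) \<Rightarrow> (real \<Rightarrow> 'a) \<Rightarrow> real" where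
  "line_dist \<gamma> \<gamma>' = (SUP t. dist (\<gamma> t) (\<gamma>' t) / (1 + t\<^sup>2))"

lemma one_plus_square_pos: "0 < 1 + (t::real)\<^sup>2"
  using zero_le_power2[of t] by linarith

lemma twice_abs_le: "2 * \<bar>t\<bar> \<le> 1 + (t::real)\<^sup>2"
  using zero_le_power2[of "\<bar>t\<bar> - 1"] by (simp add: power2_eq_square algebra_simps)

lemma line_dist_commute: "line_dist \<gamma> \<gamma>' = line_dist \<gamma>' \<gamma>"
  by (simp add: line_dist_def dist_commute)

lemma Geod_dist: "\<gamma> \<in> Geod \<Longrightarrow> dist (\<gamma> s) (\<gamma> t) = \<bar>s - t\<bar>"
  by (simp add: Geod_def geodesic_line_def)

lemma Geod_dist_le:
  assumes "\<gamma> \<in> Geod" "\<gamma>' \<in> Geod"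
  shows "dist (\<gamma> t) (\<gamma>' t) \<le> dist (\<gamma> s) (\<gamma>' s) + 2 * \<bar>t - s\<bar>"
  using dist_triangle[of "\<gamma> t" "\<gamma>' t" "\<gamma> s"] dist_triangle[of "\<gamma> s" "\<gamma>' t" "\<gamma>' s"]
    Geod_dist[OF assms(1), of t s] Geod_dist[OF assms(2), of s t]
  by (simp add: abs_minus_commute)

lemma dist_le_line_dist:
  assumes "\<gamma> \<in> Geod" "\<gamma>' \<in> Geod"
  shows "dist (\<gamma> t) (\<gamma>' t) \<le> line_dist \<gamma> \<gamma>' * (1 + t\<^sup>2)"
proof -
  have "dist (\<gamma> t) (\<gamma>' t) / (1 + t\<^sup>2) \<le> dist (\<gamma> 0) (\<gamma>' 0) + 1" for t
  proof -
    have "dist (\<gamma> t) (\<gamma>' t) \<le> dist (\<gamma> 0) (\<gamma>' 0) * 1 + (1 + t\<^sup>2)"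
      using Geod_dist_le[OF assms, of t 0] twice_abs_le[of t] by simp
    also have "\<dots> \<le> dist (\<gamma> 0) (\<gamma>' 0) * (1 + t\<^sup>2) + (1 + t\<^sup>2)"
      by (intro add_right_mono mult_left_mono) auto
    finally show ?thesis using one_plus_square_pos[of t] by (simp add: pos_divide_le_eq algebra_simps)
  qed
  then have "dist (\<gamma> t) (\<gamma>' t) / (1 + t\<^sup>2) \<le> line_dist \<gamma> \<gamma>'"
    unfolding line_dist_def by (intro cSUP_upper bdd_aboveI2) auto
  then show ?thesis using one_plus_square_pos[of t] by (simp add: pos_divide_le_eq)
qed

lemma line_dist_le:
  assumes "\<And>t. dist (\<gamma> t) (\<gamma>' t) \<le> B * (1 + t\<^sup>2)"
  shows "line_dist \<gamma> \<gamma>' \<le> B"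
  unfolding line_dist_def
  by (rule cSUP_least) (use assms one_plus_square_pos in \<open>auto simp: pos_divide_le_eq\<close>)

lemma dist_0_le_line_dist: "\<gamma> \<in> Geod \<Longrightarrow> \<gamma>' \<in> Geod \<Longrightarrow> dist (\<gamma> 0) (\<gamma>' 0) \<le> line_dist \<gamma> \<gamma>'"
  using dist_le_line_dist[of \<gamma> \<gamma>' 0] by simp

lemma line_dist_nonneg: "\<gamma> \<in> Geod \<Longrightarrow> \<gamma>' \<in> Geod \<Longrightarrow> 0 \<le> line_dist \<gamma> \<gamma>'"
  using dist_0_le_line_dist zero_le_dist order_trans by blast

lemma line_dist_triangle:
  assumes "a \<in> Geod" "b \<in> Geod" "c \<in> Geod"
  shows "line_dist a c \<le> line_dist a b + line_dist b c"
proof (rule line_dist_le)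
  fix t
  show "dist (a t) (c t) \<le> (line_dist a b + line_dist b c) * (1 + t\<^sup>2)"
    using dist_triangle[of "a t" "c t" "b t"] dist_le_line_dist[of a b t] dist_le_line_dist[of b c t] assms
    by (simp add: algebra_simps)
qed

lemma line_dist_small:
  assumes r: "0 < r"
  obtains M :: nat and e where "0 < e" "e \<le> r"
    "\<And>\<gamma> \<gamma>' :: real \<Rightarrow> 'a::metric_space. \<gamma> \<in> Geod \<Longrightarrow> \<gamma>' \<in> Geod \<Longrightarrow>
       (\<And>t. \<bar>t\<bar> \<le> real M \<Longrightarrow> dist (\<gamma> t) (\<gamma>' t) \<le> e) \<Longrightarrow> line_dist \<gamma> \<gamma>' < r"
proof -
  \<comment> \<open>Outside the window the distance is at most e + 2 * \<bar>t\<bar> \<le> 3 *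
    \<bar>t\<bar>, and \<bar>t\<bar> \<ge> 6 / r makes this at most r / 2 times the square of
    t.\<close>
  define e where "e = min (r / 2) 1"
  define M where "M = nat \<lceil>max 1 (6 / r)\<rceil>"
  have M: "max 1 (6 / r) \<le> real M" unfolding M_def by (rule real_nat_ceiling_ge)
  show thesis
  proof (rule that[of e M])
    show "0 < e" "e \<le> r" using r by (auto simp: e_def)
    fix \<gamma> \<gamma>' :: "real \<Rightarrow> 'a"
    assume \<gamma>: "\<gamma> \<in> Geod" "\<gamma>' \<in> Geod" and *: "\<And>t. \<bar>t\<bar> \<le> real M \<Longrightarrow> dist (\<gamma> t) (\<gamma>' t) \<le> e"
    have "line_dist \<gamma> \<gamma>' \<le> r / 2"
    proof (rule line_dist_le)
      fix t :: real
      show "dist (\<gamma> t) (\<gamma>' t) \<le> r / 2 * (1 + t\<^sup>2)"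
      proof (cases "\<bar>t\<bar> \<le> real M")
        case True
        have "r / 2 * 1 \<le> r / 2 * (1 + t\<^sup>2)" using r by (intro mult_left_mono) auto
        then show ?thesis using *[OF True] by (simp add: e_def)
      next
        case False
        then have t: "1 \<le> \<bar>t\<bar>" "6 / r \<le> \<bar>t\<bar>" using M by linarith+
        then have "6 \<le> r * \<bar>t\<bar>" using r by (simp add: pos_divide_le_eq mult.commute)
        then have "6 * \<bar>t\<bar> \<le> r * \<bar>t\<bar> * \<bar>t\<bar>" by (rule mult_right_mono) simp
        also have "\<dots> = r * t\<^sup>2" by (simp add: power2_eq_square)
        finally have "3 * \<bar>t\<bar> \<le> r / 2 * t\<^sup>2" by simp
        moreover have "dist (\<gamma> t) (\<gamma>' t) \<le> e + 2 * \<bar>t\<bar>"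
          using Geod_dist_le[OF \<gamma>, of t 0] *[of 0] by simp
        moreover have "e \<le> \<bar>t\<bar>" using t by (simp add: e_def)
        ultimately show ?thesis using r by (simp add: algebra_simps)
      qed
    qed
    then show "line_dist \<gamma> \<gamma>' < r" using r by simp
  qed
qed

text \<open>Uniform continuity of the identity map from \<rho> to \<sigma> on a compact set, by the
  Lebesgue number argument. It lets the lower bound treat arbitrary metrics.\<close>

lemma same_topology_uniform:
  assumes m: "Metric_space M \<rho>" "Metric_space M \<sigma>"
    and top: "Metric_space.mtopology M \<rho> = Metric_space.mtopology M \<sigma>"
    and K: "compactin (Metric_space.mtopology M \<rho>) K" and \<epsilon>: "0 < \<epsilon>"
  obtains r where "0 < r" "\<And>y z. y \<in> K \<Longrightarrow> z \<in> K \<Longrightarrow> \<rho> y z < r \<Longrightarrow> \<sigma> y z < \<epsilon>"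
proof -
  interpret \<rho>: Metric_space M \<rho> by fact
  interpret \<sigma>: Metric_space M \<sigma> by fact
  have KM: "K \<subseteq> M" using K compactin_subset_topspace by fastforce
  have "\<exists>s>0. \<forall>z\<in>M. \<rho> y z < 2 * s \<longrightarrow> \<sigma> y z < \<epsilon> / 2" if y: "y \<in> M" for y
  proof -
    have "openin \<rho>.mtopology (\<sigma>.mball y (\<epsilon> / 2))" unfolding top by (rule \<sigma>.openin_mball)
    then obtain s where "0 < s" "\<rho>.mball y s \<subseteq> \<sigma>.mball y (\<epsilon> / 2)"
      unfolding \<rho>.openin_mtopology using y \<epsilon> by fastforce
    then show ?thesis using y by (intro exI[of _ "s / 2"]) (auto simp: subset_iff)
  qed
  then obtain s where s: "\<And>y. y \<in> M \<Longrightarrow> 0 < s y" "\<And>y z. y \<in> M \<Longrightarrow> z \<in> M \<Longrightarrow> \<rho> y z < 2 * s y \<Longrightarrow> \<sigma> y z < \<epsilon> / 2"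
    by metis
  have "\<exists>\<F>. finite \<F> \<and> \<F> \<subseteq> (\<lambda>y. \<rho>.mball y (s y)) ` K \<and> K \<subseteq> \<Union>\<F>"
    by (rule compactinD[OF K]) (use s(1) KM in auto)
  then obtain \<F> where \<F>: "finite \<F>" "\<F> \<subseteq> (\<lambda>y. \<rho>.mball y (s y)) ` K" "K \<subseteq> \<Union>\<F>" by blast
  obtain F where F: "finite F" "F \<subseteq> K" "K \<subseteq> (\<Union>y\<in>F. \<rho>.mball y (s y))"
    using finite_subset_image[OF \<F>(1,2)] \<F>(3) by blast
  define r where "r = Min (insert 1 (s ` F))"
  have r: "0 < r" "\<And>y. y \<in> F \<Longrightarrow> r \<le> s y" using F s KM by (auto simp: r_def)
  show thesis
  proof (rule that[OF r(1)])
    fix y z assume yz: "y \<in> K" "z \<in> K" "\<rho> y z < r"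
    then obtain p where p: "p \<in> F" "\<rho> p y < s p" using F(3) by auto
    have M: "p \<in> M" "y \<in> M" "z \<in> M" using p yz F(2) KM by auto
    have "\<rho> p z < 2 * s p" using \<rho>.triangle[OF M] p yz(3) r(2)[OF p(1)] by linarith
    moreover have "\<rho> p y < 2 * s p" using p s(1)[OF M(1)] by linarith
    ultimately have "\<sigma> p z < \<epsilon> / 2" "\<sigma> p y < \<epsilon> / 2" using s(2) M by blast+
    then show "\<sigma> y z < \<epsilon>" using \<sigma>.triangle[of y p z] M \<sigma>.commute[of y p] by simp
  qed
qed

context hyperbolic_group begin

section \<open>The metric on orbits of lines and its deformation at infinity\<close>

abbreviation proj :: "(real \<Rightarrow> 'a) \<Rightarrow> (real \<Rightarrow> 'a) set" where "proj \<equiv> geod_orbit \<Gamma>"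

abbreviation orb :: "'a set" where "orb \<equiv> orbit_of \<Gamma> x"

lemma comp_Geod: "g \<in> \<Gamma> \<Longrightarrow> \<gamma> \<in> Geod \<Longrightarrow> g \<circ> \<gamma> \<in> Geod"
  by (simp add: Geod_def geodesic_line_def isom_\<Gamma>)

lemma line_dist_isom: "g \<in> \<Gamma> \<Longrightarrow> line_dist (g \<circ> \<gamma>) (g \<circ> \<gamma>') = line_dist \<gamma> \<gamma>'"
  by (simp add: line_dist_def isom_\<Gamma>)

lemma proj_self: "\<gamma> \<in> proj \<gamma>"
  unfolding geod_orbit_def by (rule image_eqI[of _ _ id]) (simp_all add: id_\<Gamma>)

lemma proj_comp:
  assumes g: "g \<in> \<Gamma>" shows "proj (g \<circ> \<gamma>) = proj \<gamma>"
proof -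
  have 1: "h \<circ> \<gamma> = (h \<circ> ginv g) \<circ> (g \<circ> \<gamma>)" for h using g by (auto simp: fun_eq_iff)
  have 2: "h \<circ> (g \<circ> \<gamma>) = (h \<circ> g) \<circ> \<gamma>" for h by (simp add: comp_assoc)
  have "h \<circ> \<gamma> \<in> proj (g \<circ> \<gamma>)" "h \<circ> (g \<circ> \<gamma>) \<in> proj \<gamma>" if "h \<in> \<Gamma>" for h
    unfolding geod_orbit_def
    by (rule image_eqI[where x = "h \<circ> ginv g"], rule 1, rule comp_\<Gamma>[OF that inv_\<Gamma>[OF g]])
      (rule image_eqI[where x = "h \<circ> g"], rule 2, rule comp_\<Gamma>[OF that g])
  then show ?thesis unfolding geod_orbit_def by blast
qed

lemma topspace_quotient: "topspace (quotient_geod \<Gamma>) = proj ` Geod"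
  using quotient_map_geod_orbit[of \<Gamma>] by (simp add: quotient_map_def topspace_geod_topology)

definition quotient_dist :: "(real \<Rightarrow> 'a) set \<Rightarrow> (real \<Rightarrow> 'a) set \<Rightarrow> real" where
  "quotient_dist \<omega> \<omega>' = Inf {line_dist a b | a b. a \<in> \<omega> \<and> b \<in> \<omega>'}"

text \<open>Closeness of lines at time 0 and discreteness leave only finitely many g with
  \<open>line_dist a (g \<circ> b)\<close> at most \<open>line_dist a b\<close>, so the infimum is
  attained.\<close>

lemma quotient_dist_min:
  assumes ab: "a \<in> Geod" "b \<in> Geod"
  shows "\<exists>g\<in>\<Gamma>. quotient_dist (proj a) (proj b) = line_dist a (g \<circ> b)" (is ?A)
    and "quotient_dist (proj a) (proj b) \<le> line_dist a b" (is ?B)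
proof -
  define S where "S = {g \<in> \<Gamma>. line_dist a (g \<circ> b) \<le> line_dist a b}"
  have "S \<subseteq> {g \<in> \<Gamma>. dist (b 0) (g (b 0)) \<le> dist (b 0) (a 0) + line_dist a b}"
  proof
    fix g assume g: "g \<in> S"
    then have "dist (a 0) ((g \<circ> b) 0) \<le> line_dist a b"
      using dist_0_le_line_dist[OF ab(1) comp_Geod[OF _ ab(2)], of g] by (auto simp: S_def)
    then show "g \<in> {g \<in> \<Gamma>. dist (b 0) (g (b 0)) \<le> dist (b 0) (a 0) + line_dist a b}"
      using g dist_triangle[of "b 0" "g (b 0)" "a 0"] by (auto simp: S_def)
  qed
  then have S: "finite S" "id \<in> S"
    using finite_subset[OF _ discrete] id_\<Gamma> by (blast, simp add: S_def)
  have "\<exists>g\<in>S. \<forall>h\<in>S. line_dist a (g \<circ> b) \<le> line_dist a (h \<circ> b)"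
  proof -
    have "Min ((\<lambda>g. line_dist a (g \<circ> b)) ` S) \<in> (\<lambda>g. line_dist a (g \<circ> b)) ` S"
      using S by (intro Min_in) auto
    then obtain g where "g \<in> S" "line_dist a (g \<circ> b) = Min ((\<lambda>g. line_dist a (g \<circ> b)) ` S)" by auto
    then show ?thesis using S by (intro bexI[of _ g]) auto
  qed
  then obtain g where g: "g \<in> S" and min: "\<And>h. h \<in> S \<Longrightarrow> line_dist a (g \<circ> b) \<le> line_dist a (h \<circ> b)" by blast
  have min': "line_dist a (g \<circ> b) \<le> line_dist a (h \<circ> b)" if "h \<in> \<Gamma>" for h
  proof (cases "h \<in> S")
    case False
    then show ?thesis using min[OF S(2)] that by (auto simp: S_def)
  qed (rule min)
  have "quotient_dist (proj a) (proj b) = line_dist a (g \<circ> b)"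
    unfolding quotient_dist_def
  proof (rule cInf_eq_minimum)
    show "line_dist a (g \<circ> b) \<in> {line_dist a' b' |a' b'. a' \<in> proj a \<and> b' \<in> proj b}"
    proof -
      have "g \<circ> b \<in> proj b" using g by (auto simp: geod_orbit_def S_def)
      then show ?thesis using proj_self by blast
    qed
    fix z assume "z \<in> {line_dist a' b' |a' b'. a' \<in> proj a \<and> b' \<in> proj b}"
    then obtain h k where hk: "h \<in> \<Gamma>" "k \<in> \<Gamma>" "z = line_dist (h \<circ> a) (k \<circ> b)"
      by (auto simp: geod_orbit_def)
    have "z = line_dist (ginv h \<circ> (h \<circ> a)) (ginv h \<circ> (k \<circ> b))"
      using hk line_dist_isom[OF inv_\<Gamma>[OF hk(1)]] by simp
    also have "\<dots> = line_dist a ((ginv h \<circ> k) \<circ> b)"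
      using hk(1) by (simp add: comp_assoc[symmetric])
    finally show "line_dist a (g \<circ> b) \<le> z" using min' hk comp_\<Gamma> inv_\<Gamma> by simp
  qed
  then show ?A ?B using g min[OF S(2)] by (auto simp: S_def)
qed

text \<open>The choice of representative is immaterial because the distance to \<open>orb\<close> is
  invariant under \<Gamma>.\<close>

definition height :: "(real \<Rightarrow> 'a) set \<Rightarrow> real" where
  "height \<omega> = infdist ((SOME \<gamma>. \<gamma> \<in> \<omega>) 0) orb"

lemma orb_image:
  assumes g: "g \<in> \<Gamma>" shows "g ` orb = orb"
proof -
  have "h x \<in> g ` orb" "g (h x) \<in> orb" if h: "h \<in> \<Gamma>" for h
  proof -
    have "(ginv g \<circ> h) x \<in> orb" "(g \<circ> h) x \<in> orb"
      unfolding orbit_of_def using comp_\<Gamma>[OF inv_\<Gamma>[OF g] h] comp_\<Gamma>[OF g h] by blast+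
    then show "h x \<in> g ` orb" "g (h x) \<in> orb" using g by (auto intro: image_eqI[of _ g "ginv g (h x)"])
  qed
  then show ?thesis unfolding orbit_of_def by blast
qed

lemma orb_nonempty [simp]: "orb \<noteq> {}" using id_\<Gamma> by (auto simp: orbit_of_def)

lemma infdist_orb_le:
  assumes g: "g \<in> \<Gamma>" shows "infdist (g p) orb \<le> infdist p orb"
  unfolding infdist_notempty[OF orb_nonempty, of p]
proof (rule cINF_greatest)
  fix q assume "q \<in> orb"
  then have "g q \<in> orb" using orb_image[OF g] by blast
  then show "infdist (g p) orb \<le> dist p q" using infdist_le[of "g q" orb "g p"] isom_\<Gamma>[OF g] by simp
qed simp

lemma infdist_orb: "g \<in> \<Gamma> \<Longrightarrow> infdist (g p) orb = infdist p orb"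
  using infdist_orb_le[of g p] infdist_orb_le[OF inv_\<Gamma>, of g "g p"] by simp

lemma height_proj: "height (proj \<gamma>) = infdist (\<gamma> 0) orb"
proof -
  have "(SOME a. a \<in> proj \<gamma>) \<in> proj \<gamma>" by (rule someI[of _ \<gamma>]) (rule proj_self)
  then show ?thesis by (auto simp: height_def geod_orbit_def infdist_orb)
qed

text \<open>Plays the role of the distance to the point added at infinity; a sum of two weights is
  the length of the detour through that point.\<close>

definition weight :: "(real \<Rightarrow> 'a) set \<Rightarrow> real" where
  "weight \<omega> = 1 / (1 + height \<omega>)"

text \<open>The quotient metric deformed near infinity so that it extends to the one-point
  compactification of the quotient.\<close>

definition compact_dist :: "(real \<Rightarrow> 'a) set \<Rightarrow> (real \<Rightarrow> 'a) set \<Rightarrow> real" where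
  "compact_dist \<omega> \<omega>' = (if \<omega> \<in> proj ` Geod \<and> \<omega>' \<in> proj ` Geod
     then min (quotient_dist \<omega> \<omega>') (weight \<omega> + weight \<omega>') else 0)"

lemma height_nonneg: "0 \<le> height \<omega>" by (simp add: height_def infdist_nonneg)

lemma weight_pos: "0 < weight \<omega>"
  using height_nonneg[of \<omega>] by (simp add: weight_def)

lemma quotient_dist_nonneg: "a \<in> Geod \<Longrightarrow> b \<in> Geod \<Longrightarrow> 0 \<le> quotient_dist (proj a) (proj b)"
  using quotient_dist_min(1)[of a b] line_dist_nonneg comp_Geod by metis

text \<open>Both the height and the map s to 1 / (1 + s) on nonnegative s are 1-Lipschitz. This is
  the triangle inequality with one vertex at infinity, needed for
  \<open>compact_dist\<close>.\<close>

lemma weight_le: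
  assumes ab: "a \<in> Geod" "b \<in> Geod"
  shows "weight (proj a) \<le> weight (proj b) + quotient_dist (proj a) (proj b)"
proof -
  obtain g where g: "g \<in> \<Gamma>" "quotient_dist (proj a) (proj b) = line_dist a (g \<circ> b)"
    using quotient_dist_min(1)[OF ab] by blast
  let ?u = "height (proj a)" and ?v = "height (proj b)" and ?d = "quotient_dist (proj a) (proj b)"
  have "?v \<le> ?u + dist (g (b 0)) (a 0)"
    using infdist_triangle[of "g (b 0)" orb "a 0"] infdist_orb[OF g(1), of "b 0"] by (simp add: height_proj)
  also have "dist (g (b 0)) (a 0) \<le> ?d"
    using dist_0_le_line_dist[OF ab(1) comp_Geod[OF g(1) ab(2)]] g(2) by (simp add: dist_commute)
  finally have vu: "?v \<le> ?u + ?d" by simp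
  have u: "0 \<le> ?u" "0 \<le> ?v" "0 \<le> ?d" using height_nonneg quotient_dist_nonneg[OF ab] by auto
  have "1 / (1 + ?u) - 1 / (1 + ?v) = (?v - ?u) / ((1 + ?u) * (1 + ?v))"
    using u by (simp add: field_simps)
  also have "\<dots> \<le> ?d / ((1 + ?u) * (1 + ?v))"
    using vu u by (intro divide_right_mono) auto
  also have "\<dots> \<le> ?d / 1"
  proof (rule divide_left_mono)
    show "1 \<le> (1 + ?u) * (1 + ?v)" using u mult_mono[of 1 "1 + ?u" 1 "1 + ?v"] by simp
    then show "0 < (1 + ?u) * (1 + ?v) * 1" by simp
  qed (rule u(3))
  finally show ?thesis by (simp add: weight_def)
qed

lemma quotient_dist_commute: "quotient_dist \<omega> \<omega>' = quotient_dist \<omega>' \<omega>"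
  unfolding quotient_dist_def by (intro arg_cong[of _ _ Inf]) (use line_dist_commute in blast)

lemma quotient_dist_triangle:
  assumes "a \<in> Geod" "b \<in> Geod" "c \<in> Geod"
  shows "quotient_dist (proj a) (proj c) \<le> quotient_dist (proj a) (proj b) + quotient_dist (proj b) (proj c)"
proof -
  obtain g where g: "g \<in> \<Gamma>" "quotient_dist (proj a) (proj b) = line_dist a (g \<circ> b)"
    using quotient_dist_min(1) assms by blast
  obtain h where h: "h \<in> \<Gamma>" "quotient_dist (proj b) (proj c) = line_dist b (h \<circ> c)"
    using quotient_dist_min(1) assms by blast
  have "quotient_dist (proj a) (proj c) = quotient_dist (proj a) (proj (g \<circ> (h \<circ> c)))"
    using g h by (simp add: proj_comp)
  also have "\<dots> \<le> line_dist a (g \<circ> (h \<circ> c))"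
    using g h assms by (intro quotient_dist_min(2) comp_Geod)
  also have "\<dots> \<le> line_dist a (g \<circ> b) + line_dist (g \<circ> b) (g \<circ> (h \<circ> c))"
    using g h assms by (intro line_dist_triangle comp_Geod)
  finally show ?thesis using g h by (simp add: line_dist_isom)
qed

lemma Metric_space_compact_dist: "Metric_space (proj ` Geod) compact_dist"
proof
  \<comment> \<open>Nonnegativity and symmetry are required for all arguments, also outside the
    carrier; the default value 0 of \<open>compact_dist\<close> provides them there.\<close>
  fix \<omega> \<omega>' show "0 \<le> compact_dist \<omega> \<omega>'"
    using weight_pos[of \<omega>] weight_pos[of \<omega>'] by (auto simp: compact_dist_def quotient_dist_nonneg)
  show "compact_dist \<omega> \<omega>' = compact_dist \<omega>' \<omega>"
    by (simp add: compact_dist_def quotient_dist_commute add.commute)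
next
  fix \<omega> \<omega>' assume "\<omega> \<in> proj ` Geod" "\<omega>' \<in> proj ` Geod"
  then obtain a b where ab: "a \<in> Geod" "b \<in> Geod" "\<omega> = proj a" "\<omega>' = proj b" by blast
  show "(compact_dist \<omega> \<omega>' = 0) = (\<omega> = \<omega>')"
  proof
    assume "compact_dist \<omega> \<omega>' = 0"
    then have "quotient_dist \<omega> \<omega>' = 0"
      using ab weight_pos[of \<omega>] weight_pos[of \<omega>'] by (auto simp: compact_dist_def min_def split: if_splits)
    then obtain g where g: "g \<in> \<Gamma>" "line_dist a (g \<circ> b) = 0"
      using quotient_dist_min(1)[of a b] ab by auto
    have "a t = (g \<circ> b) t" for t
      using dist_le_line_dist[OF ab(1) comp_Geod[OF g(1) ab(2)], of t] g(2) by simp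
    then have "a = g \<circ> b" by blast
    then show "\<omega> = \<omega>'" using ab proj_comp[OF g(1)] by simp
  next
    assume "\<omega> = \<omega>'"
    moreover have "line_dist a a = 0" by (simp add: line_dist_def)
    ultimately have "quotient_dist \<omega> \<omega>' = 0"
      using quotient_dist_min(2)[of a a] quotient_dist_nonneg[of a a] ab by simp
    then show "compact_dist \<omega> \<omega>' = 0"
      using weight_pos[of \<omega>] weight_pos[of \<omega>'] by (simp add: compact_dist_def)
  qed
next
  fix \<omega>1 \<omega>2 \<omega>3 assume "\<omega>1 \<in> proj ` Geod" "\<omega>2 \<in> proj ` Geod" "\<omega>3 \<in> proj ` Geod"
  then obtain a b c where abc: "a \<in> Geod" "b \<in> Geod" "c \<in> Geod" "\<omega>1 = proj a" "\<omega>2 = proj b" "\<omega>3 = proj c" by blast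
  show "compact_dist \<omega>1 \<omega>3 \<le> compact_dist \<omega>1 \<omega>2 + compact_dist \<omega>2 \<omega>3"
    using quotient_dist_triangle[of a b c] weight_le[of a b] weight_le[of c b] abc
      weight_pos[of \<omega>2] quotient_dist_commute[of "proj c" "proj b"]
    by (simp add: compact_dist_def min_def)
qed

lemma compact_dist_le_line_dist: "a \<in> Geod \<Longrightarrow> b \<in> Geod \<Longrightarrow> compact_dist (proj a) (proj b) \<le> line_dist a b"
  using quotient_dist_min(2)[of a b] by (simp add: compact_dist_def)

text \<open>Below the weight of one endpoint the detour through infinity is too long, so the
  distance is realised by actual lines.\<close>

lemma compact_dist_less:
  assumes "a \<in> Geod" "b \<in> Geod" "compact_dist (proj a) (proj b) < r" "r \<le> weight (proj a)"
  obtains g where "g \<in> \<Gamma>" "line_dist a (g \<circ> b) < r"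
  using assms quotient_dist_min(1)[of a b] weight_pos[of "proj b"]
  by (auto simp: compact_dist_def min_def split: if_splits)

lemma mtopology_compact_dist: "Metric_space.mtopology (proj ` Geod) compact_dist = quotient_geod \<Gamma>"
proof -
  interpret M: Metric_space "proj ` Geod" compact_dist by (rule Metric_space_compact_dist)
  show ?thesis
    unfolding topology_eq
  proof (intro allI iffI)
    fix V assume V: "openin M.mtopology V"
    show "openin (quotient_geod \<Gamma>) V"
      unfolding openin_quotient_geod openin_geod_topology
    proof (intro conjI ballI)
      show "V \<subseteq> proj ` Geod" using V openin_subset by fastforce
      fix \<gamma> assume "\<gamma> \<in> {\<gamma> \<in> Geod. proj \<gamma> \<in> V}"
      then have \<gamma>: "\<gamma> \<in> Geod" "proj \<gamma> \<in> V" by auto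
      obtain r where r: "0 < r" "M.mball (proj \<gamma>) r \<subseteq> V" using V \<gamma>(2) unfolding M.openin_mtopology by blast
      obtain N :: nat and e where e: "0 < e" and small: "\<And>\<gamma> \<gamma>' :: real \<Rightarrow> 'a. \<gamma> \<in> Geod \<Longrightarrow> \<gamma>' \<in> Geod \<Longrightarrow>
         (\<And>t. \<bar>t\<bar> \<le> real N \<Longrightarrow> dist (\<gamma> t) (\<gamma>' t) \<le> e) \<Longrightarrow> line_dist \<gamma> \<gamma>' < r"
        using line_dist_small[OF r(1)] by metis
      have "proj \<gamma>' \<in> V" if "\<gamma>' \<in> Geod" "\<forall>t\<in>{-real N..real N}. dist (\<gamma> t) (\<gamma>' t) < e" for \<gamma>'
      proof -
        have "line_dist \<gamma> \<gamma>' < r"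
          by (rule small[OF \<gamma>(1) that(1)]) (use that(2) in \<open>auto simp: abs_le_iff less_imp_le\<close>)
        then have "compact_dist (proj \<gamma>) (proj \<gamma>') < r"
          using compact_dist_le_line_dist[OF \<gamma>(1) that(1)] by simp
        then show ?thesis using r(2) \<gamma>(1) that(1) by auto
      qed
      then show "\<exists>K e. compact K \<and> 0 < e \<and> {\<gamma>' \<in> Geod. \<forall>t\<in>K. dist (\<gamma> t) (\<gamma>' t) < e} \<subseteq> {\<gamma> \<in> Geod. proj \<gamma> \<in> V}"
        using e by (intro exI[of _ "{-real N..real N}"] exI[of _ e]) auto
    qed auto
  next
    fix V assume V: "openin (quotient_geod \<Gamma>) V"
    show "openin M.mtopology V"
      unfolding M.openin_mtopology
    proof (intro conjI allI impI)
      show VG: "V \<subseteq> proj ` Geod" using V openin_quotient_geod by blast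
      fix \<omega> assume "\<omega> \<in> V"
      then obtain \<gamma> where \<gamma>: "\<gamma> \<in> Geod" "proj \<gamma> \<in> V" "\<omega> = proj \<gamma>" using VG by blast
      obtain K e where K: "compact K" "0 < e" "{\<gamma>' \<in> Geod. \<forall>t\<in>K. dist (\<gamma> t) (\<gamma>' t) < e} \<subseteq> {\<gamma> \<in> Geod. proj \<gamma> \<in> V}"
        using V \<gamma> unfolding openin_quotient_geod openin_geod_topology by blast
      obtain N where N: "0 < N" "\<And>t. t \<in> K \<Longrightarrow> \<bar>t\<bar> \<le> N"
        using compact_imp_bounded[OF K(1)] unfolding bounded_pos by auto
      \<comment> \<open>The second bound excludes the detour through infinity; the first converts
        \<open>line_dist\<close> below r into distance below e at all times up to N.\<close>
      define r where "r = min (e / (1 + N\<^sup>2)) (weight \<omega>)"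
      have r: "0 < r" using K(2) weight_pos[of \<omega>] one_plus_square_pos[of N] by (simp add: r_def)
      have "M.mball \<omega> r \<subseteq> V"
      proof
        fix \<omega>' assume "\<omega>' \<in> M.mball \<omega> r"
        then obtain \<gamma>' where \<gamma>': "\<gamma>' \<in> Geod" "\<omega>' = proj \<gamma>'" "compact_dist \<omega> \<omega>' < r" by auto
        obtain g where g: "g \<in> \<Gamma>" "line_dist \<gamma> (g \<circ> \<gamma>') < r"
          using compact_dist_less[of \<gamma> \<gamma>' r] \<gamma> \<gamma>' by (auto simp: r_def)
        have "dist (\<gamma> t) ((g \<circ> \<gamma>') t) < e" if t: "t \<in> K" for t
        proof -
          have "t\<^sup>2 \<le> N\<^sup>2" using N(2)[OF t] N(1) by (simp add: abs_le_square_iff[symmetric])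
          have "dist (\<gamma> t) ((g \<circ> \<gamma>') t) \<le> line_dist \<gamma> (g \<circ> \<gamma>') * (1 + t\<^sup>2)"
            using \<gamma> g \<gamma>' by (intro dist_le_line_dist comp_Geod)
          also have "\<dots> \<le> line_dist \<gamma> (g \<circ> \<gamma>') * (1 + N\<^sup>2)"
            using \<open>t\<^sup>2 \<le> N\<^sup>2\<close> line_dist_nonneg[OF \<gamma>(1) comp_Geod[OF g(1) \<gamma>'(1)]] by (intro mult_left_mono) auto
          also have "\<dots> < r * (1 + N\<^sup>2)"
            using g one_plus_square_pos[of N] by (intro mult_strict_right_mono)
          also have "\<dots> \<le> e / (1 + N\<^sup>2) * (1 + N\<^sup>2)"
            using one_plus_square_pos[of N] by (intro mult_right_mono) (auto simp: r_def)
          finally show ?thesis using one_plus_square_pos[of N] by simp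
        qed
        then have "proj (g \<circ> \<gamma>') \<in> V" using K(3) comp_Geod[OF g(1) \<gamma>'(1)] by blast
        then show "\<omega>' \<in> V" using \<gamma>' proj_comp[OF g(1)] by simp
      qed
      then show "\<exists>r>0. M.mball \<omega> r \<subseteq> V" using r by blast
    qed
  qed
qed

lemma geodesic_flow_Geod: "\<gamma> \<in> Geod \<Longrightarrow> geodesic_flow s \<gamma> \<in> Geod"
  by (simp add: Geod_def geodesic_line_def geodesic_flow_def)

lemma quotient_flow_power: "(quotient_flow 1 ^^ i) (proj \<gamma>) = proj (geodesic_flow (real i) \<gamma>)"
proof (induction i)
  case (Suc i)
  then show ?case
    by (simp add: quotient_flow_geod_orbit) (simp add: geodesic_flow_def algebra_simps)
qed (simp add: geodesic_flow_def)

end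

section \<open>Entropy at a fixed scale\<close>

lemma log_enat_mono: "a \<le> b \<Longrightarrow> log_enat a \<le> log_enat b"
  by (cases a; cases b) (auto simp: log_enat_def)

lemma Lim_at_right_antimono:
  fixes F :: "real \<Rightarrow> ereal"
  assumes F: "\<And>r s. 0 < r \<Longrightarrow> r \<le> s \<Longrightarrow> F s \<le> F r"
  shows "Lim (at_right 0) F = (SUP r\<in>{0<..}. F r)"
proof (rule tendsto_Lim)
  show "(F \<longlongrightarrow> (SUP r\<in>{0<..}. F r)) (at_right 0)"
  proof (rule order_tendstoI)
    fix a assume "a < (SUP r\<in>{0<..}. F r)"
    then obtain r where r: "0 < r" "a < F r" by (auto simp: less_SUP_iff)
    have "a < F s" if "0 < s" "s < r" for s using F[of s r] that r by (auto intro: less_le_trans)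
    then show "\<forall>\<^sub>F s in at_right 0. a < F s" unfolding eventually_at_right_field using r(1) by blast
  next
    fix a assume a: "(SUP r\<in>{0<..}. F r) < a"
    have "F s < a" if "0 < s" for s using that a by (intro le_less_trans[OF SUP_upper a]) auto
    then show "\<forall>\<^sub>F s in at_right 0. F s < a" unfolding eventually_at_right_field by (intro exI[of _ 1]) auto
  qed
qed simp

definition scale_entropy :: "'y set \<Rightarrow> ('y \<Rightarrow> 'y \<Rightarrow> real) \<Rightarrow> ('y \<Rightarrow> 'y) \<Rightarrow> 'y set \<Rightarrow> real \<Rightarrow> ereal" where
  "scale_entropy M \<rho> T K r =
     limsup (\<lambda>n. ereal (1 / real n) * log_enat (ball_cover_number M (dynamical_metric T \<rho> n) K r))"

lemma funpow_closed: "(\<And>y. y \<in> M \<Longrightarrow> T y \<in> M) \<Longrightarrow> y \<in> M \<Longrightarrow> (T ^^ i) y \<in> M"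
  by (induction i) auto

lemma dynamical_metric_less_iff:
  "0 < n \<Longrightarrow> dynamical_metric T \<rho> n y z < r \<longleftrightarrow> (\<forall>i<n. \<rho> ((T ^^ i) y) ((T ^^ i) z) < r)"
  unfolding dynamical_metric_def by (subst Max_less_iff) (auto simp: lessThan_empty_iff)

lemma Metric_space_dynamical_metric:
  assumes m: "Metric_space M \<rho>" and T: "\<And>y. y \<in> M \<Longrightarrow> T y \<in> M" and n: "0 < n"
  shows "Metric_space M (dynamical_metric T \<rho> n)"
proof -
  interpret Metric_space M \<rho> by fact
  let ?d = "dynamical_metric T \<rho> n"
  have ge: "\<rho> ((T ^^ i) y) ((T ^^ i) z) \<le> ?d y z" if "i < n" for i y z
    unfolding dynamical_metric_def using that by (intro Max_ge) auto
  have le: "?d y z \<le> B" if "\<And>i. i < n \<Longrightarrow> \<rho> ((T ^^ i) y) ((T ^^ i) z) \<le> B" for y z B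
    unfolding dynamical_metric_def using that n by (subst Max_le_iff) (auto simp: lessThan_empty_iff)
  show ?thesis
  proof
    fix y z show nn: "0 \<le> ?d y z" using ge[of 0 y z] n order_trans[OF nonneg] by blast
    show "?d y z = ?d z y" by (simp add: dynamical_metric_def commute)
  next
    fix y z assume yz: "y \<in> M" "z \<in> M"
    show "(?d y z = 0) = (y = z)"
    proof
      assume "?d y z = 0"
      then have "\<rho> y z \<le> 0" using ge[of 0 y z] n by simp
      then show "y = z" using yz nonneg[of y z] by (simp add: zero antisym)
    next
      assume "y = z"
      then have "?d y z \<le> 0" using funpow_closed[of M T, OF T] yz by (intro le) auto
      moreover have "0 \<le> ?d y z" using ge[of 0 y z] n order_trans[OF nonneg] by blast
      ultimately show "?d y z = 0" by simp
    qed
  next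
    fix u v w assume M: "u \<in> M" "v \<in> M" "w \<in> M"
    show "?d u w \<le> ?d u v + ?d v w"
    proof (rule le)
      fix i assume i: "i < n"
      show "\<rho> ((T ^^ i) u) ((T ^^ i) w) \<le> ?d u v + ?d v w"
        using triangle[of "(T ^^ i) u" "(T ^^ i) v" "(T ^^ i) w"] funpow_closed[of M T, OF T] M ge[OF i, of u v] ge[OF i, of v w]
        by fastforce
    qed
  qed
qed

lemma scale_entropy_antimono:
  assumes m: "Metric_space M \<rho>" and T: "\<And>y. y \<in> M \<Longrightarrow> T y \<in> M" and rs: "r \<le> s"
  shows "scale_entropy M \<rho> T K s \<le> scale_entropy M \<rho> T K r"
  unfolding scale_entropy_def
proof (rule Limsup_mono, rule always_eventually, rule allI)
  fix n
  show "ereal (1 / real n) * log_enat (ball_cover_number M (dynamical_metric T \<rho> n) K s)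
     \<le> ereal (1 / real n) * log_enat (ball_cover_number M (dynamical_metric T \<rho> n) K r)"
  \<comment> \<open>For n = 0 the metric is unspecified, but the factor 1 / 0 = 0 annihilates both
    sides, even when a covering number is infinite.\<close>
  proof (cases "n = 0")
    case False
    then interpret d: Metric_space M "dynamical_metric T \<rho> n"
      using Metric_space_dynamical_metric[OF m T] by simp
    have "d.mball y r \<subseteq> d.mball y s" for y using rs by auto
    then have "ball_cover_number M (dynamical_metric T \<rho> n) K s \<le> ball_cover_number M (dynamical_metric T \<rho> n) K r"
      unfolding ball_cover_number_def by (intro INF_superset_mono) blast+
    then show ?thesis by (intro ereal_mult_left_mono log_enat_mono) auto
  qed (simp add: zero_ereal_def[symmetric])
qed

lemma topological_entropy_eq:
  assumes T: "\<And>y. y \<in> topspace Y \<Longrightarrow> T y \<in> topspace Y"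
  shows "topological_entropy Y T =
     (INF \<rho>\<in>{\<rho>. Metric_space (topspace Y) \<rho> \<and> Metric_space.mtopology (topspace Y) \<rho> = Y}.
      SUP K\<in>{K. compactin Y K}. SUP r\<in>{0<..}. scale_entropy (topspace Y) \<rho> T K r)"
proof -
  have "Lim (at_right 0) (\<lambda>r. limsup (\<lambda>n. ereal (1 / real n) *
            log_enat (ball_cover_number (topspace Y) (dynamical_metric T \<rho> n) K r)))
        = (SUP r\<in>{0<..}. scale_entropy (topspace Y) \<rho> T K r)" if "Metric_space (topspace Y) \<rho>" for \<rho> K
    unfolding scale_entropy_def[symmetric]
    by (rule Lim_at_right_antimono) (rule scale_entropy_antimono[OF that T])
  then show ?thesis
    unfolding topological_entropy_def by (intro INF_cong SUP_cong) auto
qed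

text \<open>A coding bound: one point for each code that occurs serves as a centre. Q is a relation,
  so a point may carry several codes and none has to be singled out.\<close>

lemma ball_cover_number_le:
  assumes m: "Metric_space M d" and K: "K \<subseteq> M" and I: "finite I"
    and Q: "\<And>y. y \<in> K \<Longrightarrow> \<exists>c\<in>I. Q y c" "\<And>y z c. y \<in> K \<Longrightarrow> z \<in> K \<Longrightarrow> Q y c \<Longrightarrow> Q z c \<Longrightarrow> d y z < r"
  shows "ball_cover_number M d K r \<le> enat (card I)"
proof -
  interpret Metric_space M d by fact
  define J where "J = {c \<in> I. \<exists>y\<in>K. Q y c}"
  define s where "s c = (SOME y. y \<in> K \<and> Q y c)" for c
  have s: "s c \<in> K" "Q (s c) c" if "c \<in> J" for c
    using someI_ex[of "\<lambda>y. y \<in> K \<and> Q y c"] that by (auto simp: J_def s_def)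
  have J: "finite J" "card J \<le> card I" using I card_mono[of I J] by (auto simp: J_def)
  have "K \<subseteq> (\<Union>y\<in>s ` J. mball y r)"
  proof
    fix y assume y: "y \<in> K"
    then obtain c where c: "c \<in> I" "Q y c" using Q(1) by blast
    then have "c \<in> J" using y by (auto simp: J_def)
    then have "d (s c) y < r" using s Q(2) y c by blast
    then show "y \<in> (\<Union>y\<in>s ` J. mball y r)" using \<open>c \<in> J\<close> s K y by auto
  qed
  then have "ball_cover_number M d K r \<le> enat (card (s ` J))"
    unfolding ball_cover_number_def using J s K by (intro INF_lower) auto
  also have "\<dots> \<le> enat (card I)" using card_image_le[OF J(1), of s] J(2) by simp
  finally show ?thesis .
qed

text \<open>Constants, the polynomial factor and the shift c vanish after taking logarithms and
  dividing by n. The square will come from a pair of visiting times, the shift from an enlarged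
  ball.\<close>

lemma scale_entropy_le_real:
  assumes b: "\<And>n. n0 \<le> n \<Longrightarrow> ball_cover_number M (dynamical_metric T \<rho> n) K r \<le> enat (N n)"
    and N: "\<And>n. n0 \<le> n \<Longrightarrow> real (N n) \<le> C * real n ^ 2 * exp (h * (real n + c))" and C: "0 < C"
  shows "scale_entropy M \<rho> T K r \<le> ereal h"
proof -
  let ?a = "\<lambda>n. ln C / real n + 2 * (ln (real n) / real n) + h + h * c / real n"
  have "ereal (1 / real n) * log_enat (ball_cover_number M (dynamical_metric T \<rho> n) K r) \<le> ereal (?a n)"
    if n: "max n0 1 \<le> n" for n
  proof -
    have n1: "1 \<le> n" "n0 \<le> n" using n by auto
    have "log_enat (ball_cover_number M (dynamical_metric T \<rho> n) K r) \<le> log_enat (enat (N n))"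
      using b n1 by (intro log_enat_mono) auto
    also have "\<dots> \<le> ereal (ln C + 2 * ln (real n) + h * (real n + c))"
    proof (cases "N n = 0")
      case False
      have "ln (real (N n)) \<le> ln (C * real n ^ 2 * exp (h * (real n + c)))"
        using False N n1 C by (subst ln_le_cancel_iff) auto
      also have "\<dots> = ln C + 2 * ln (real n) + h * (real n + c)"
        using C n1 by (simp add: ln_mult ln_realpow)
      finally show ?thesis using False by (simp add: log_enat_def)
    qed (simp add: log_enat_def)
    finally have "ereal (1 / real n) * log_enat (ball_cover_number M (dynamical_metric T \<rho> n) K r)
       \<le> ereal (1 / real n) * ereal (ln C + 2 * ln (real n) + h * (real n + c))"
      by (rule ereal_mult_left_mono) simp
    also have "\<dots> = ereal (?a n)" using n1 by (simp add: field_simps)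
    finally show ?thesis .
  qed
  then have "scale_entropy M \<rho> T K r \<le> limsup (\<lambda>n. ereal (?a n))"
    unfolding scale_entropy_def by (intro Limsup_mono eventually_sequentiallyI)
  also have "?a \<longlonglongrightarrow> 0 + 2 * 0 + h + 0"
    by (intro tendsto_add tendsto_mult_left lim_const_over_n lim_ln_over_n tendsto_const)
  then have "(\<lambda>n. ereal (?a n)) \<longlonglongrightarrow> ereal h" by simp
  then have "limsup (\<lambda>n. ereal (?a n)) = ereal h" by (intro lim_imp_Limsup) simp_all
  finally show ?thesis .
qed

section \<open>The upper bound\<close>

context hyperbolic_group begin

lemma orb_self: "x \<in> orb"
  unfolding orbit_of_def by (rule image_eqI[of _ _ id]) (simp_all add: id_\<Gamma>)

lemma finite_orb_ball: "finite (orb \<inter> ball x T)"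
proof -
  have "orb \<inter> ball x T \<subseteq> (\<lambda>g. g x) ` displ T" by (auto simp: orbit_of_def)
  then show ?thesis using discrete finite_subset by blast
qed

lemma orb_near:
  assumes "infdist p orb < R"
  obtains g where "g \<in> \<Gamma>" "dist p (g x) < R"
proof -
  have "(INF q\<in>orb. dist p q) < R" using assms by (simp add: infdist_notempty)
  then obtain q where "q \<in> orb" "dist p q < R"
    by (subst (asm) cINF_less_iff) (auto intro: bdd_belowI2[of _ 0])
  then show thesis using that by (auto simp: orbit_of_def)
qed

lemma finite_net:
  assumes "0 < e"
  obtains P where "finite P" "\<And>q. dist x q \<le> R \<Longrightarrow> \<exists>u\<in>P. dist q u \<le> e"
proof -
  obtain P where "finite P" "cball x R \<subseteq> (\<Union>u\<in>P. ball u e)"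
    using proper[of x R] assms unfolding compact_eq_totally_bounded by blast
  moreover from this(2) have "\<exists>u\<in>P. dist q u \<le> e" if "dist x q \<le> R" for q
    using that by (fastforce simp: subset_iff dist_commute intro: less_imp_le)
  ultimately show thesis using that by blast
qed

text \<open>This is where line-convexity enters: closeness at the two ends of an interval propagates
  inside, so a long segment is pinned down by its ends.\<close>

lemma lines_convex_le:
  fixes \<gamma> \<gamma>' :: "real \<Rightarrow> 'a"
  assumes "\<gamma> \<in> Geod" "\<gamma>' \<in> Geod" "dist (\<gamma> s) (\<gamma>' s) \<le> e" "dist (\<gamma> t) (\<gamma>' t) \<le> e" "s \<le> u" "u \<le> t"
  shows "dist (\<gamma> u) (\<gamma>' u) \<le> e"
proof -
  have "convex_on UNIV (\<lambda>t. dist (\<gamma> t) (\<gamma>' t))" using lines_convex assms by (simp add: Geod_def)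
  then have "convex_on {s..t} (\<lambda>t. dist (\<gamma> t) (\<gamma>' t))" by (rule convex_on_subset) auto
  then have "dist (\<gamma> u) (\<gamma>' u) \<le> max (dist (\<gamma> s) (\<gamma>' s)) (dist (\<gamma> t) (\<gamma>' t))"
    using assms by (intro convex_on_le_max) auto
  then show ?thesis using assms by linarith
qed

lemma quotient_flow_closed: "\<omega> \<in> proj ` Geod \<Longrightarrow> quotient_flow 1 \<omega> \<in> proj ` Geod"
  using geodesic_flow_Geod by (auto simp: quotient_flow_geod_orbit intro!: imageI)

lemma height_flow: "height ((quotient_flow 1 ^^ i) (proj \<gamma>)) = infdist (\<gamma> (real i)) orb"
  by (simp add: quotient_flow_power height_proj geodesic_flow_def)

text \<open>Both points are within 1 / (1 + R) of infinity, so the detour through it is short,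
  whatever the lines do.\<close>

lemma compact_dist_high:
  assumes "0 \<le> R" "2 / (1 + R) \<le> r" "R < height \<omega>" "R < height \<omega>'" "0 < r"
  shows "compact_dist \<omega> \<omega>' < r"
proof -
  have "weight \<omega> < 1 / (1 + R)" "weight \<omega>' < 1 / (1 + R)"
    using assms by (auto simp: weight_def frac_less2)
  then have "weight \<omega> + weight \<omega>' < r" using assms(2) by simp
  then show ?thesis using assms(5) by (auto simp: compact_dist_def min_less_iff_disj)
qed

text \<open>The part of a line before its first and after its last visit to the \<open>R\<close>-neighbourhood of the
  orbit is invisible to \<^const>\<open>compact_dist\<close>; by convexity, the part in between is
  determined up to finitely many choices by the orbit points next to its two ends.\<close>

lemma compact_dist_cover:
  assumes r: "0 < r"
  obtains C c where "0 < C"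
    "\<And>n K. 0 < n \<Longrightarrow> K \<subseteq> proj ` Geod \<Longrightarrow>
       ball_cover_number (proj ` Geod) (dynamical_metric (quotient_flow 1) compact_dist n) K r
         \<le> enat (1 + C * n ^ 2 * card (orb \<inter> ball x (real n + c)))"
proof -
  define R where "R = 2 / r"
  have R: "0 \<le> R" "2 / (1 + R) \<le> r" using r by (auto simp: R_def field_simps)
  obtain M :: nat and e where e: "0 < e" and small: "\<And>\<gamma> \<gamma>' :: real \<Rightarrow> 'a. \<gamma> \<in> Geod \<Longrightarrow> \<gamma>' \<in> Geod \<Longrightarrow>
       (\<And>t. \<bar>t\<bar> \<le> real M \<Longrightarrow> dist (\<gamma> t) (\<gamma>' t) \<le> e) \<Longrightarrow> line_dist \<gamma> \<gamma>' < r"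
    using line_dist_small[OF r] by metis
  \<comment> \<open>The radius allows 1 for replacing the infimum in \<open>infdist\<close> by an
    orbit point, and M for the time added at both ends of the visiting interval.\<close>
  obtain P where P: "finite P" "\<And>q. dist x q \<le> R + 1 + real M \<Longrightarrow> \<exists>u\<in>P. dist q u \<le> e / 2"
    using finite_net[of "e / 2" "R + 1 + real M"] e by auto
  \<comment> \<open>Fixing one isometry for each orbit point makes the count run over orbit points,
    so that stabilisers contribute no factor.\<close>
  define G where "G q = (SOME g. g \<in> \<Gamma> \<and> g x = q)" for q
  have G: "G q \<in> \<Gamma>" "G q x = q" if "q \<in> orb" for q
    using someI_ex[of "\<lambda>g. g \<in> \<Gamma> \<and> g x = q"] that by (auto simp: G_def orbit_of_def)
  \<comment> \<open>Both ends are within R + 1 of their orbit points and the times a and b differ by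
    less than n.\<close>
  define c where "c = 2 * R + 3"
  let ?I = "\<lambda>n. insert None (Some ` ({..<n} \<times> {..<n} \<times> (orb \<inter> ball x (real n + c)) \<times> P \<times> P))"
  \<comment> \<open>\<open>None\<close> means no visit at all. Otherwise a and b are visiting times
    outside of which the line is high, q is an orbit point near time b for a representative
    normalised at time a, and u, v locate the line at times a - M and b + M, the latter relative to
    q.\<close>
  define Q where "Q n \<omega> k = (case k of None \<Rightarrow> (\<forall>i<n. R < height ((quotient_flow 1 ^^ i) \<omega>))
     | Some (a, b, q, u, v) \<Rightarrow> \<exists>\<gamma>\<in>Geod. \<omega> = proj \<gamma> \<and> a \<le> b \<and> (\<forall>i<n. i < a \<or> b < i \<longrightarrow> R < infdist (\<gamma> (real i)) orb) \<and>
          dist (\<gamma> (real a - real M)) u \<le> e / 2 \<and> dist (\<gamma> (real b + real M)) (G q v) \<le> e / 2 \<and> q \<in> orb)" for n \<omega> k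
  show thesis
  proof (rule that[of "(card P)\<^sup>2 + 1" c])
    fix n K assume n: "0 < (n::nat)" and K: "K \<subseteq> proj ` Geod"
    let ?F = "orb \<inter> ball x (real n + c)"
    have "ball_cover_number (proj ` Geod) (dynamical_metric (quotient_flow 1) compact_dist n) K r \<le> enat (card (?I n))"
    proof (rule ball_cover_number_le[where Q = "Q n"])
      show "Metric_space (proj ` Geod) (dynamical_metric (quotient_flow 1) compact_dist n)"
        by (rule Metric_space_dynamical_metric[OF Metric_space_compact_dist quotient_flow_closed n])
      show "finite (?I n)" using P(1) finite_orb_ball by auto
      fix \<omega> assume "\<omega> \<in> K"
      then obtain \<gamma>0 where \<gamma>0: "\<gamma>0 \<in> Geod" "\<omega> = proj \<gamma>0" using K by blast
      let ?near = "{i. i < n \<and> infdist (\<gamma>0 (real i)) orb \<le> R}"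
      show "\<exists>k\<in>?I n. Q n \<omega> k"
      proof (cases "?near = {}")
        case True
        then have "Q n \<omega> None" by (auto simp: Q_def \<gamma>0 height_flow not_le)
        then show ?thesis by blast
      next
        case False
        have fin: "finite ?near" by simp
        define a where "a = Min ?near"
        define b where "b = Max ?near"
        have "a \<in> ?near" "b \<in> ?near" unfolding a_def b_def using Min_in[OF fin False] Max_in[OF fin False] by auto
        then have ab: "a < n" "b < n" "infdist (\<gamma>0 (real a)) orb \<le> R" "infdist (\<gamma>0 (real b)) orb \<le> R" by auto
        have le: "a \<le> b" unfolding a_def using fin \<open>b \<in> ?near\<close> by (rule Min_le)
        have out: "R < infdist (\<gamma>0 (real i)) orb" if "i < n" "i < a \<or> b < i" for i
        proof (rule ccontr)
          assume "\<not> ?thesis"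
          then have "i \<in> ?near" using that(1) by simp
          then have "a \<le> i" "i \<le> b" unfolding a_def b_def using fin by (auto intro: Min_le Max_ge)
          then show False using that(2) by linarith
        qed
        \<comment> \<open>Moving the orbit point near time a to x normalises the representative;
          only the orbit point near time b remains to be recorded.\<close>
        obtain g where g: "g \<in> \<Gamma>" "dist (\<gamma>0 (real a)) (g x) < R + 1"
          using orb_near[of "\<gamma>0 (real a)" "R + 1"] ab by auto
        define \<gamma> where "\<gamma> = ginv g \<circ> \<gamma>0"
        have \<gamma>: "\<gamma> \<in> Geod" "\<omega> = proj \<gamma>"
          using \<gamma>0 g proj_comp[OF inv_\<Gamma>[OF g(1)]] comp_Geod[OF inv_\<Gamma>[OF g(1)]] by (auto simp: \<gamma>_def)
        have inf: "infdist (\<gamma> t) orb = infdist (\<gamma>0 t) orb" for t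
          using infdist_orb[OF inv_\<Gamma>[OF g(1)]] by (simp add: \<gamma>_def)
        have a: "dist x (\<gamma> (real a)) \<le> R + 1"
          using g dist_shift[OF g(1), of x "\<gamma>0 (real a)"] by (simp add: \<gamma>_def dist_commute)
        obtain h where h: "h \<in> \<Gamma>" "dist (\<gamma> (real b)) (h x) < R + 1"
          using orb_near[of "\<gamma> (real b)" "R + 1"] ab inf by auto
        have horb: "h x \<in> orb" using h by (auto simp: orbit_of_def)
        let ?g = "G (h x)"
        have "dist x (h x) < real n + c"
          using dist_triangle[of x "h x" "\<gamma> (real a)"] dist_triangle[of "\<gamma> (real a)" "h x" "\<gamma> (real b)"] a h
            Geod_dist[OF \<gamma>(1), of "real a" "real b"] le ab by (simp add: c_def)
        moreover have "dist x (\<gamma> (real a - real M)) \<le> R + 1 + real M"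
          using a dist_triangle[of x "\<gamma> (real a - real M)" "\<gamma> (real a)"] Geod_dist[OF \<gamma>(1), of "real a" "real a - real M"] by simp
        then obtain u where "u \<in> P" "dist (\<gamma> (real a - real M)) u \<le> e / 2" using P(2) by blast
        moreover have "dist (?g x) (\<gamma> (real b + real M)) \<le> R + 1 + real M"
          using h G[OF horb] dist_triangle[of "h x" "\<gamma> (real b + real M)" "\<gamma> (real b)"] Geod_dist[OF \<gamma>(1), of "real b" "real b + real M"]
          by (simp add: dist_commute)
        then have "dist x (ginv ?g (\<gamma> (real b + real M))) \<le> R + 1 + real M"
          using dist_shift[OF G(1)[OF horb]] by simp
        then obtain v where "v \<in> P" "dist (ginv ?g (\<gamma> (real b + real M))) v \<le> e / 2" using P(2) by blast
        moreover then have "dist (\<gamma> (real b + real M)) (?g v) \<le> e / 2"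
          using dist_shift[OF G(1)[OF horb], of v "\<gamma> (real b + real M)"] by (simp add: dist_commute)
        ultimately show ?thesis
          using \<gamma> inf out le ab horb
          by (intro bexI[of _ "Some (a, b, h x, u, v)"]) (auto simp: Q_def intro!: bexI[of _ \<gamma>])
      qed
      fix \<omega>' k assume "\<omega>' \<in> K" and Q: "Q n \<omega> k" "Q n \<omega>' k"
      show "dynamical_metric (quotient_flow 1) compact_dist n \<omega> \<omega>' < r"
        unfolding dynamical_metric_less_iff[OF n]
      proof (intro allI impI)
        fix i assume i: "i < n"
        show "compact_dist ((quotient_flow 1 ^^ i) \<omega>) ((quotient_flow 1 ^^ i) \<omega>') < r"
        proof (cases k)
          case None
          then show ?thesis using Q i R r by (intro compact_dist_high[of R]) (auto simp: Q_def)
        next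
          case (Some s)
          obtain a b q u v where s: "s = (a, b, q, u, v)" by (cases s)
          obtain \<gamma> where \<gamma>: "\<gamma> \<in> Geod" "\<omega> = proj \<gamma>" "a \<le> b" "\<And>i. i < n \<Longrightarrow> i < a \<or> b < i \<Longrightarrow> R < infdist (\<gamma> (real i)) orb"
             "dist (\<gamma> (real a - real M)) u \<le> e / 2" "dist (\<gamma> (real b + real M)) (G q v) \<le> e / 2"
            using Q(1) by (auto simp: Q_def Some s)
          obtain \<gamma>' where \<gamma>': "\<gamma>' \<in> Geod" "\<omega>' = proj \<gamma>'" "\<And>i. i < n \<Longrightarrow> i < a \<or> b < i \<Longrightarrow> R < infdist (\<gamma>' (real i)) orb"
             "dist (\<gamma>' (real a - real M)) u \<le> e / 2" "dist (\<gamma>' (real b + real M)) (G q v) \<le> e / 2"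
            using Q(2) by (auto simp: Q_def Some s)
          show ?thesis
          proof (cases "i < a \<or> b < i")
            case True
            then show ?thesis using \<gamma> \<gamma>' i R r by (intro compact_dist_high[of R]) (auto simp: height_flow)
          next
            case False
            \<comment> \<open>The window of radius M around time i lies between a - M and b + M,
              where u and \<open>G q v\<close> match the two lines; convexity fills in the
              rest.\<close>
            have "line_dist (geodesic_flow (real i) \<gamma>) (geodesic_flow (real i) \<gamma>') < r"
            proof (rule small[OF geodesic_flow_Geod[OF \<gamma>(1)] geodesic_flow_Geod[OF \<gamma>'(1)]])
              fix t assume t: "\<bar>t\<bar> \<le> real M"
              have "dist (\<gamma> (t + real i)) (\<gamma>' (t + real i)) \<le> e"
              proof (rule lines_convex_le[OF \<gamma>(1) \<gamma>'(1)])
                show "dist (\<gamma> (real a - real M)) (\<gamma>' (real a - real M)) \<le> e"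
                  using \<gamma>(5) \<gamma>'(4) dist_triangle2[of "\<gamma> (real a - real M)" "\<gamma>' (real a - real M)" u] by simp
                show "dist (\<gamma> (real b + real M)) (\<gamma>' (real b + real M)) \<le> e"
                  using \<gamma>(6) \<gamma>'(5) dist_triangle2[of "\<gamma> (real b + real M)" "\<gamma>' (real b + real M)" "G q v"] by simp
              qed (use t False in auto)
              then show "dist (geodesic_flow (real i) \<gamma> t) (geodesic_flow (real i) \<gamma>' t) \<le> e"
                by (simp add: geodesic_flow_def)
            qed
            then show ?thesis
              using compact_dist_le_line_dist[OF geodesic_flow_Geod[OF \<gamma>(1)] geodesic_flow_Geod[OF \<gamma>'(1)], of "real i" "real i"]
              by (simp add: quotient_flow_power \<gamma>(2) \<gamma>'(2))
          qed
        qed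
      qed
    qed (rule K)
    also have "card (?I n) \<le> 1 + card (Some ` ({..<n} \<times> {..<n} \<times> ?F \<times> P \<times> P))"
      by (rule order_trans[OF card_insert_le_m1]) (use P(1) finite_orb_ball in auto)
    also have "\<dots> = 1 + (card P)\<^sup>2 * n\<^sup>2 * card ?F"
      by (simp add: card_image card_cartesian_product power2_eq_square)
    also have "\<dots> \<le> 1 + ((card P)\<^sup>2 + 1) * n\<^sup>2 * card ?F" by (simp add: algebra_simps)
    finally show "ball_cover_number (proj ` Geod) (dynamical_metric (quotient_flow 1) compact_dist n) K r
         \<le> enat (1 + ((card P)\<^sup>2 + 1) * n\<^sup>2 * card ?F)" by simp
  qed simp
qed

lemma critical_exponent_bound:
  assumes "critical_exponent x \<Gamma> < ereal h"
  obtains T0 where "0 < T0" "\<And>T. T0 \<le> T \<Longrightarrow> real (card (orb \<inter> ball x T)) \<le> exp (h * T)"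
proof -
  have "\<forall>\<^sub>F T in at_top. ereal (1 / T * ln (real (card (orb \<inter> ball x T)))) < ereal h"
    using assms unfolding critical_exponent_def by (rule Limsup_lessD)
  then obtain T0 where T0: "\<And>T. T0 \<le> T \<Longrightarrow> 1 / T * ln (real (card (orb \<inter> ball x T))) < h"
    unfolding eventually_at_top_linorder by auto
  show thesis
  proof (rule that[of "max 1 T0"])
    fix T assume T: "max 1 T0 \<le> T"
    have "x \<in> orb \<inter> ball x T" using T orb_self by simp
    then have pos: "0 < card (orb \<inter> ball x T)" using finite_orb_ball by (auto simp: card_gt_0_iff)
    have "ln (real (card (orb \<inter> ball x T))) \<le> h * T"
      using T0[of T] T by (simp add: pos_divide_less_eq mult.commute)
    then show "real (card (orb \<inter> ball x T)) \<le> exp (h * T)"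
      using pos by (metis exp_le_cancel_iff exp_ln of_nat_0_less_iff)
  qed simp
qed

lemma critical_exponent_nonneg: "0 \<le> critical_exponent x \<Gamma>"
proof -
  have "x \<in> orb \<inter> ball x T" if "0 < T" for T using that orb_self by simp
  then have "0 < card (orb \<inter> ball x T)" if "0 < T" for T
    using that finite_orb_ball unfolding card_gt_0_iff by blast
  then have "(0::ereal) \<le> ereal (1 / T * ln (real (card (orb \<inter> ball x T))))" if "1 \<le> T" for T
    using that by (auto simp: Suc_le_eq)
  then have "\<forall>\<^sub>F T in at_top. (0::ereal) \<le> ereal (1 / T * ln (real (card (orb \<inter> ball x T))))"
    by (intro eventually_at_top_linorderI)
  then have "Limsup (at_top :: real filter) (\<lambda>T. 0 :: ereal) \<le> critical_exponent x \<Gamma>"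
    unfolding critical_exponent_def by (rule Limsup_mono)
  then show ?thesis by (simp add: Limsup_const)
qed

text \<open>The infimum over metrics is at most the value at \<open>compact_dist\<close>, and the
  covering bound has the same constants for all K, so the supremum over K does no harm.\<close>

lemma topological_entropy_le:
  "topological_entropy (quotient_geod \<Gamma>) (quotient_flow 1) \<le> critical_exponent x \<Gamma>"
proof -
  have "scale_entropy (proj ` Geod) compact_dist (quotient_flow 1) K r \<le> critical_exponent x \<Gamma>"
    if K: "compactin (quotient_geod \<Gamma>) K" and r: "0 < r" for K r
  proof (rule ccontr)
    assume "\<not> ?thesis"
    then have "critical_exponent x \<Gamma> < scale_entropy (proj ` Geod) compact_dist (quotient_flow 1) K r"
      by (simp only: not_le)
    then obtain h where h: "critical_exponent x \<Gamma> < ereal h" "ereal h < scale_entropy (proj ` Geod) compact_dist (quotient_flow 1) K r"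
      using ereal_dense2 by blast
    \<comment> \<open>Positivity of h allows the summand 1 contributed by the code
      \<open>None\<close> to be absorbed into the exponential.\<close>
    have "0 < ereal h" using critical_exponent_nonneg h(1) by (rule le_less_trans)
    then have "0 < h" by simp
    obtain T0 where T0: "0 < T0" "\<And>T. T0 \<le> T \<Longrightarrow> real (card (orb \<inter> ball x T)) \<le> exp (h * T)"
      using critical_exponent_bound[OF h(1)] by blast
    obtain C c where C: "0 < C" and cover: "\<And>n K. 0 < n \<Longrightarrow> K \<subseteq> proj ` Geod \<Longrightarrow>
       ball_cover_number (proj ` Geod) (dynamical_metric (quotient_flow 1) compact_dist n) K r
         \<le> enat (1 + C * n ^ 2 * card (orb \<inter> ball x (real n + c)))"
      using compact_dist_cover[OF r] by blast
    define n0 where "n0 = nat \<lceil>T0 + \<bar>c\<bar> + 1\<rceil>"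
    have n0: "T0 + \<bar>c\<bar> + 1 \<le> real n0" unfolding n0_def by (rule real_nat_ceiling_ge)
    have KY: "K \<subseteq> proj ` Geod" using compactin_subset_topspace[OF K] topspace_quotient by simp
    have "scale_entropy (proj ` Geod) compact_dist (quotient_flow 1) K r \<le> ereal h"
    proof (rule scale_entropy_le_real[where C = "1 + real C" and c = c])
      fix n assume n: "n0 \<le> n"
      then have n': "T0 + \<bar>c\<bar> + 1 \<le> real n" using n0 by linarith
      then have n1: "1 \<le> real n" using T0(1) by linarith
      show "ball_cover_number (proj ` Geod) (dynamical_metric (quotient_flow 1) compact_dist n) K r
         \<le> enat (1 + C * n ^ 2 * card (orb \<inter> ball x (real n + c)))"
        using n1 KY by (intro cover) auto
      have 1: "real (card (orb \<inter> ball x (real n + c))) \<le> exp (h * (real n + c))"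
        using n' by (intro T0(2)) linarith
      have 2: "1 \<le> real n ^ 2 * exp (h * (real n + c))"
      proof -
        have "1 * 1 \<le> real n ^ 2 * exp (h * (real n + c))"
          using n1 n' T0(1) \<open>0 < h\<close> by (intro mult_mono) (auto intro!: mult_nonneg_nonneg)
        then show ?thesis by simp
      qed
      have "real (1 + C * n ^ 2 * card (orb \<inter> ball x (real n + c))) = 1 + real C * real n ^ 2 * real (card (orb \<inter> ball x (real n + c)))"
        by simp
      also have "\<dots> \<le> real n ^ 2 * exp (h * (real n + c)) + real C * real n ^ 2 * exp (h * (real n + c))"
        using 1 2 by (intro add_mono mult_left_mono) auto
      also have "\<dots> = (1 + real C) * real n ^ 2 * exp (h * (real n + c))" by (simp add: algebra_simps)
      finally show "real (1 + C * n ^ 2 * card (orb \<inter> ball x (real n + c))) \<le> (1 + real C) * real n ^ 2 * exp (h * (real n + c))" .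
    qed simp
    then show False using h(2) by simp
  qed
  moreover have "quotient_flow 1 \<omega> \<in> topspace (quotient_geod \<Gamma>)" if "\<omega> \<in> topspace (quotient_geod \<Gamma>)" for \<omega>
    using that quotient_flow_closed by (simp add: topspace_quotient)
  ultimately show ?thesis
    using Metric_space_compact_dist mtopology_compact_dist
    by (subst topological_entropy_eq) (auto simp: topspace_quotient intro!: INF_lower2[of compact_dist] SUP_least)
qed

end

section \<open>The lower bound\<close>

locale extended_group = hyperbolic_group x \<Gamma> \<delta>
  for x :: "'a::metric_space" and \<Gamma> :: "('a \<Rightarrow> 'a) set" and \<delta> :: real +
  fixes F :: "('a \<Rightarrow> 'a) set" and c \<Phi> :: real
  assumes finite_F: "finite F" and F_\<Gamma>: "F \<subseteq> \<Gamma>" and nrm_F: "f \<in> F \<Longrightarrow> dist x (f x) \<le> \<Phi>"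
    and c_nonneg: "0 \<le> c" and extension: "\<exists>f\<in>F. gromov_product x y (f z) \<le> c"
begin

text \<open>The constants fit the input of \<open>line_along_chain\<close>. \<open>turn\<close>
  bounds the backtracking after a letter from F is inserted, which shifts a base point and an
  endpoint by up to \<Phi> each. \<open>min_len\<close> is the step length required for that
  backtracking, plus \<Phi> because the inserted letter may shorten a step. \<open>width\<close> is
  the resulting distance between line and vertices, rounding included.\<close>

definition turn :: real where "turn = c + 2 * \<Phi>"
definition min_len :: real where "min_len = 4 * turn + 6 * \<delta> + 1 + \<Phi>"
definition width :: real where "width = turn + 4 * \<delta> + 1"

lemma \<Phi>_nonneg: "0 \<le> \<Phi>"
  using extension nrm_F zero_le_dist order_trans by metis

lemma turn_nonneg: "0 \<le> turn" using \<Phi>_nonneg c_nonneg by (simp add: turn_def)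

lemma width_pos: "1 \<le> width" using turn_nonneg \<delta>_nonneg by (simp add: width_def)

lemma choices_pos: "0 < card (displ (2 * width + 4))" "0 < card F"
proof -
  have "F \<noteq> {}" "id \<in> displ (2 * width + 4)" using extension id_\<Gamma> width_pos by auto
  then show "0 < card (displ (2 * width + 4))" "0 < card F"
    using finite_F discrete unfolding card_gt_0_iff by blast+
qed

text \<open>Any sequence of sufficiently long elements becomes quasigeodesic after inserting letters
  from \<open>F\<close>.\<close>

lemma word_line:
  fixes g :: "int \<Rightarrow> 'a \<Rightarrow> 'a"
  assumes g: "\<And>k. g k \<in> \<Gamma>" "\<And>k. min_len \<le> nrm (g k)" "\<And>k. nrm (g k) \<le> T"
  obtains \<gamma> t f q where "\<gamma> \<in> Geod" "\<And>s. infdist (\<gamma> s) orb \<le> T + \<Phi> + width"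
    "t 0 = (0::nat)" "\<And>k. dist (\<gamma> (real (t k))) (q k x) \<le> width"
    "\<And>k. \<bar>real (t (Suc k)) - real (t k)\<bar> \<le> T + \<Phi> + 2 * width"
    "\<And>k. q k \<in> \<Gamma>" "\<And>k. f k \<in> F" "\<And>k. q (Suc k) = q k \<circ> (g (int k) \<circ> f k)"
proof -
  \<comment> \<open>The inserted letter depends only on the two letters around the junction, so all
    the choices can be made independently.\<close>
  have "\<exists>f. \<forall>k. f k \<in> F \<and> gromov_product x (ginv (g k) x) (f k (g (k + 1) x)) \<le> c"
    using extension by (intro choice allI) blast
  then obtain f where f: "\<And>k. f k \<in> F" "\<And>k. gromov_product x (ginv (g k) x) (f k (g (k + 1) x)) \<le> c"
    by blast
  have f\<Gamma>: "f k \<in> \<Gamma>" "nrm (f k) \<le> \<Phi>" for k using f F_\<Gamma> nrm_F by auto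
  define e where "e k = g k \<circ> f k" for k
  have e: "e k \<in> \<Gamma>" for k unfolding e_def by (intro comp_\<Gamma> g f\<Gamma>)
  have nrm_e: "min_len - \<Phi> \<le> nrm (e k)" "nrm (e k) \<le> T + \<Phi>" for k
  proof -
    have "dist (g k x) (g k (f k x)) \<le> \<Phi>" using f\<Gamma>(2) isom_\<Gamma>[OF g(1)] by simp
    then show "min_len - \<Phi> \<le> nrm (e k)" "nrm (e k) \<le> T + \<Phi>"
      using g(2,3)[of k] dist_triangle[of x "g k x" "g k (f k x)"] dist_triangle[of x "g k (f k x)" "g k x"]
      by (simp_all add: e_def dist_commute)
  qed
  have turn: "gromov_product x (ginv (e k) x) (e (k + 1) x) \<le> turn" for k
  proof -
    let ?y = "f k (g (k + 1) x)"
    \<comment> \<open>Applying \<open>f k\<close> turns the incoming direction into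
      \<open>ginv (g k) x\<close> and moves the base point by at most \<Phi>; ignoring the following
      inserted letter costs another \<Phi>.\<close>
    have "f k (ginv (e k) x) = ginv (g k) (g k (f k (ginv (e k) x)))" using g(1) by simp
    also have "g k (f k (ginv (e k) x)) = e k (ginv (e k) x)" by (simp add: e_def)
    finally have "f k (ginv (e k) x) = ginv (g k) x" using e by simp
    then have "gromov_product x (ginv (e k) x) (e (k + 1) x)
        = gromov_product (f k x) (ginv (g k) x) (f k (e (k + 1) x))"
      using gromov_product_isom[OF f\<Gamma>(1)] by metis
    also have "\<dots> \<le> gromov_product x (ginv (g k) x) (f k (e (k + 1) x)) + \<Phi>"
      using gromov_product_change_base[of "f k x" "ginv (g k) x" "f k (e (k + 1) x)" x] f\<Gamma>(2)[of k]
      by (simp add: dist_commute)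
    also have "\<dots> \<le> gromov_product x (ginv (g k) x) ?y + dist (f k (e (k + 1) x)) ?y + \<Phi>"
      using gromov_product_change_point2 by simp
    also have "dist (f k (e (k + 1) x)) ?y \<le> \<Phi>"
      using f\<Gamma>(2)[of "k + 1"] isom_\<Gamma>[OF f\<Gamma>(1)] isom_\<Gamma>[OF g(1)] by (simp add: e_def dist_commute)
    finally show ?thesis using f(2)[of k] by (simp add: turn_def)
  qed
  have ch: "chain turn (min_len - \<Phi>) (\<lambda>k. walk e k x)"
    by (rule walk_chain) (rule e turn nrm_e(1))+
  have "4 * turn + 6 * \<delta> + 1 \<le> min_len - \<Phi>" by (simp add: min_len_def)
  moreover have "dist (walk e k x) (walk e (k + 1) x) \<le> T + \<Phi>" for k
    using walk_dist[OF e] nrm_e by simp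
  ultimately obtain \<gamma> where \<gamma>: "geodesic_line \<gamma>" "dist (\<gamma> 0) (walk e 0 x) \<le> turn + 4 * \<delta>"
    "\<And>k::nat. \<exists>j::nat. dist (\<gamma> (real j)) (walk e (int k) x) \<le> turn + 4 * \<delta> + 1"
    "\<And>t. infdist (\<gamma> t) (range (\<lambda>k. walk e k x)) \<le> T + \<Phi> + (turn + 4 * \<delta>)"
    using line_along_chain[OF ch turn_nonneg] by blast
  have G: "\<gamma> \<in> Geod" using \<gamma>(1) by (simp add: Geod_def)
  define q where "q k = walk e (int k)" for k
  obtain j where j: "\<And>k. dist (\<gamma> (real (j k :: nat))) (q k x) \<le> width"
    using \<gamma>(3) unfolding q_def width_def by metis
  \<comment> \<open>Time 0 is admissible for the vertex at x. With this normalisation the increments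
    determine all times.\<close>
  define t where "t k = (if k = 0 then 0 else j k)" for k
  have t: "dist (\<gamma> (real (t k))) (q k x) \<le> width" for k
    using j[of k] \<gamma>(2) by (simp add: t_def q_def width_def)
  show thesis
  proof (rule that[OF G, of t q "\<lambda>k. f (int k)"])
    have "range (\<lambda>k. walk e k x) \<subseteq> orb" using walk_in[OF e] by (auto simp: orbit_of_def)
    then have "infdist (\<gamma> s) orb \<le> infdist (\<gamma> s) (range (\<lambda>k. walk e k x))" for s
      by (intro infdist_mono) auto
    then show "infdist (\<gamma> s) orb \<le> T + \<Phi> + width" for s
      using \<gamma>(4)[of s] by (smt (verit) width_def)
    show "t 0 = 0" by (simp add: t_def)
    show "dist (\<gamma> (real (t k))) (q k x) \<le> width" for k by (rule t)
    show "\<bar>real (t (Suc k)) - real (t k)\<bar> \<le> T + \<Phi> + 2 * width" for k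
    proof -
      have "\<bar>real (t (Suc k)) - real (t k)\<bar> = dist (\<gamma> (real (t (Suc k)))) (\<gamma> (real (t k)))"
        using Geod_dist[OF G] by simp
      also have "\<dots> \<le> dist (\<gamma> (real (t (Suc k)))) (q (Suc k) x) + dist (q (Suc k) x) (q k x) + dist (q k x) (\<gamma> (real (t k)))"
        by (meson add_right_mono dist_triangle order_trans)
      also have "dist (q (Suc k) x) (q k x) \<le> T + \<Phi>"
        using walk_dist[of e "int k", OF e] nrm_e(2)[of "int k"] by (simp add: q_def dist_commute add.commute)
      finally show ?thesis using t[of k] t[of "Suc k"] by (simp add: dist_commute)
    qed
    show "q k \<in> \<Gamma>" for k unfolding q_def by (rule walk_in[OF e])
    show "f (int k) \<in> F" for k by (rule f)
    show "q (Suc k) = q k \<circ> (g (int k) \<circ> f (int k))" for k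
      using walk_Suc[of e "int k", OF e] by (simp add: q_def e_def add.commute)
  qed
qed

text \<open>The isometry \<open>h\<close> in \<open>close\<close> may vary with \<open>i\<close>, by an element moving a point of \<open>\<gamma>0\<close> at most
  by 2. By discreteness such a change costs boundedly many choices per letter, which
  replaces an injectivity radius.\<close>

lemma close_words_count:
  fixes V :: "(nat \<Rightarrow> 'a \<Rightarrow> 'a) set" and B :: nat
  assumes V: "V \<subseteq> ({..<N} \<rightarrow>\<^sub>E A)" and A: "A \<subseteq> \<Gamma>"
    and t0: "\<And>w. w \<in> V \<Longrightarrow> t w 0 = (0::nat)"
    and t: "\<And>w k. w \<in> V \<Longrightarrow> dist (\<gamma> w (real (t w k))) (q w k x) \<le> width"
    and tB: "\<And>w k. w \<in> V \<Longrightarrow> \<bar>real (t w (Suc k)) - real (t w k)\<bar> \<le> real B"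
    and q: "\<And>w k. w \<in> V \<Longrightarrow> q w k \<in> \<Gamma>" and f: "\<And>w k. w \<in> V \<Longrightarrow> f w k \<in> F"
    and qS: "\<And>w k. w \<in> V \<Longrightarrow> k < N \<Longrightarrow> q w (Suc k) = q w k \<circ> (w k \<circ> f w k)"
    and close: "\<And>w i. w \<in> V \<Longrightarrow> i < N * B + 1 \<Longrightarrow>
       \<exists>h\<in>\<Gamma>. \<forall>s. \<bar>s\<bar> \<le> real B \<longrightarrow> dist (\<gamma>0 (real i + s)) (h (\<gamma> w (real i + s))) \<le> 1"
  shows "card V \<le> ((2 * B + 1) * (card (displ (2 * width + 4)) ^ 3 * card F)) ^ N"
proof -
  define D where "D = width + 1"
  let ?U = "displ (2 * width + 4)"
  obtain h where h: "\<And>w i. w \<in> V \<Longrightarrow> i < N * B + 1 \<Longrightarrow> h w i \<in> \<Gamma>"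
    and hc: "\<And>w i s. w \<in> V \<Longrightarrow> i < N * B + 1 \<Longrightarrow> \<bar>s\<bar> \<le> real B \<Longrightarrow> dist (\<gamma>0 (real i + s)) (h w i (\<gamma> w (real i + s))) \<le> 1"
    using close by metis
  have t_le: "t w k \<le> k * B" if "w \<in> V" for w k
  proof (induction k)
    case (Suc k)
    have "real (t w (Suc k)) \<le> real (t w k) + real B" using tB[OF that, of k] by linarith
    then have "t w (Suc k) \<le> t w k + B" by linarith
    then show ?case using Suc by simp
  qed (simp add: t0[OF that])
  have t_less: "t w k < N * B + 1" if "w \<in> V" "k \<le> N" for w k
    using t_le[OF that(1), of k] mult_le_mono1[OF that(2), of B] by linarith
  \<comment> \<open>Carries the path of the word w to the side of \<open>\<gamma>0\<close>, with the
    isometry available at the current time.\<close>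
  define a where "a w k = h w (t w k) \<circ> q w k" for w k
  have a\<Gamma>: "a w k \<in> \<Gamma>" if "w \<in> V" "k \<le> N" for w k
    unfolding a_def using that h[OF _ t_less] q by (intro comp_\<Gamma>) auto
  have a: "dist (\<gamma>0 (real (t w k))) (a w k x) \<le> D" if wk: "w \<in> V" "k \<le> N" for w k
  proof -
    let ?h = "h w (t w k)"
    have "dist (\<gamma>0 (real (t w k))) (?h (\<gamma> w (real (t w k)))) \<le> 1"
      using hc[OF wk(1) t_less[OF wk], of 0] by simp
    moreover have "dist (?h (\<gamma> w (real (t w k)))) (?h (q w k x)) \<le> width"
      using t[OF wk(1)] isom_\<Gamma>[OF h[OF wk(1) t_less[OF wk]]] by simp
    ultimately show ?thesis
      using dist_triangle[of "\<gamma>0 (real (t w k))" "?h (q w k x)" "?h (\<gamma> w (real (t w k)))"] by (simp add: a_def D_def)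
  qed
  \<comment> \<open>A reference element that depends on the time but not on the word; relative to it
    \<open>a w k\<close> takes boundedly many values.\<close>
  define C where "C s = (SOME g. g \<in> \<Gamma> \<and> dist (\<gamma>0 (real s)) (g x) \<le> D)" for s :: nat
  have C: "C (t w k) \<in> \<Gamma>" "dist (\<gamma>0 (real (t w k))) (C (t w k) x) \<le> D" if "w \<in> V" "k \<le> N" for w k
    using someI[of "\<lambda>g. g \<in> \<Gamma> \<and> dist (\<gamma>0 (real (t w k))) (g x) \<le> D" "a w k"] a[OF that] a\<Gamma>[OF that]
    by (auto simp: C_def)
  define b where "b w k = ginv (C (t w k)) \<circ> a w k" for w k
  have b: "b w k \<in> ?U" if wk: "w \<in> V" "k \<le> N" for w k
  proof -
    have "dist (C (t w k) x) (a w k x) \<le> 2 * D"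
      using dist_triangle3[of "C (t w k) x" "a w k x" "\<gamma>0 (real (t w k))"] a[OF wk] C[OF wk] by linarith
    then have "nrm (b w k) \<le> 2 * width + 4"
      using dist_shift[OF C(1)[OF wk]] by (simp add: b_def D_def)
    then show ?thesis using C(1)[OF wk] a\<Gamma>[OF wk] by (simp add: b_def comp_\<Gamma> inv_\<Gamma>)
  qed
  have Cb: "C (t w k) \<circ> b w k = a w k" if "w \<in> V" "k \<le> N" for w k
    unfolding b_def using C(1)[OF that] by (simp add: comp_assoc[symmetric])
  \<comment> \<open>The discrepancy between the aligning isometries at consecutive times, conjugated
    back to x. At the later time both are usable, since the times differ by at most B; so it moves
    \<open>\<gamma>0\<close> there by at most 2, which gives the bound 2 * D + 2 = 2 * width +
    4.\<close>
  define u where "u w k = ginv (a w (Suc k)) \<circ> (h w (t w k) \<circ> ginv (h w (t w (Suc k))) \<circ> a w (Suc k))" for w k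
  have u: "u w k \<in> ?U" if wk: "w \<in> V" "k < N" for w k
  proof -
    have k: "k \<le> N" "Suc k \<le> N" using wk by auto
    note H = h[OF wk(1) t_less[OF wk(1) k(1)]] h[OF wk(1) t_less[OF wk(1) k(2)]]
    note ak = a\<Gamma>[OF wk(1) k(2)]
    let ?p = "\<gamma>0 (real (t w (Suc k)))" and ?z = "\<gamma> w (real (t w (Suc k)))"
    let ?v = "h w (t w k) \<circ> ginv (h w (t w (Suc k)))"
    have v: "?v \<in> \<Gamma>" using H by (intro comp_\<Gamma> inv_\<Gamma>)
    have "dist ?p (h w (t w k) ?z) \<le> 1"
      using hc[OF wk(1) t_less[OF wk(1) k(1)], of "real (t w (Suc k)) - real (t w k)"] tB[OF wk(1), of k] by simp
    moreover have "dist ?p (h w (t w (Suc k)) ?z) \<le> 1"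
      using hc[OF wk(1) t_less[OF wk(1) k(2)], of 0] by simp
    then have "dist (?v ?p) (?v (h w (t w (Suc k)) ?z)) \<le> 1" using isom_\<Gamma>[OF v] by simp
    moreover have "?v (h w (t w (Suc k)) ?z) = h w (t w k) ?z" using H by simp
    ultimately have vp: "dist ?p (?v ?p) \<le> 2"
      using dist_triangle2[of ?p "?v ?p" "h w (t w k) ?z"] by simp
    have "nrm (u w k) = dist (a w (Suc k) x) (?v (a w (Suc k) x))"
      using dist_shift[OF ak] by (simp add: u_def)
    also have "\<dots> \<le> dist (a w (Suc k) x) ?p + dist ?p (?v ?p) + dist (?v ?p) (?v (a w (Suc k) x))"
      by (meson add_right_mono dist_triangle order_trans)
    also have "dist (?v ?p) (?v (a w (Suc k) x)) = dist ?p (a w (Suc k) x)" by (rule isom_\<Gamma>[OF v])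
    finally have "nrm (u w k) \<le> 2 * width + 4"
      using vp a[OF wk(1) k(2)] by (simp add: D_def dist_commute)
    moreover have "u w k \<in> \<Gamma>" unfolding u_def by (intro comp_\<Gamma>[OF inv_\<Gamma>[OF ak]] comp_\<Gamma>[OF v ak])
    ultimately show ?thesis by simp
  qed
  have step: "w k \<circ> f w k = ginv (a w k) \<circ> (a w (Suc k) \<circ> u w k)" if wk: "w \<in> V" "k < N" for w k
  proof
    fix p
    have k: "k \<le> N" "Suc k \<le> N" using wk by auto
    note H = h[OF wk(1) t_less[OF wk(1) k(1)]] h[OF wk(1) t_less[OF wk(1) k(2)]]
    have "(a w (Suc k) \<circ> u w k) p = h w (t w k) (ginv (h w (t w (Suc k))) (a w (Suc k) p))"
      using a\<Gamma>[OF wk(1) k(2)] by (simp add: u_def)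
    also have "\<dots> = h w (t w k) (q w (Suc k) p)" using H by (simp add: a_def)
    also have "\<dots> = a w k ((w k \<circ> f w k) p)" by (simp add: a_def qS[OF wk])
    finally show "(w k \<circ> f w k) p = (ginv (a w k) \<circ> (a w (Suc k) \<circ> u w k)) p"
      using a\<Gamma>[OF wk(1) k(1)] by simp
  qed
  let ?Code = "{- int B..int B} \<times> ?U \<times> ?U \<times> ?U \<times> F"
  \<comment> \<open>Decoding: the increments give the times, these give \<open>C\<close>, which with
    b gives a; then u yields \<open>w k \<circ> f w k\<close>, and f removes the inserted letter.
    Only the increment has a range that grows with B.\<close>
  define code where "code w = (\<lambda>k\<in>{..<N}. (int (t w (Suc k)) - int (t w k), b w k, b w (Suc k), u w k, f w k))" for w
  have "code ` V \<subseteq> {..<N} \<rightarrow>\<^sub>E ?Code"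
  proof (intro image_subsetI PiE_I)
    fix w k assume w: "w \<in> V" and k: "k \<in> {..<N}"
    have "\<bar>int (t w (Suc k)) - int (t w k)\<bar> \<le> int B" using tB[OF w, of k] by linarith
    then have "int (t w (Suc k)) - int (t w k) \<in> {- int B..int B}" by auto
    then show "code w k \<in> ?Code" using k b[OF w, of k] b[OF w, of "Suc k"] u[OF w, of k] f[OF w, of k] by (simp add: code_def)
  qed (simp add: code_def)
  note code = this
  have "inj_on code V"
  proof (rule inj_onI)
    fix v w assume vw: "v \<in> V" "w \<in> V" "code v = code w"
    have eq: "int (t v (Suc k)) - int (t v k) = int (t w (Suc k)) - int (t w k)" "b v k = b w k" "b v (Suc k) = b w (Suc k)" "u v k = u w k" "f v k = f w k"
      if "k < N" for k
      using fun_cong[OF vw(3), of k] that by (simp_all add: code_def)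
    have teq: "k \<le> N \<Longrightarrow> t v k = t w k" for k
    proof (induction k)
      case (Suc k)
      then show ?case using eq(1)[of k] by simp
    qed (simp add: t0 vw)
    show "v = w"
    proof (rule PiE_ext)
      show "v \<in> {..<N} \<rightarrow>\<^sub>E A" "w \<in> {..<N} \<rightarrow>\<^sub>E A" using vw V by auto
      fix k assume "k \<in> {..<N}"
      then have k: "k < N" "k \<le> N" "Suc k \<le> N" by auto
      have "a v k = a w k" "a v (Suc k) = a w (Suc k)"
        using Cb[OF vw(1) k(2)] Cb[OF vw(2) k(2)] Cb[OF vw(1) k(3)] Cb[OF vw(2) k(3)] eq[OF k(1)] teq[OF k(2)] teq[OF k(3)]
        by simp_all
      then have "v k \<circ> f v k = w k \<circ> f v k"
        using step[OF vw(1) k(1)] step[OF vw(2) k(1)] eq[OF k(1)] by simp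
      then have "(v k \<circ> f v k) \<circ> ginv (f v k) = (w k \<circ> f v k) \<circ> ginv (f v k)" by simp
      then show "v k = w k" using f[OF vw(1), of k] F_\<Gamma> by (simp add: comp_assoc subset_iff)
    qed
  qed
  moreover have "finite ({..<N} \<rightarrow>\<^sub>E ?Code)"
    using discrete finite_F by (intro finite_PiE finite_cartesian_product) auto
  ultimately have "card V \<le> card ({..<N} \<rightarrow>\<^sub>E ?Code)" using code by (intro card_inj_on_le)
  also have "\<dots> = card ?Code ^ N" by (simp add: card_PiE)
  also have "card ?Code = (2 * B + 1) * (card ?U ^ 3 * card F)"
  proof -
    have "card {- int B..int B} = 2 * B + 1" by (simp add: nat_add_distrib nat_mult_distrib)
    then show ?thesis unfolding card_cartesian_product by (simp only: power3_eq_cube mult.assoc)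
  qed
  finally show ?thesis .
qed

section \<open>A compact invariant set carrying the lines of words\<close>

definition near_lines :: "real \<Rightarrow> (real \<Rightarrow> 'a) set set" where
  "near_lines R = proj ` {\<gamma> \<in> Geod. \<forall>t. infdist (\<gamma> t) orb \<le> R}"

text \<open>Each of these orbits has a representative starting within R + 1 of x, and such
  representatives form a compact set of lines.\<close>

lemma compactin_near_lines: "compactin (quotient_geod \<Gamma>) (near_lines R)"
proof -
  let ?S = "{\<gamma> \<in> Geod. dist x (\<gamma> 0) \<le> R + 1 \<and> (\<forall>t. infdist (\<gamma> t) orb \<le> R)}"
  have "compactin geod_topology ?S"
    by (rule compactin_geod_topology[OF compact_cocompact_lines]) auto
  then have "compactin (quotient_geod \<Gamma>) (proj ` ?S)"
    using quotient_imp_continuous_map[OF quotient_map_geod_orbit] by (rule image_compactin)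
  moreover have "proj \<gamma> \<in> proj ` ?S" if \<gamma>: "\<gamma> \<in> Geod" "\<forall>t. infdist (\<gamma> t) orb \<le> R" for \<gamma>
  proof -
    have "infdist (\<gamma> 0) orb < R + 1" using \<gamma>(2) by (metis add.commute le_less_trans less_add_one)
    then obtain g where g: "g \<in> \<Gamma>" "dist (\<gamma> 0) (g x) < R + 1" by (rule orb_near)
    have "ginv g \<circ> \<gamma> \<in> ?S"
      using \<gamma> g comp_Geod[OF inv_\<Gamma>[OF g(1)]] infdist_orb[OF inv_\<Gamma>[OF g(1)]] dist_shift[OF g(1), of x "\<gamma> 0"]
      by (simp add: dist_commute less_imp_le)
    then show ?thesis using proj_comp[OF inv_\<Gamma>[OF g(1)], of \<gamma>] by (metis (no_types, lifting) imageI)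
  qed
  then have "proj ` ?S = near_lines R" unfolding near_lines_def by blast
  ultimately show ?thesis by simp
qed

lemma near_lines_flow: "\<omega> \<in> near_lines R \<Longrightarrow> (quotient_flow 1 ^^ i) \<omega> \<in> near_lines R"
  unfolding near_lines_def using geodesic_flow_Geod
  by (force simp: quotient_flow_power geodesic_flow_def)

text \<open>Compactness makes an arbitrary \<rho> control \<open>compact_dist\<close> uniformly.
  Since the height is bounded here, small distances come from an isometry and not from the detour
  through infinity.\<close>

lemma near_lines_uniform:
  assumes \<rho>: "Metric_space (proj ` Geod) \<rho>" "Metric_space.mtopology (proj ` Geod) \<rho> = quotient_geod \<Gamma>"
    and R: "0 \<le> R"
  obtains r where "0 < r"
    "\<And>a b. proj a \<in> near_lines R \<Longrightarrow> proj b \<in> near_lines R \<Longrightarrow> a \<in> Geod \<Longrightarrow> b \<in> Geod \<Longrightarrow> \<rho> (proj a) (proj b) < r \<Longrightarrow>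
       \<exists>h\<in>\<Gamma>. \<forall>s. \<bar>s\<bar> \<le> B \<longrightarrow> dist (a s) (h (b s)) \<le> 1"
proof -
  \<comment> \<open>The first bound converts \<open>line_dist\<close> into distance at most 1 for
    \<bar>s\<bar> \<le> B; the second stays below the weight of every point of
    \<open>near_lines R\<close>.\<close>
  define \<epsilon> where "\<epsilon> = min (1 / (1 + B\<^sup>2)) (1 / (1 + R))"
  have \<epsilon>: "0 < \<epsilon>" using R one_plus_square_pos[of B] by (simp add: \<epsilon>_def)
  obtain r where r: "0 < r" "\<And>y z. y \<in> near_lines R \<Longrightarrow> z \<in> near_lines R \<Longrightarrow> \<rho> y z < r \<Longrightarrow> compact_dist y z < \<epsilon>"
    using same_topology_uniform[OF \<rho>(1) Metric_space_compact_dist _ _ \<epsilon>, of "near_lines R"]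
      \<rho>(2) mtopology_compact_dist compactin_near_lines by auto
  show thesis
  proof (rule that[OF r(1)])
    fix a b assume ab: "proj a \<in> near_lines R" "proj b \<in> near_lines R" "a \<in> Geod" "b \<in> Geod" "\<rho> (proj a) (proj b) < r"
    obtain a' where a': "proj a = proj a'" "\<forall>t. infdist (a' t) orb \<le> R"
      using ab(1) by (auto simp: near_lines_def)
    have "height (proj a) \<le> R" unfolding a'(1) height_proj using a'(2) by blast
    then have "1 / (1 + R) \<le> weight (proj a)"
      unfolding weight_def using height_nonneg[of "proj a"] by (intro divide_left_mono) auto
    then have "\<epsilon> \<le> weight (proj a)" by (simp add: \<epsilon>_def)
    then obtain h where h: "h \<in> \<Gamma>" "line_dist a (h \<circ> b) < \<epsilon>"
      using compact_dist_less[OF ab(3,4) r(2)[OF ab(1,2,5)]] by blast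
    have "dist (a s) (h (b s)) \<le> 1" if s: "\<bar>s\<bar> \<le> B" for s
    proof -
      have "dist (a s) ((h \<circ> b) s) \<le> line_dist a (h \<circ> b) * (1 + s\<^sup>2)"
        using ab h by (intro dist_le_line_dist comp_Geod)
      also have "\<dots> \<le> 1 / (1 + B\<^sup>2) * (1 + B\<^sup>2)"
      proof (intro mult_mono)
        show "line_dist a (h \<circ> b) \<le> 1 / (1 + B\<^sup>2)" using h by (simp add: \<epsilon>_def)
        show "1 + s\<^sup>2 \<le> 1 + B\<^sup>2" using s by (simp add: abs_le_square_iff[symmetric])
      qed (use one_plus_square_pos[of s] in auto)
      finally show ?thesis using one_plus_square_pos[of B] by simp
    qed
    then show "\<exists>h\<in>\<Gamma>. \<forall>s. \<bar>s\<bar> \<le> B \<longrightarrow> dist (a s) (h (b s)) \<le> 1" using h by blast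
  qed
qed

text \<open>One dynamical ball contains the lines of at most Q ^ N words of length N, so a cover has
  at least (card A / Q) ^ N members. Since each letter advances the time by at most B, the horizon N
  * B + 1 sees all letters.\<close>

lemma scale_entropy_ge:
  assumes A: "finite A" "A \<noteq> {}" "A \<subseteq> \<Gamma>" "\<forall>g\<in>A. min_len \<le> nrm g \<and> nrm g \<le> T"
    and \<rho>: "Metric_space (proj ` Geod) \<rho>" "Metric_space.mtopology (proj ` Geod) \<rho> = quotient_geod \<Gamma>"
    and B: "T + \<Phi> + 2 * width \<le> real B"
  defines "Q \<equiv> (2 * B + 1) * (card (displ (2 * width + 4)) ^ 3 * card F)"
  obtains K r where "compactin (quotient_geod \<Gamma>) K" "0 < r"
    "ereal (max 0 ((ln (real (card A)) - ln (real Q)) / real B)) \<le> scale_entropy (proj ` Geod) \<rho> (quotient_flow 1) K r"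
proof -
  interpret \<rho>: Metric_space "proj ` Geod" \<rho> by fact
  have T: "0 \<le> T" using A zero_le_dist order_trans by (metis all_not_in_conv)
  define R where "R = T + \<Phi> + width"
  have R: "0 \<le> R" using T \<Phi>_nonneg width_pos by (simp add: R_def)
  have Bpos: "0 < B" using B T \<Phi>_nonneg width_pos by (cases B) auto
  obtain r where r: "0 < r"
    "\<And>a b. proj a \<in> near_lines R \<Longrightarrow> proj b \<in> near_lines R \<Longrightarrow> a \<in> Geod \<Longrightarrow> b \<in> Geod \<Longrightarrow> \<rho> (proj a) (proj b) < r \<Longrightarrow>
       \<exists>h\<in>\<Gamma>. \<forall>s. \<bar>s\<bar> \<le> real B \<longrightarrow> dist (a s) (h (b s)) \<le> 1"
    using near_lines_uniform[OF \<rho> R] by metis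
  obtain a0 where a0: "a0 \<in> A" using A(2) by blast
  have Q: "0 < Q" using choices_pos by (simp add: Q_def)
  define \<kappa> where "\<kappa> = ln (real (card A)) - ln (real Q)"
  have cA: "0 < card A" using A by (simp add: card_gt_0_iff)
  have count: "real (card A) ^ N \<le> real (card S) * real Q ^ N"
    if S: "finite S" "near_lines R \<subseteq> (\<Union>s\<in>S. Metric_space.mball (proj ` Geod) (dynamical_metric (quotient_flow 1) \<rho> (N * B + 1)) s (r / 2))"
    for S N
  proof -
    define n where "n = N * B + 1"
    have n: "0 < n" by (simp add: n_def)
    interpret d: Metric_space "proj ` Geod" "dynamical_metric (quotient_flow 1) \<rho> n"
      by (rule Metric_space_dynamical_metric[OF \<rho>(1) quotient_flow_closed n])
    note S = S[folded n_def]
    let ?W = "{..<N} \<rightarrow>\<^sub>E A"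
    \<comment> \<open>Only positions 0 to N - 1 are free; the filler a0 makes the sequence
      bi-infinite, as a complete line requires.\<close>
    define word where "word w k = (if 0 \<le> k \<and> k < int N then w (nat k) else a0)" for w and k :: int
    have word: "word w k \<in> \<Gamma>" "min_len \<le> nrm (word w k)" "nrm (word w k) \<le> T" if w: "w \<in> ?W" for w k
    proof -
      have "word w k \<in> A" using a0 PiE_mem[OF w, of "nat k"] by (auto simp: word_def)
      then show "word w k \<in> \<Gamma>" "min_len \<le> nrm (word w k)" "nrm (word w k) \<le> T" using A by auto
    qed
    define good where "good w \<gamma> t f q \<longleftrightarrow> \<gamma> \<in> Geod \<and> (\<forall>s. infdist (\<gamma> s) orb \<le> R) \<and> t 0 = (0::nat) \<and>
      (\<forall>k. dist (\<gamma> (real (t k))) (q k x) \<le> width) \<and> (\<forall>k. \<bar>real (t (Suc k)) - real (t k)\<bar> \<le> real B) \<and>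
      (\<forall>k. q k \<in> \<Gamma>) \<and> (\<forall>k. f k \<in> F) \<and> (\<forall>k<N. q (Suc k) = q k \<circ> (w k \<circ> f k))" for w \<gamma> t f q
    have "\<exists>\<gamma> t f q. good w \<gamma> t f q" if w: "w \<in> ?W" for w
    proof (rule word_line[of "word w" T])
      fix \<gamma> t f q
      assume *: "\<gamma> \<in> Geod" "\<And>s. infdist (\<gamma> s) orb \<le> T + \<Phi> + width" "t 0 = (0::nat)"
        "\<And>k. dist (\<gamma> (real (t k))) (q k x) \<le> width"
        "\<And>k. \<bar>real (t (Suc k)) - real (t k)\<bar> \<le> T + \<Phi> + 2 * width"
        "\<And>k. q k \<in> \<Gamma>" "\<And>k. f k \<in> F" "\<And>k. q (Suc k) = q k \<circ> (word w (int k) \<circ> f k)"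
      have 1: "\<bar>real (t (Suc k)) - real (t k)\<bar> \<le> real B" for k using *(5)[of k] B by linarith
      have 2: "q (Suc k) = q k \<circ> (w k \<circ> f k)" if "k < N" for k using *(8)[of k] that by (simp add: word_def)
      have "good w \<gamma> t f q" unfolding good_def R_def
        by (intro conjI allI impI * 1 2)
      then show ?thesis by blast
    qed (rule word[OF w])+
    then obtain \<gamma> t f q where data: "\<And>w. w \<in> ?W \<Longrightarrow> good w (\<gamma> w) (t w) (f w) (q w)" by metis
    note data = data[unfolded good_def]
    have \<gamma>K: "proj (\<gamma> w) \<in> near_lines R" if "w \<in> ?W" for w using data that by (auto simp: near_lines_def)
    \<comment> \<open>Two lines in one ball of radius r / 2 are at dynamical distance below r from
      each other; the centre itself need not lie in \<open>near_lines R\<close>.\<close>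
    define V where "V s = {w \<in> ?W. proj (\<gamma> w) \<in> d.mball s (r / 2)}" for s
    have finW: "finite ?W" using A(1) by (intro finite_PiE) auto
    have "card (V s) \<le> Q ^ N" for s
    proof (cases "V s = {}")
      case False
      then obtain w0 where w0: "w0 \<in> V s" by blast
      show ?thesis
        unfolding Q_def
      proof (rule close_words_count[where t = t and \<gamma> = \<gamma> and q = q and f = f and ?\<gamma>0.0 = "\<gamma> w0"])
        show "V s \<subseteq> ?W" by (auto simp: V_def)
        fix w i assume w: "w \<in> V s" and i: "i < N * B + 1"
        have W: "w0 \<in> ?W" "w \<in> ?W" using w w0 by (auto simp: V_def)
        have "proj (\<gamma> w) \<in> d.mball s (r / 2)" "proj (\<gamma> w0) \<in> d.mball s (r / 2)" using w w0 by (auto simp: V_def)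
        then have "dynamical_metric (quotient_flow 1) \<rho> n (proj (\<gamma> w0)) (proj (\<gamma> w)) < r"
          using d.triangle[of "proj (\<gamma> w0)" s "proj (\<gamma> w)"] d.commute[of "proj (\<gamma> w0)" s] unfolding d.in_mball by linarith
        then have "\<rho> (proj (geodesic_flow (real i) (\<gamma> w0))) (proj (geodesic_flow (real i) (\<gamma> w))) < r"
          using i unfolding dynamical_metric_less_iff[OF n] n_def[symmetric] by (auto simp: quotient_flow_power)
        moreover have "proj (geodesic_flow (real i) (\<gamma> v)) \<in> near_lines R" "geodesic_flow (real i) (\<gamma> v) \<in> Geod" if "v \<in> ?W" for v
          using near_lines_flow[OF \<gamma>K[OF that], of i] data that by (auto simp: quotient_flow_power geodesic_flow_Geod)
        ultimately have "\<exists>h\<in>\<Gamma>. \<forall>s. \<bar>s\<bar> \<le> real B \<longrightarrow> dist (geodesic_flow (real i) (\<gamma> w0) s) (h (geodesic_flow (real i) (\<gamma> w) s)) \<le> 1"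
          using W by (intro r(2)) auto
        then show "\<exists>h\<in>\<Gamma>. \<forall>s. \<bar>s\<bar> \<le> real B \<longrightarrow> dist (\<gamma> w0 (real i + s)) (h (\<gamma> w (real i + s))) \<le> 1"
          by (simp add: geodesic_flow_def add.commute)
      qed (use data A(3) in \<open>auto simp: V_def\<close>)
    qed simp
    moreover have "?W \<subseteq> (\<Union>s\<in>S. V s)"
    proof
      fix w assume w: "w \<in> ?W"
      then obtain s where "s \<in> S" "proj (\<gamma> w) \<in> d.mball s (r / 2)" using \<gamma>K[OF w] S(2) by blast
      then show "w \<in> (\<Union>s\<in>S. V s)" using w by (auto simp: V_def)
    qed
    then have "card ?W \<le> card (\<Union>s\<in>S. V s)" using S(1) finW by (intro card_mono) (auto simp: V_def)
    then have "card ?W \<le> (\<Sum>s\<in>S. card (V s))" using card_UN_le[OF S(1), of V] by linarith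
    ultimately have "card ?W \<le> (\<Sum>s\<in>S. Q ^ N)" by (meson order_trans sum_mono)
    then have "card A ^ N \<le> card S * Q ^ N" by (simp add: card_PiE)
    then show ?thesis by (metis of_nat_le_iff of_nat_mult of_nat_power)
  qed
  have cover: "ereal (max 0 (real N * \<kappa>)) \<le> log_enat (ball_cover_number (proj ` Geod) (dynamical_metric (quotient_flow 1) \<rho> (N * B + 1)) (near_lines R) (r / 2))" for N
  proof -
    define m where "m = nat \<lceil>exp (max 0 (real N * \<kappa>))\<rceil>"
    have m: "exp (max 0 (real N * \<kappa>)) \<le> real m" unfolding m_def by (rule real_nat_ceiling_ge)
    have "m \<le> card S"
      if S: "finite S" "near_lines R \<subseteq> (\<Union>s\<in>S. Metric_space.mball (proj ` Geod) (dynamical_metric (quotient_flow 1) \<rho> (N * B + 1)) s (r / 2))" for S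
    proof -
      \<comment> \<open>Both powers are 1: the cover is nonempty, which accounts for the 0 in the
        maximum.\<close>
      have "real (card A) ^ 0 \<le> real (card S) * real Q ^ 0"
      proof -
        have "S \<noteq> {}"
        proof
          assume "S = {}"
          then have "real (card A) ^ N \<le> 0" using count[OF S] by simp
          moreover have "0 < real (card A) ^ N" using cA by simp
          ultimately show False by linarith
        qed
        then show ?thesis using S(1) by (simp add: Suc_le_eq card_gt_0_iff)
      qed
      then have 1: "1 \<le> real (card S)" by simp
      have "exp (real N * \<kappa>) = (real (card A) / real Q) ^ N"
        using cA Q by (simp add: \<kappa>_def exp_of_nat_mult exp_diff)
      also have "\<dots> \<le> real (card S)"
        using count[OF S] Q by (simp add: power_divide pos_divide_le_eq)
      finally have "exp (max 0 (real N * \<kappa>)) \<le> real (card S)" using 1 by (simp add: max_def)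
      then show ?thesis unfolding m_def by (simp add: ceiling_le_iff nat_le_iff)
    qed
    then have "enat m \<le> ball_cover_number (proj ` Geod) (dynamical_metric (quotient_flow 1) \<rho> (N * B + 1)) (near_lines R) (r / 2)"
      unfolding ball_cover_number_def by (intro INF_greatest) auto
    then have "log_enat (enat m) \<le> log_enat (ball_cover_number (proj ` Geod) (dynamical_metric (quotient_flow 1) \<rho> (N * B + 1)) (near_lines R) (r / 2))"
      by (rule log_enat_mono)
    moreover have m0: "0 < real m" using m exp_gt_zero less_le_trans by blast
    have "max 0 (real N * \<kappa>) \<le> ln (real m)" using m unfolding ln_ge_iff[OF m0] .
    then have "ereal (max 0 (real N * \<kappa>)) \<le> log_enat (enat m)"
      using m0 by (simp add: log_enat_def)
    ultimately show ?thesis by (rule order_trans[rotated])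
  qed
  show thesis
  proof (rule that[OF compactin_near_lines])
    show "0 < r / 2" using r by simp
    let ?X = "\<lambda>n. ereal (1 / real n) * log_enat (ball_cover_number (proj ` Geod) (dynamical_metric (quotient_flow 1) \<rho> n) (near_lines R) (r / 2))"
    \<comment> \<open>Covers are estimated at times N * B + 1 only; the limsup along this
      subsequence bounds the full one from below.\<close>
    let ?a = "\<lambda>N. max 0 (real N / real (N * B + 1) * \<kappa>)"
    have "?a \<longlonglongrightarrow> max 0 (1 / real B * \<kappa>)"
    proof (intro tendsto_max tendsto_const tendsto_mult)
      have "(\<lambda>N. 1 / (real B + 1 / real N)) \<longlonglongrightarrow> 1 / (real B + 0)"
        using Bpos by (intro tendsto_divide tendsto_add tendsto_const lim_1_over_n) auto
      moreover have "\<forall>\<^sub>F N in sequentially. 1 / (real B + 1 / real N) = real N / real (N * B + 1)"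
        using eventually_gt_at_top[of 0] by eventually_elim (simp add: field_simps)
      ultimately show "(\<lambda>N. real N / real (N * B + 1)) \<longlonglongrightarrow> 1 / real B"
        by (simp add: tendsto_cong)
    qed
    then have "(\<lambda>N. ereal (?a N)) \<longlonglongrightarrow> ereal (max 0 (\<kappa> / real B))"
      unfolding lim_ereal times_divide_eq_left mult_1_left .
    then have "ereal (max 0 (\<kappa> / real B)) = limsup (\<lambda>N. ereal (?a N))"
      by (intro lim_imp_Limsup[symmetric]) simp_all
    also have "\<dots> \<le> limsup (?X \<circ> (\<lambda>N. N * B + 1))"
    proof (rule Limsup_mono, rule always_eventually, rule allI)
      fix N
      have "ereal (?a N) = ereal (1 / real (N * B + 1)) * ereal (max 0 (real N * \<kappa>))"
        by (simp only: times_ereal.simps(1) max_mult_distrib_left) simp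
      also have "\<dots> \<le> (?X \<circ> (\<lambda>N. N * B + 1)) N"
        using cover[of N] by (auto intro!: ereal_mult_left_mono)
      finally show "ereal (?a N) \<le> (?X \<circ> (\<lambda>N. N * B + 1)) N" .
    qed
    also have "\<dots> \<le> limsup ?X"
      by (rule limsup_subseq_mono) (use Bpos in \<open>auto simp: strict_mono_def\<close>)
    finally show "ereal (max 0 ((ln (real (card A)) - ln (real Q)) / real B)) \<le> scale_entropy (proj ` Geod) \<rho> (quotient_flow 1) (near_lines R) (r / 2)"
      unfolding scale_entropy_def \<kappa>_def .
  qed
qed

section \<open>From alphabets to the critical exponent\<close>

lemma topological_entropy_ge_words:
  assumes A: "finite A" "A \<noteq> {}" "A \<subseteq> \<Gamma>" "\<forall>g\<in>A. min_len \<le> nrm g \<and> nrm g \<le> T"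
    and B: "T + \<Phi> + 2 * width \<le> real B"
  shows "ereal (max 0 ((ln (real (card A)) - ln (real ((2 * B + 1) * (card (displ (2 * width + 4)) ^ 3 * card F)))) / real B))
    \<le> topological_entropy (quotient_geod \<Gamma>) (quotient_flow 1)"
    (is "?h \<le> _")
proof -
  have T: "quotient_flow 1 \<omega> \<in> topspace (quotient_geod \<Gamma>)" if "\<omega> \<in> topspace (quotient_geod \<Gamma>)" for \<omega>
    using that quotient_flow_closed by (simp add: topspace_quotient)
  have "?h \<le> (SUP K\<in>{K. compactin (quotient_geod \<Gamma>) K}. SUP r\<in>{0<..}. scale_entropy (proj ` Geod) \<rho> (quotient_flow 1) K r)"
    if \<rho>: "Metric_space (proj ` Geod) \<rho>" "Metric_space.mtopology (proj ` Geod) \<rho> = quotient_geod \<Gamma>" for \<rho>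
  proof -
    obtain K r where "compactin (quotient_geod \<Gamma>) K" "0 < r" "?h \<le> scale_entropy (proj ` Geod) \<rho> (quotient_flow 1) K r"
      using scale_entropy_ge[where A = A and T = T and \<rho> = \<rho> and B = B, OF A \<rho> B] by blast
    then show ?thesis by (intro SUP_upper2[of K] SUP_upper2[of r]) auto
  qed
  then show ?thesis
    by (subst topological_entropy_eq[OF T]) (auto simp: topspace_quotient intro!: INF_greatest)
qed

lemma linear_le_exp:
  fixes \<alpha> \<beta> \<epsilon> T :: real
  assumes "0 < \<epsilon>" "0 \<le> \<alpha>" "0 \<le> \<beta>" "1 \<le> T" "2 * (\<alpha> + \<beta>) / \<epsilon>\<^sup>2 \<le> T"
  shows "\<alpha> + \<beta> * T \<le> exp (\<epsilon> * T)"
proof -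
  have "\<alpha> + \<beta> * T \<le> (\<alpha> + \<beta>) * T" using assms mult_left_mono[of 1 T \<alpha>] by (simp add: algebra_simps)
  also have "2 * (\<alpha> + \<beta>) \<le> \<epsilon>\<^sup>2 * T" using assms by (simp add: pos_divide_le_eq mult.commute)
  then have "(\<alpha> + \<beta>) * T \<le> \<epsilon>\<^sup>2 * T / 2 * T" using assms by (intro mult_right_mono) auto
  also have "\<dots> = (\<epsilon> * T)\<^sup>2 / 2" by (simp add: power2_eq_square)
  also have "\<dots> \<le> exp (\<epsilon> * T)"
  proof -
    have "0 \<le> \<epsilon> * T" using assms by simp
    then show ?thesis using exp_lower_Taylor_quadratic[of "\<epsilon> * T"] by linarith
  qed
  finally show ?thesis .
qed

text \<open>With s < s' strictly between the two sides, some large T has more than exp (s' * T)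
  orbit points within T. Taking all long elements up to T as alphabet, the time per letter is T plus
  a constant and the multiplicity is linear in T, so the gap s' - s outweighs both.\<close>

lemma topological_entropy_ge:
  assumes unbounded: "\<And>l. \<exists>g\<in>\<Gamma>. l \<le> nrm g"
  shows "critical_exponent x \<Gamma> \<le> topological_entropy (quotient_geod \<Gamma>) (quotient_flow 1)"
proof (rule ccontr)
  let ?h = "topological_entropy (quotient_geod \<Gamma>) (quotient_flow 1)"
  assume "\<not> ?thesis"
  then have less: "?h < critical_exponent x \<Gamma>" by (simp only: not_le)
  obtain g where g: "g \<in> \<Gamma>" "min_len \<le> nrm g" using unbounded by blast
  \<comment> \<open>A one-letter alphabet only serves to reach the 0 in the maximum. It gives s > 0,
    and hence exp (s * B) may be estimated from an upper bound for B.\<close>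
  have "(0::ereal) \<le> ereal (max 0 ((ln (real (card {g})) - ln (real ((2 * nat \<lceil>nrm g + \<Phi> + 2 * width\<rceil> + 1) * (card (displ (2 * width + 4)) ^ 3 * card F))))
     / real (nat \<lceil>nrm g + \<Phi> + 2 * width\<rceil>)))"
    unfolding zero_ereal_def ereal_less_eq by (rule max.cobounded1)
  also have "\<dots> \<le> ?h"
    by (rule topological_entropy_ge_words) (use g real_nat_ceiling_ge in auto)
  finally have h0: "0 \<le> ?h" .
  obtain s where s: "?h < ereal s" "ereal s < critical_exponent x \<Gamma>" using ereal_dense2[OF less] by blast
  obtain s' where s': "ereal s < ereal s'" "ereal s' < critical_exponent x \<Gamma>" using ereal_dense2[OF s(2)] by blast
  have s0: "0 < s" using h0 s(1) by (metis ereal_less(2) le_less_trans)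
  define \<epsilon> where "\<epsilon> = s' - s"
  have \<epsilon>: "0 < \<epsilon>" using s'(1) by (simp add: \<epsilon>_def)
  define \<kappa> where "\<kappa> = \<Phi> + 2 * width + 1"
  have \<kappa>: "1 \<le> \<kappa>" using \<Phi>_nonneg width_pos by (simp add: \<kappa>_def)
  define U where "U = real (card (displ (2 * width + 4)) ^ 3 * card F)"
  have U: "0 < U" using choices_pos by (simp add: U_def)
  \<comment> \<open>Counts the orbit points too close to x for letters of length at least
    \<open>min_len\<close>. The constants \<alpha> and \<beta> are read off by expanding N0 * exp (s
    * T) + (2 * (T + \<kappa>) + 1) * U * exp (s * (T + \<kappa>)).\<close>
  define N0 where "N0 = real (card (orb \<inter> ball x min_len))"
  define \<beta> where "\<beta> = 2 * U * exp (s * \<kappa>)"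
  define \<alpha> where "\<alpha> = N0 + (2 * \<kappa> + 1) * U * exp (s * \<kappa>)"
  have \<alpha>\<beta>: "0 \<le> \<alpha>" "0 \<le> \<beta>" using U \<kappa> by (auto simp: \<alpha>_def \<beta>_def N0_def)
  define T0 where "T0 = max 1 (2 * (\<alpha> + \<beta>) / \<epsilon>\<^sup>2)"
  have "\<exists>T\<ge>T0. ereal s' < ereal (1 / T * ln (real (card (orb \<inter> ball x T))))"
  proof (rule ccontr)
    assume "\<not> ?thesis"
    then have "\<forall>\<^sub>F T in at_top. ereal (1 / T * ln (real (card (orb \<inter> ball x T)))) \<le> ereal s'"
      unfolding eventually_at_top_linorder by (meson not_le)
    then have "critical_exponent x \<Gamma> \<le> ereal s'"
      unfolding critical_exponent_def by (rule Limsup_bounded)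
    then show False using s'(2) by simp
  qed
  then obtain T where T: "T0 \<le> T" "s' < 1 / T * ln (real (card (orb \<inter> ball x T)))" by auto
  have T1: "1 \<le> T" "2 * (\<alpha> + \<beta>) / \<epsilon>\<^sup>2 \<le> T" using T(1) by (auto simp: T0_def)
  have "x \<in> orb \<inter> ball x T" using T1 orb_self by simp
  then have pos: "0 < card (orb \<inter> ball x T)" using finite_orb_ball unfolding card_gt_0_iff by blast
  have "s' * T < ln (real (card (orb \<inter> ball x T)))" using T T1 by (simp add: field_simps)
  then have "exp (s' * T) < exp (ln (real (card (orb \<inter> ball x T))))" by simp
  then have big: "exp (s' * T) < real (card (orb \<inter> ball x T))" using pos by simp
  \<comment> \<open>Several elements may share an orbit point, but only a lower bound for the size
    of A is needed.\<close>
  define A where "A = {g \<in> \<Gamma>. min_len \<le> nrm g \<and> nrm g \<le> T}"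
  have finA: "finite A" by (rule finite_subset[OF _ discrete[of x T]]) (auto simp: A_def)
  have "orb \<inter> ball x T \<subseteq> (\<lambda>g. g x) ` A \<union> (orb \<inter> ball x min_len)"
    by (auto simp: orbit_of_def A_def)
  then have "card (orb \<inter> ball x T) \<le> card ((\<lambda>g. g x) ` A \<union> (orb \<inter> ball x min_len))"
    using finA finite_orb_ball by (intro card_mono) auto
  also have "\<dots> \<le> card A + card (orb \<inter> ball x min_len)"
    using card_Un_le card_image_le[OF finA, of "\<lambda>g. g x"] by (meson add_le_mono1 order_trans)
  finally have cardA: "exp (s' * T) \<le> real (card A) + N0" using big by (simp add: N0_def)
  define B where "B = nat \<lceil>T + \<Phi> + 2 * width\<rceil>"
  have B: "T + \<Phi> + 2 * width \<le> real B" unfolding B_def by (rule real_nat_ceiling_ge)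
  have BT: "real B \<le> T + \<kappa>" using T1 \<Phi>_nonneg width_pos by (simp add: B_def \<kappa>_def) linarith
  have Bpos: "0 < real B" using B T1 \<Phi>_nonneg width_pos by linarith
  have "N0 + (2 * real B + 1) * U * exp (s * real B) \<le> N0 * 1 + (2 * (T + \<kappa>) + 1) * U * exp (s * (T + \<kappa>))"
    using BT s0 U T1 \<kappa> by (intro add_mono mult_mono) auto
  also have "\<dots> \<le> N0 * exp (s * T) + (2 * (T + \<kappa>) + 1) * U * exp (s * (T + \<kappa>))"
    using s0 T1 by (intro add_right_mono mult_left_mono) (auto simp: N0_def)
  also have "\<dots> = (\<alpha> + \<beta> * T) * exp (s * T)"
    by (simp add: \<alpha>_def \<beta>_def exp_add algebra_simps)
  also have "\<dots> \<le> exp (\<epsilon> * T) * exp (s * T)"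
    using linear_le_exp[OF \<epsilon> \<alpha>\<beta> T1] by (intro mult_right_mono) auto
  also have "\<dots> = exp (s' * T)" by (simp add: \<epsilon>_def exp_add[symmetric] algebra_simps)
  finally have "(2 * real B + 1) * U * exp (s * real B) \<le> real (card A)" using cardA by linarith
  moreover have Q: "0 < (2 * real B + 1) * U" using U Bpos by simp
  ultimately have lnA: "ln ((2 * real B + 1) * U * exp (s * real B)) \<le> ln (real (card A))" and "0 < real (card A)"
    by (smt (verit) exp_gt_zero ln_mono mult_pos_pos)+
  then have A: "A \<noteq> {}" by auto
  have "ln ((2 * real B + 1) * U) + s * real B \<le> ln (real (card A))"
    using lnA ln_mult_pos[OF Q exp_gt_zero[of "s * real B"]] by simp
  then have "s \<le> (ln (real (card A)) - ln ((2 * real B + 1) * U)) / real B"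
    using Bpos by (simp add: pos_le_divide_eq)
  also have "(2 * real B + 1) * U = real ((2 * B + 1) * (card (displ (2 * width + 4)) ^ 3 * card F))"
    by (simp add: U_def algebra_simps)
  finally have "ereal s \<le> ereal (max 0 ((ln (real (card A)) - ln (real ((2 * B + 1) * (card (displ (2 * width + 4)) ^ 3 * card F)))) / real B))"
    unfolding ereal_less_eq le_max_iff_disj by (rule disjI2)
  also have "\<dots> \<le> ?h"
    by (rule topological_entropy_ge_words[OF finA A _ _ B]) (auto simp: A_def)
  finally show False using s(1) by simp
qed

end

theorem theorem1:
  fixes x :: "'a::metric_space" and \<Gamma> :: "('a \<Rightarrow> 'a) set"
  assumes "proper_space TYPE('a)"
    and "geodesic_space TYPE('a)"
    and "line_convex TYPE('a)"
    and "gromov_hyperbolic TYPE('a)"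
    and "subgroup \<Gamma> isom_group"
    and "discrete_isometries \<Gamma>"
    and "virtually_torsion_free (isom_group\<lparr>carrier := \<Gamma>\<rparr>)"
    and "non_elementary x \<Gamma>"
    and "ergodic_entropy x \<Gamma> < \<infinity>"
  shows "topological_entropy (quotient_geod \<Gamma>) (quotient_flow 1) = critical_exponent x \<Gamma>"
proof -
  obtain \<delta> where \<delta>: "0 \<le> \<delta>" "\<And>p q r w :: 'a. min (gromov_product w p q) (gromov_product w q r) - \<delta> \<le> gromov_product w p r"
    using assms(4) unfolding gromov_hyperbolic_def by blast
  interpret isom: group "isom_group :: ('a \<Rightarrow> 'a) monoid" by (rule group_isom_group)
  interpret sub: subgroup \<Gamma> isom_group by (rule assms(5))
  have iso: "bij g" "\<And>p q. dist (g p) (g q) = dist p q" if "g \<in> \<Gamma>" for g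
    using sub.subset that by (auto simp: isom_group_def)
  \<comment> \<open>The abstract group inverse is a left inverse of the bijection g and therefore
    equals \<open>ginv g\<close>.\<close>
  have inv: "ginv g \<in> \<Gamma>" if g: "g \<in> \<Gamma>" for g
  proof -
    let ?h = "inv\<^bsub>isom_group\<^esub> g"
    have h: "?h \<in> \<Gamma>" using g by (rule sub.m_inv_closed)
    have "?h \<circ> g = id"
      using isom.l_inv[of g] sub.subset g by (auto simp: isom_group_def)
    then have "?h (g p) = p" for p by (simp add: fun_eq_iff)
    then have "ginv g = ?h"
      using iso(1)[OF g] by (intro ext) (metis bij_inv_eq_iff)
    then show ?thesis using h by simp
  qed
  interpret hyperbolic_group x \<Gamma> \<delta>
  proof
    show "compact (cball p r)" for p :: 'a and r using assms(1) by (simp add: proper_space_def)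
    show "\<exists>c::real \<Rightarrow> 'a. c 0 = p \<and> c (dist p q) = q \<and>
        (\<forall>s\<in>{0..dist p q}. \<forall>t\<in>{0..dist p q}. dist (c s) (c t) = \<bar>s - t\<bar>)" for p q
      using assms(2) unfolding geodesic_space_def by blast
    show "convex_on UNIV (\<lambda>t. dist (\<gamma> t) (\<gamma>' t))" if "geodesic_line \<gamma>" "geodesic_line \<gamma>'" for \<gamma> \<gamma>' :: "real \<Rightarrow> 'a"
      using assms(3) that unfolding line_convex_def by blast
    show "id \<in> \<Gamma>" using sub.one_closed by (simp add: isom_group_def)
    show "g \<circ> h \<in> \<Gamma>" if "g \<in> \<Gamma>" "h \<in> \<Gamma>" for g h
      using sub.m_closed[OF that] by (simp add: isom_group_def)
    show "finite {g \<in> \<Gamma>. dist p (g p) \<le> R}" for p R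
    proof (rule finite_subset)
      show "{g \<in> \<Gamma>. dist p (g p) \<le> R} \<subseteq> {g \<in> \<Gamma>. dist p (g p) \<le> max 0 R}" by auto
      show "finite {g \<in> \<Gamma>. dist p (g p) \<le> max 0 R}"
        using assms(6) unfolding discrete_isometries_def by simp
    qed
  qed (use \<delta> iso inv in auto)
  obtain c F where F: "0 \<le> c" "finite F" "F \<subseteq> \<Gamma>" "\<And>y z. \<exists>f\<in>F. gromov_product x y (f z) \<le> c"
    using extension_set[OF assms(8)] by blast
  interpret extended_group x \<Gamma> \<delta> F c "Max (nrm ` F)"
    by unfold_locales (use F in auto)
  have "\<exists>g\<in>\<Gamma>. l \<le> nrm g" for l
    using three_directions[OF assms(8)] by metis
  then have "critical_exponent x \<Gamma> \<le> topological_entropy (quotient_geod \<Gamma>) (quotient_flow 1)"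
    by (rule topological_entropy_ge)
  with topological_entropy_le show ?thesis by (rule antisym)
qed

end
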